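(* Work in $\mathsf{ZF}+\mathsf{AD}^+$ and assume $V=\mathrm{L}\bigl(\wp(\mathbb{R})\bigr)$. Suppose that $\Theta$ is regular. Then there is a poset $\mathbb{P}$ whose underlying set is $\Theta$ such that for every $\mathbb{P}$-generic filter $G$ over $V$, there is a subset of $\Theta^{V}$ which belongs to $V[G]\setminus V$, and $\mathsf{AD}$ holds in $V[G]$.
   Context: $\Theta$ denotes the supremum of the ordinals that are surjective images of $\mathbb{R}$. $\mathsf{AD}$ is the Axiom of Determinacy and $\mathsf{AD}^+$ is Woodin's strengthening of $\mathsf{AD}$. *)

theory Defs
  imports Main
begin

text \<open>
  A universe of sets is a structure consisting of a type and a binary relation on it.
  ``Work in ZF'' means: let the structure be an arbitrary model (of any cardinality, not
  necessarily well-founded) of the first-order theory ZF. Separation and Replacement are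
  therefore schemas over first-order formulas, not over arbitrary HOL predicates. All notions
  below that are evaluated inside a structure quantify only over elements of that structure, so
  they are first-order notions and are interpreted internally.
\<close>

datatype fm = Mem nat nat | Eq nat nat | Neg fm | Conj fm fm | All nat fm

locale set_structure =
  fixes mem :: "'a \<Rightarrow> 'a \<Rightarrow> bool"
begin

definition elts :: "'a \<Rightarrow> 'a set" where
  "elts x = {z. mem z x}"

text \<open>
  Meaningful only when some element of the structure has extension \<open>S\<close>; below this is always
  guaranteed by ZF.
\<close>
definition setof :: "'a set \<Rightarrow> 'a" where
  "setof S = (THE x. elts x = S)"

primrec sat :: "fm \<Rightarrow> (nat \<Rightarrow> 'a) \<Rightarrow> bool" where
  "sat (Mem i k) s \<longleftrightarrow> mem (s i) (s k)"
| "sat (Eq i k) s \<longleftrightarrow> s i = s k"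
| "sat (Neg \<phi>) s \<longleftrightarrow> \<not> sat \<phi> s"
| "sat (Conj \<phi> \<psi>) s \<longleftrightarrow> sat \<phi> s \<and> sat \<psi> s"
| "sat (All i \<phi>) s \<longleftrightarrow> (\<forall>a. sat \<phi> (s(i := a)))"

definition extensionality :: bool where
  "extensionality \<longleftrightarrow> (\<forall>x y. elts x = elts y \<longrightarrow> x = y)"

definition foundation :: bool where
  "foundation \<longleftrightarrow> (\<forall>x. elts x \<noteq> {} \<longrightarrow> (\<exists>y\<in>elts x. elts y \<inter> elts x = {}))"

definition pairing :: bool where
  "pairing \<longleftrightarrow> (\<forall>a b. \<exists>x. elts x = {a, b})"

definition union_axiom :: bool where
  "union_axiom \<longleftrightarrow> (\<forall>x. \<exists>u. elts u = (\<Union>y\<in>elts x. elts y))"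

definition power_set :: bool where
  "power_set \<longleftrightarrow> (\<forall>x. \<exists>p. elts p = {y. elts y \<subseteq> elts x})"

definition infinity :: bool where
  "infinity \<longleftrightarrow> (\<exists>x. (\<exists>e\<in>elts x. elts e = {}) \<and>
     (\<forall>y\<in>elts x. \<exists>z\<in>elts x. elts z = insert y (elts y)))"

text \<open>The assignment \<open>s\<close> supplies the parameters.\<close>

definition separation :: bool where
  "separation \<longleftrightarrow> (\<forall>\<phi> s a. \<exists>b. elts b = {x \<in> elts a. sat \<phi> (s(0 := x))})"

definition replacement :: bool where
  "replacement \<longleftrightarrow> (\<forall>\<phi> s a.
     (\<forall>x\<in>elts a. \<exists>!y. sat \<phi> (s(0 := x, 1 := y))) \<longrightarrow>
     (\<exists>b. elts b = {y. \<exists>x\<in>elts a. sat \<phi> (s(0 := x, 1 := y))}))"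

definition ZF :: bool where
  "ZF \<longleftrightarrow> extensionality \<and> foundation \<and> pairing \<and> union_axiom \<and> power_set \<and> infinity \<and>
     separation \<and> replacement"

definition opair :: "'a \<Rightarrow> 'a \<Rightarrow> 'a" where
  "opair a b = setof {setof {a}, setof {a, b}}"

definition suc :: "'a \<Rightarrow> 'a" where
  "suc x = setof (insert x (elts x))"

definition zero :: 'a where
  "zero = setof {}"

definition powerset :: "'a \<Rightarrow> 'a" where
  "powerset x = setof {y. elts y \<subseteq> elts x}"

definition transitive :: "'a \<Rightarrow> bool" where
  "transitive x \<longleftrightarrow> (\<forall>y\<in>elts x. elts y \<subseteq> elts x)"

definition trcl :: "'a \<Rightarrow> 'a" where
  "trcl x = setof {z. \<forall>t. transitive t \<and> elts x \<subseteq> elts t \<longrightarrow> z \<in> elts t}"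

definition ordinal :: "'a \<Rightarrow> bool" where
  "ordinal x \<longleftrightarrow> transitive x \<and> (\<forall>y\<in>elts x. transitive y)"

definition limit_ordinal :: "'a \<Rightarrow> bool" where
  "limit_ordinal x \<longleftrightarrow> ordinal x \<and> elts x \<noteq> {} \<and> (\<forall>y\<in>elts x. suc y \<in> elts x)"

definition omega :: 'a where
  "omega = (THE w. limit_ordinal w \<and> (\<forall>n\<in>elts w. \<not> limit_ordinal n))"

definition fun_on :: "'a \<Rightarrow> 'a \<Rightarrow> bool" where
  "fun_on f a \<longleftrightarrow>
     (\<forall>p\<in>elts f. \<exists>x\<in>elts a. \<exists>y. p = opair x y) \<and>
     (\<forall>x\<in>elts a. \<exists>!y. opair x y \<in> elts f)"

definition app :: "'a \<Rightarrow> 'a \<Rightarrow> 'a" where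
  "app f x = (THE y. opair x y \<in> elts f)"

definition maps :: "'a \<Rightarrow> 'a \<Rightarrow> 'a \<Rightarrow> bool" where
  "maps f a b \<longleftrightarrow> fun_on f a \<and> (\<forall>x\<in>elts a. app f x \<in> elts b)"

definition funs :: "'a \<Rightarrow> 'a \<Rightarrow> 'a" where
  "funs a b = setof {f. maps f a b}"

definition restr :: "'a \<Rightarrow> 'a \<Rightarrow> 'a" where
  "restr f a = setof {p \<in> elts f. \<exists>x\<in>elts a. \<exists>y. p = opair x y}"

definition finite_seqs :: "'a \<Rightarrow> 'a" where
  "finite_seqs a = setof {s. \<exists>n\<in>elts omega. maps s n a}"

text \<open>As usual under determinacy, the reals are the elements of Baire space.\<close>
definition reals :: 'a where
  "reals = funs omega omega"

definition surj_image_of_reals :: "'a \<Rightarrow> bool" where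
  "surj_image_of_reals a \<longleftrightarrow>
     (\<exists>f. maps f reals a \<and> (\<forall>y\<in>elts a. \<exists>x\<in>elts reals. app f x = y))"

text \<open>The supremum of a set of ordinals is its union.\<close>
definition Theta :: 'a where
  "Theta = setof (\<Union>a\<in>{a. ordinal a \<and> surj_image_of_reals a}. elts a)"

definition regular :: "'a \<Rightarrow> bool" where
  "regular k \<longleftrightarrow> limit_ordinal k \<and>
     (\<forall>a\<in>elts k. \<forall>f. maps f a k \<longrightarrow> (\<exists>b\<in>elts k. \<forall>x\<in>elts a. app f x \<in> elts b))"

definition even_nat :: "'a \<Rightarrow> bool" where
  "even_nat n \<longleftrightarrow> (\<forall>e. zero \<in> elts e \<and> (\<forall>k\<in>elts e. suc (suc k) \<in> elts e) \<longrightarrow> n \<in> elts e)"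

text \<open>
  The game with moves in \<open>a\<close> and payoff \<open>B\<close>: player I makes the moves with even index, player II
  those with odd index, and I wins a play \<open>x\<close> iff \<open>x \<in> B\<close>.
\<close>
definition determined :: "'a \<Rightarrow> 'a set \<Rightarrow> bool" where
  "determined a B \<longleftrightarrow>
     (\<exists>\<sigma>. maps \<sigma> (finite_seqs a) a \<and>
        (\<forall>x\<in>elts (funs omega a).
           (\<forall>n\<in>elts omega. even_nat n \<longrightarrow> app x n = app \<sigma> (restr x n)) \<longrightarrow> x \<in> B)) \<or>
     (\<exists>\<sigma>. maps \<sigma> (finite_seqs a) a \<and>
        (\<forall>x\<in>elts (funs omega a).
           (\<forall>n\<in>elts omega. \<not> even_nat n \<longrightarrow> app x n = app \<sigma> (restr x n)) \<longrightarrow> x \<notin> B))"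

definition AD :: bool where
  "AD \<longleftrightarrow> (\<forall>A. elts A \<subseteq> elts reals \<longrightarrow> determined omega (elts A))"

definition DC_reals :: bool where
  "DC_reals \<longleftrightarrow> (\<forall>R. (\<forall>x\<in>elts reals. \<exists>y\<in>elts reals. opair x y \<in> elts R) \<longrightarrow>
     (\<exists>f. maps f omega reals \<and> (\<forall>n\<in>elts omega. opair (app f n) (app f (suc n)) \<in> elts R)))"

text \<open>
  Infinity-Borel codes are generated from the codes \<open>(0,(n,m))\<close> of the sets \<open>{x. x(n) = m}\<close> by
  \<open>(1,c)\<close> (complement) and \<open>(2,f)\<close> (union), where \<open>f\<close> is a function from an ordinal to codes.
  Here \<open>h\<close> assigns to each code in the set \<open>d\<close>, which is closed under subcodes, the set of reals
  it codes; \<open>h\<close> is unique by Foundation.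
\<close>
definition borel_evaluation :: "'a \<Rightarrow> 'a \<Rightarrow> bool" where
  "borel_evaluation d h \<longleftrightarrow> fun_on h d \<and> (\<forall>c\<in>elts d.
     (\<exists>n\<in>elts omega. \<exists>m\<in>elts omega. c = opair zero (opair n m) \<and>
        app h c = setof {x \<in> elts reals. app x n = m}) \<or>
     (\<exists>e\<in>elts d. c = opair (suc zero) e \<and>
        app h c = setof (elts reals - elts (app h e))) \<or>
     (\<exists>f a. c = opair (suc (suc zero)) f \<and> ordinal a \<and> maps f a d \<and>
        app h c = setof (\<Union>\<xi>\<in>elts a. elts (app h (app f \<xi>)))))"

definition infinity_borel :: "'a \<Rightarrow> bool" where
  "infinity_borel A \<longleftrightarrow> (\<exists>d h. borel_evaluation d h \<and> (\<exists>c\<in>elts d. app h c = A))"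

text \<open>Continuity with respect to the product topologies of the discrete spaces \<open>l\<close> and omega.\<close>
definition continuous_map :: "'a \<Rightarrow> 'a \<Rightarrow> bool" where
  "continuous_map l f \<longleftrightarrow> maps f (funs omega l) reals \<and>
     (\<forall>x\<in>elts (funs omega l). \<forall>n\<in>elts omega. \<exists>m\<in>elts omega.
        \<forall>y\<in>elts (funs omega l). restr y m = restr x m \<longrightarrow>
          restr (app f y) n = restr (app f x) n)"

text \<open>There is no game on the empty set of moves, so \<open>l\<close> is nonzero.\<close>
definition ordinal_determinacy :: bool where
  "ordinal_determinacy \<longleftrightarrow> (\<forall>l\<in>elts Theta. l \<noteq> zero \<longrightarrow>
     (\<forall>f A. continuous_map l f \<and> elts A \<subseteq> elts reals \<longrightarrow>
        determined l {x \<in> elts (funs omega l). app f x \<in> elts A}))"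

definition AD_plus :: bool where
  "AD_plus \<longleftrightarrow> DC_reals \<and> (\<forall>A. elts A \<subseteq> elts reals \<longrightarrow> infinity_borel A) \<and> ordinal_determinacy"

definition upd :: "'a \<Rightarrow> 'a \<Rightarrow> 'a \<Rightarrow> 'a" where
  "upd s i a = setof (insert (opair i a) {opair k (app s k) | k. k \<in> elts omega \<and> k \<noteq> i})"

text \<open>
  The sets \<open>{s. (A,\<in>) \<Turnstile> \<phi>[s]}\<close> of satisfying assignments \<open>s : \<omega> \<rightarrow> A\<close>, for formulas \<open>\<phi>\<close> in the
  sense of the structure, form the smallest family closed under the clauses below, which
  correspond to atomic formulas, negation, conjunction and existential quantification.
\<close>
definition definability_closed :: "'a \<Rightarrow> 'a \<Rightarrow> bool" where
  "definability_closed A D \<longleftrightarrow>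
     (\<forall>i\<in>elts omega. \<forall>k\<in>elts omega.
        setof {s \<in> elts (funs omega A). app s i \<in> elts (app s k)} \<in> elts D \<and>
        setof {s \<in> elts (funs omega A). app s i = app s k} \<in> elts D) \<and>
     (\<forall>R\<in>elts D. setof (elts (funs omega A) - elts R) \<in> elts D) \<and>
     (\<forall>R\<in>elts D. \<forall>S\<in>elts D. setof (elts R \<inter> elts S) \<in> elts D) \<and>
     (\<forall>R\<in>elts D. \<forall>i\<in>elts omega.
        setof {s \<in> elts (funs omega A). \<exists>a\<in>elts A. upd s i a \<in> elts R} \<in> elts D)"

definition definable_relation :: "'a \<Rightarrow> 'a \<Rightarrow> bool" where
  "definable_relation A R \<longleftrightarrow> (\<forall>D. definability_closed A D \<longrightarrow> R \<in> elts D)"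

text \<open>
  The subsets of (nonempty) \<open>A\<close> that are first-order definable over \<open>(A,\<in>)\<close> with parameters; the
  assignment \<open>s\<close> supplies the parameters.
\<close>
definition Def :: "'a \<Rightarrow> 'a" where
  "Def A = setof {x. \<exists>R s. definable_relation A R \<and> s \<in> elts (funs omega A) \<and>
                       elts x = {a \<in> elts A. upd s zero a \<in> elts R}}"

definition L_hierarchy :: "'a \<Rightarrow> 'a \<Rightarrow> 'a \<Rightarrow> bool" where
  "L_hierarchy X a f \<longleftrightarrow> ordinal a \<and> fun_on f (suc a) \<and>
     app f zero = trcl (setof {X}) \<and>
     (\<forall>b. suc b \<in> elts (suc a) \<longrightarrow> app f (suc b) = Def (app f b)) \<and>
     (\<forall>b\<in>elts (suc a). limit_ordinal b \<longrightarrow> app f b = setof (\<Union>c\<in>elts b. elts (app f c)))"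

definition V_eq_L_over :: "'a \<Rightarrow> bool" where
  "V_eq_L_over X \<longleftrightarrow> (\<forall>x. \<exists>a f. L_hierarchy X a f \<and> x \<in> elts (app f a))"

definition poset :: "'a \<Rightarrow> 'a \<Rightarrow> bool" where
  "poset P le \<longleftrightarrow>
     (\<forall>z\<in>elts le. \<exists>p\<in>elts P. \<exists>q\<in>elts P. z = opair p q) \<and>
     (\<forall>p\<in>elts P. opair p p \<in> elts le) \<and>
     (\<forall>p q. opair p q \<in> elts le \<and> opair q p \<in> elts le \<longrightarrow> p = q) \<and>
     (\<forall>p q r. opair p q \<in> elts le \<and> opair q r \<in> elts le \<longrightarrow> opair p r \<in> elts le)"

definition dense :: "'a \<Rightarrow> 'a \<Rightarrow> 'a \<Rightarrow> bool" where
  "dense P le D \<longleftrightarrow> elts D \<subseteq> elts P \<and> (\<forall>p\<in>elts P. \<exists>q\<in>elts D. opair q p \<in> elts le)"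

text \<open>
  \<open>G\<close> is a set outside the structure; it meets the dense sets belonging to the structure.
\<close>
definition generic_filter :: "'a \<Rightarrow> 'a \<Rightarrow> 'a set \<Rightarrow> bool" where
  "generic_filter P le G \<longleftrightarrow> G \<subseteq> elts P \<and> G \<noteq> {} \<and>
     (\<forall>p\<in>G. \<forall>q. opair p q \<in> elts le \<longrightarrow> q \<in> G) \<and>
     (\<forall>p\<in>G. \<forall>q\<in>G. \<exists>r\<in>G. opair r p \<in> elts le \<and> opair r q \<in> elts le) \<and>
     (\<forall>D. dense P le D \<longrightarrow> G \<inter> elts D \<noteq> {})"

text \<open>
  \<open>x\<close> is the value of the name \<open>t\<close> at \<open>g\<close>, by the recursion
  \<open>val t = {val u | u p. p \<in> g \<and> (u,p) \<in> t}\<close> carried out inside the structure. As usual, the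
  recursion makes sense for every set \<open>t\<close>; elements that are not of the form \<open>(u,p)\<close> with
  \<open>p \<in> g\<close> are ignored.
\<close>
definition name_value :: "'a \<Rightarrow> 'a \<Rightarrow> 'a \<Rightarrow> bool" where
  "name_value g t x \<longleftrightarrow> (\<exists>d h. transitive d \<and> t \<in> elts d \<and> fun_on h d \<and>
     (\<forall>v\<in>elts d. elts (app h v) = {app h u | u. \<exists>p\<in>elts g. opair u p \<in> elts v}) \<and>
     app h t = x)"

end

text \<open>
  \<open>F\<close> is, via the embedding \<open>j\<close> of the ground model \<open>E\<close>, the generic extension \<open>E[G]\<close>: a model of
  ZF which contains \<open>E\<close> as a transitive class, contains \<open>G\<close>, and consists of the values at \<open>G\<close> of
  the names in \<open>E\<close>. An embedding replaces the inclusion, and no recursion outside \<open>F\<close> is used,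
  because \<open>E\<close> may be ill-founded. For generic \<open>G\<close> these conditions determine \<open>(F,j)\<close> up to
  isomorphism over \<open>E\<close>. Since \<open>E\<close> embeds into \<open>E[G]\<close> and its names map onto \<open>E[G]\<close>, the two have the
  same cardinality, so \<open>F\<close> can be taken on the same type as \<open>E\<close> without loss of generality.
\<close>
definition generic_extension ::
  "('a \<Rightarrow> 'a \<Rightarrow> bool) \<Rightarrow> 'a set \<Rightarrow> ('a \<Rightarrow> 'a \<Rightarrow> bool) \<Rightarrow> ('a \<Rightarrow> 'a) \<Rightarrow> bool" where
  "generic_extension E G F j \<longleftrightarrow> set_structure.ZF F \<and>
     inj j \<and> (\<forall>x. set_structure.elts F (j x) = j ` set_structure.elts E x) \<and>
     (\<exists>g. set_structure.elts F g = j ` G \<and>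
          (\<forall>x. \<exists>t. set_structure.name_value F g (j t) x))"

end

theory Submission
  imports Defs
begin

text \<open>
  Call a set small (\<open>Rsmall\<close>) if it is empty or a surjective image of the reals. Wadge's
  lemma and the regularity of Theta yield an increasing sequence, of length Theta, of small sets
  whose union is the power set of the reals; hence, by \<open>V = L(P(R))\<close>, every set is a union
  of small sets indexed by an ordinal.

  The poset is a well-ordered set of bounded partial functions from Theta to 2, ordered by
  extension. It is closed under the limits of greedy sequences: given a small set \<open>Y\<close> of
  relations \<open>b\<close> between conditions and reals, always pass to the first extension \<open>q\<close> in the
  poset for which some pair \<open>(b, x)\<close> with \<open>q\<close> related to \<open>x\<close> by \<open>b\<close> is new. Since the pairs
  form a small set and Theta is not small, such a sequence has length below Theta, and its
  limit meets, for every \<open>b\<close> in \<open>Y\<close>, all the sets \<open>{q. q b x}\<close> that are open and dense.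
  So the intersection of a family of open dense sets indexed by the reals is dense, and the
  extension has no new subsets of small sets; in particular it has the same reals and the same
  sets of reals, and determinacy persists. As the conditions are enumerated greedily, and those
  coded by the sets of reals of one stage form a small set, there are exactly Theta many of them.
\<close>

section \<open>First-order definability with parameters\<close>

text \<open>The set \<open>T2\<close> of all bounded partial functions contains a copy of the power
  set of \<open>omega\<close>, so under AD it has no well-ordering and cannot be put on Theta;
  moreover, descending sequences in it would have to be built by choosing extensions. A well-ordered
  subset cures both defects, since the first suitable condition can always be taken. But that subset
  must contain the limits of sequences that are chosen along its own enumeration.
  \<open>greedy_enumeration\<close> breaks this circle: the candidates at each step depend on the
  enumeration reached so far, while the closure it delivers refers to the final one. Such limits
  need parameters, and candidates are named by triples of ordinals. A relation between conditions
  and reals has no ordinal as its name; its small family, however, has an index, and one limit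
  serves the whole family. A model of ZF has Separation and Replacement for formulas alone, so every
  predicate and operation carries a certificate of definability (\<open>dfn\<close>,
  \<open>dft\<close>), mostly found by \<open>intro dfi\<close>.\<close>

named_theorems dfi

context set_structure
begin

text \<open>Variables are handled in de Bruijn style: the quantifier binds variable 0 and shifts the
  others. Because the notion speaks of HOL predicates on assignments and admits every element as a
  parameter, a certificate follows the HOL text of the predicate; \<open>dfn_expressible\<close>
  leads back to formulas.\<close>

inductive dfn :: "((nat \<Rightarrow> 'a) \<Rightarrow> bool) \<Rightarrow> bool" where
  dfn_mem_var: "dfn (\<lambda>s. mem (s i) (s k))"
| dfn_eq_var: "dfn (\<lambda>s. s i = s k)"
| dfn_par: "dfn (\<lambda>s. s i = c)"
| dfn_Not: "dfn P \<Longrightarrow> dfn (\<lambda>s. \<not> P s)"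
| dfn_conj: "dfn P \<Longrightarrow> dfn Q \<Longrightarrow> dfn (\<lambda>s. P s \<and> Q s)"
| dfn_all_shift: "dfn P \<Longrightarrow> dfn (\<lambda>s. \<forall>a. P (case_nat a s))"

lemma dfn_rename: "dfn P \<Longrightarrow> dfn (\<lambda>s. P (\<lambda>i. s (f i)))"
proof (induction arbitrary: f rule: dfn.induct)
  case (dfn_all_shift P)
  have eq: "case_nat a (\<lambda>i. s (f i)) = (\<lambda>i. (case_nat a s) (case_nat 0 (\<lambda>k. Suc (f k)) i))"
    for a and s :: "nat \<Rightarrow> 'a"
    by (rule ext) (auto split: nat.split)
  show ?case
    unfolding eq
    by (rule dfn.dfn_all_shift) (rule dfn_all_shift.IH)
qed (intro dfn.intros; assumption)+

text \<open>Only finitely many variables matter; the quantifier case of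
  \<open>dfn_expressible\<close> needs this to find a fresh one.\<close>

definition depends_below :: "((nat \<Rightarrow> 'a) \<Rightarrow> bool) \<Rightarrow> nat \<Rightarrow> bool" where
  "depends_below P n \<longleftrightarrow> (\<forall>s s'. (\<forall>i<n. s i = s' i) \<longrightarrow> P s = P s')"

text \<open>
  \<open>v\<close> says where the free variables, and \<open>w\<close> where the parameters \<open>ps\<close>, are placed among
  the variables of the formula.
\<close>
definition expressible :: "((nat \<Rightarrow> 'a) \<Rightarrow> bool) \<Rightarrow> 'a list \<Rightarrow> bool" where
  "expressible P ps \<longleftrightarrow> (\<forall>v w. \<exists>\<phi>. \<forall>e. (\<forall>j<length ps. e (w j) = ps ! j) \<longrightarrow>
     sat \<phi> e = P (\<lambda>i. e (v i)))"

lemma expressibleE: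
  assumes "expressible P ps"
  obtains \<phi> where "\<And>e. (\<And>j. j < length ps \<Longrightarrow> e (w j) = ps ! j) \<Longrightarrow> sat \<phi> e = P (\<lambda>i. e (v i))"
  using assms unfolding expressible_def by blast

lemma expressibleI:
  assumes "\<And>v w. \<exists>\<phi>. \<forall>e. (\<forall>j<length ps. e (w j) = ps ! j) \<longrightarrow> sat \<phi> e = P (\<lambda>i. e (v i))"
  shows "expressible P ps"
  using assms unfolding expressible_def by blast

lemma expressible_Not: "expressible P ps \<Longrightarrow> expressible (\<lambda>s. \<not> P s) ps"
proof (rule expressibleI)
  fix v w :: "nat \<Rightarrow> nat"
  assume P: "expressible P ps"
  obtain \<phi> where "\<And>e. (\<And>j. j < length ps \<Longrightarrow> e (w j) = ps ! j) \<Longrightarrow> sat \<phi> e = P (\<lambda>i. e (v i))"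
    by (rule expressibleE[OF P, of w v]) blast
  then show "\<exists>\<phi>. \<forall>e. (\<forall>j<length ps. e (w j) = ps ! j) \<longrightarrow> sat \<phi> e = (\<not> P (\<lambda>i. e (v i)))"
    by (intro exI[of _ "Neg \<phi>"]) simp
qed

lemma expressible_conj:
  assumes "expressible P ps" "expressible Q qs"
  shows "expressible (\<lambda>s. P s \<and> Q s) (ps @ qs)"
proof (rule expressibleI)
  fix v w :: "nat \<Rightarrow> nat"
  obtain \<phi> where \<phi>: "\<And>e. (\<And>j. j < length ps \<Longrightarrow> e (w j) = ps ! j) \<Longrightarrow> sat \<phi> e = P (\<lambda>i. e (v i))"
    by (rule expressibleE[OF assms(1), of w v]) blast
  obtain \<psi> where \<psi>: "\<And>e. (\<And>j. j < length qs \<Longrightarrow> e (w (length ps + j)) = qs ! j) \<Longrightarrow>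
      sat \<psi> e = Q (\<lambda>i. e (v i))"
    by (rule expressibleE[OF assms(2), of "\<lambda>j. w (length ps + j)" v]) blast
  have "sat (Conj \<phi> \<psi>) e = (P (\<lambda>i. e (v i)) \<and> Q (\<lambda>i. e (v i)))"
    if e: "\<forall>j<length (ps @ qs). e (w j) = (ps @ qs) ! j" for e
  proof -
    have "e (w j) = ps ! j" if "j < length ps" for j
      using e that by (metis length_append nth_append trans_less_add1)
    moreover have "e (w (length ps + j)) = qs ! j" if "j < length qs" for j
      using e that by (metis length_append nat_add_left_cancel_less nth_append_length_plus)
    ultimately show ?thesis
      using \<phi> \<psi> by simp
  qed
  then show "\<exists>\<phi>. \<forall>e. (\<forall>j<length (ps @ qs). e (w j) = (ps @ qs) ! j) \<longrightarrow>
      sat \<phi> e = (P (\<lambda>i. e (v i)) \<and> Q (\<lambda>i. e (v i)))"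
    by blast
qed

lemma expressible_all:
  assumes "expressible P ps" "depends_below P n"
  shows "expressible (\<lambda>s. \<forall>a. P (case_nat a s)) ps"
proof (rule expressibleI)
  fix v w :: "nat \<Rightarrow> nat"
  \<comment> \<open>The variable bound by the formula must avoid the places of the relevant free
    variables and those of the parameters.\<close>
  have "finite (v ` {..<n} \<union> w ` {..<length ps})" by simp
  then obtain k where k: "k \<notin> v ` {..<n} \<union> w ` {..<length ps}"
    using ex_new_if_finite[OF infinite_UNIV_nat] by blast
  obtain \<phi> where \<phi>: "\<And>e. (\<And>j. j < length ps \<Longrightarrow> e (w j) = ps ! j) \<Longrightarrow>
      sat \<phi> e = P (\<lambda>i. e (case_nat k v i))"
    by (rule expressibleE[OF assms(1), of w "case_nat k v"]) blast
  have "sat (All k \<phi>) e = (\<forall>a. P (case_nat a (\<lambda>i. e (v i))))"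
    if e: "\<forall>j<length ps. e (w j) = ps ! j" for e
  proof -
    have "sat \<phi> (e(k := a)) = P (case_nat a (\<lambda>i. e (v i)))" for a
    proof -
      have "sat \<phi> (e(k := a)) = P (\<lambda>i. (e(k := a)) (case_nat k v i))"
        by (rule \<phi>) (use e k in auto)
      also have "\<dots> = P (case_nat a (\<lambda>i. e (v i)))"
        by (rule assms(2)[unfolded depends_below_def, rule_format])
          (use k in \<open>auto split: nat.split\<close>)
      finally show ?thesis .
    qed
    then show ?thesis by simp
  qed
  then show "\<exists>\<phi>. \<forall>e. (\<forall>j<length ps. e (w j) = ps ! j) \<longrightarrow>
      sat \<phi> e = (\<forall>a. P (case_nat a (\<lambda>i. e (v i))))"
    by blast
qed

lemma depends_below_all: "depends_below P n \<Longrightarrow> depends_below (\<lambda>s. \<forall>a. P (case_nat a s)) n"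
proof -
  assume P: "depends_below P n"
  have "P (case_nat a s) = P (case_nat a s')" if "\<forall>i<n. s i = s' i" for a s s'
    by (rule P[unfolded depends_below_def, rule_format])
      (use that in \<open>auto split: nat.split\<close>)
  then show ?thesis
    unfolding depends_below_def by meson
qed

lemma depends_below_conj:
  assumes "depends_below P n" "depends_below Q m"
  shows "depends_below (\<lambda>s. P s \<and> Q s) (n + m)"
  unfolding depends_below_def
proof (intro allI impI)
  fix s s' :: "nat \<Rightarrow> 'a"
  assume "\<forall>i<n + m. s i = s' i"
  then have "P s = P s'" "Q s = Q s'"
    using assms unfolding depends_below_def by (meson trans_less_add1 trans_less_add2)+
  then show "(P s \<and> Q s) = (P s' \<and> Q s')" by simp
qed

lemma dfn_expressible: "dfn P \<Longrightarrow> \<exists>n ps. depends_below P n \<and> expressible P ps"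
proof (induction rule: dfn.induct)
  case (dfn_mem_var i k)
  have "expressible (\<lambda>s. mem (s i) (s k)) []"
    by (rule expressibleI, rule_tac x = "Mem (v i) (v k)" in exI) simp
  moreover have "depends_below (\<lambda>s. mem (s i) (s k)) (Suc (i + k))"
    by (simp add: depends_below_def)
  ultimately show ?case by blast
next
  case (dfn_eq_var i k)
  have "expressible (\<lambda>s. s i = s k) []"
    by (rule expressibleI, rule_tac x = "Eq (v i) (v k)" in exI) simp
  moreover have "depends_below (\<lambda>s. s i = s k) (Suc (i + k))"
    by (simp add: depends_below_def)
  ultimately show ?case by blast
next
  case (dfn_par i c)
  have "expressible (\<lambda>s. s i = c) [c]"
    by (rule expressibleI, rule_tac x = "Eq (v i) (w 0)" in exI) simp
  moreover have "depends_below (\<lambda>s. s i = c) (Suc i)"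
    by (simp add: depends_below_def)
  ultimately show ?case by blast
next
  case (dfn_Not P)
  then obtain n ps where "depends_below P n" "expressible P ps" by blast
  then have "depends_below (\<lambda>s. \<not> P s) n" "expressible (\<lambda>s. \<not> P s) ps"
    by (simp_all add: depends_below_def expressible_Not)
  then show ?case by blast
next
  case (dfn_conj P Q)
  then show ?case using depends_below_conj expressible_conj by blast
next
  case (dfn_all_shift P)
  then obtain n ps where "depends_below P n" "expressible P ps" by blast
  from depends_below_all[OF this(1)] expressible_all[OF this(2,1)] show ?case by blast
qed

section \<open>Definable terms, substitution and closure rules\<close>

definition dft :: "((nat \<Rightarrow> 'a) \<Rightarrow> 'a) \<Rightarrow> bool" where
  "dft t \<longleftrightarrow> dfn (\<lambda>s. s 0 = t (\<lambda>i. s (Suc i)))"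

lemma dfn_cong: "dfn P \<Longrightarrow> (\<And>s. P s = Q s) \<Longrightarrow> dfn Q"
proof -
  assume "dfn P" and "\<And>s. P s = Q s"
  then have "P = Q" by blast
  with \<open>dfn P\<close> show ?thesis by simp
qed

lemma dfn_const [dfi]: "dfn (\<lambda>s. P)"
proof -
  have *: "dfn (\<lambda>s. s 0 = s 0)" by (rule dfn_eq_var)
  from dfn_Not[OF *] have "dfn (\<lambda>s. False)" by simp
  with * show ?thesis by (cases P) simp_all
qed

lemma dfn_Neg [dfi]: "dfn P \<Longrightarrow> dfn (\<lambda>s. \<not> P s)"
  by (rule dfn_Not)

lemma dfn_And [dfi]: "dfn P \<Longrightarrow> dfn Q \<Longrightarrow> dfn (\<lambda>s. P s \<and> Q s)"
  by (rule dfn_conj)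

lemma dfn_Or [dfi]: "dfn P \<Longrightarrow> dfn Q \<Longrightarrow> dfn (\<lambda>s. P s \<or> Q s)"
  by (rule dfn_cong[OF dfn_Not[OF dfn_conj[OF dfn_Not dfn_Not]]], assumption+) auto

lemma dfn_Imp [dfi]: "dfn P \<Longrightarrow> dfn Q \<Longrightarrow> dfn (\<lambda>s. P s \<longrightarrow> Q s)"
  by (rule dfn_cong[OF dfn_Not[OF dfn_conj[OF _ dfn_Not]]], assumption+) auto

lemma dfn_Iff [dfi]: "dfn P \<Longrightarrow> dfn Q \<Longrightarrow> dfn (\<lambda>s. P s = Q s)"
  by (rule dfn_cong[OF dfn_conj[OF dfn_Imp dfn_Imp]], assumption+) auto

lemma dfn_All [dfi]: "dfn (\<lambda>s. Q (\<lambda>i. s (Suc i)) (s 0)) \<Longrightarrow> dfn (\<lambda>s. \<forall>a. Q s a)"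
  by (drule dfn_all_shift) simp

lemma dfn_Ex [dfi]: "dfn (\<lambda>s. Q (\<lambda>i. s (Suc i)) (s 0)) \<Longrightarrow> dfn (\<lambda>s. \<exists>a. Q s a)"
  by (rule dfn_cong[OF dfn_Not[OF dfn_All[OF dfn_Not]]], assumption) auto

lemma dft_rename: "dft t \<Longrightarrow> dft (\<lambda>s. t (\<lambda>i. s (f i)))"
  unfolding dft_def
  by (drule dfn_rename[of _ "case_nat 0 (\<lambda>i. Suc (f i))"]) simp

lemma dft_var [dfi]: "dft (\<lambda>s. s i)"
  unfolding dft_def by (rule dfn_eq_var)

lemma dft_const [dfi]: "dft (\<lambda>s. c)"
  unfolding dft_def by (rule dfn_par)

text \<open>A term is eliminated by naming its value:
  \<open>\<exists>a. a = t s \<and> Q s a\<close>. The composition rules \<open>dfn_comp1\<close> to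
  \<open>dfn_comp4\<close> apply this to one argument after another, so that each notion has to be
  certified only for variables.\<close>

lemma dfn_sub: "dft t \<Longrightarrow> dfn (\<lambda>s. Q (\<lambda>i. s (Suc i)) (s 0)) \<Longrightarrow> dfn (\<lambda>s. Q s (t s))"
  unfolding dft_def
  by (rule dfn_cong[OF dfn_Ex[where Q = "\<lambda>s a. a = t s \<and> Q s a"]], rule dfn_conj, assumption+) auto

lemma dft_sub:
  assumes "dft t" "dft (\<lambda>s. Q (\<lambda>i. s (Suc i)) (s 0))"
  shows "dft (\<lambda>s. Q s (t s))"
  unfolding dft_def
proof (rule dfn_sub[where Q = "\<lambda>s a. s 0 = Q (\<lambda>i. s (Suc i)) a"])
  show "dft (\<lambda>s. t (\<lambda>i. s (Suc i)))" by (rule dft_rename) fact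
  show "dfn (\<lambda>s. s (Suc 0) = Q (\<lambda>i. s (Suc (Suc i))) (s 0))"
    using dfn_rename[OF assms(2)[unfolded dft_def], of "\<lambda>i. if i = 0 then Suc 0 else if i = Suc 0 then 0 else i"]
    by simp
qed

lemma dfn_comp1: "dfn (\<lambda>s. R (s 0)) \<Longrightarrow> dft t \<Longrightarrow> dfn (\<lambda>s. R (t s))"
  by (rule dfn_sub[where Q = "\<lambda>s a. R a"])

lemma dfn_comp2:
  assumes "dfn (\<lambda>s. R (s 0) (s (Suc 0)))" "dft t" "dft u"
  shows "dfn (\<lambda>s. R (t s) (u s))"
proof (rule dfn_sub[where Q = "\<lambda>s a. R a (u s)"])
  show "dft t" by fact
  show "dfn (\<lambda>s. R (s 0) (u (\<lambda>i. s (Suc i))))"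
  proof (rule dfn_sub[where Q = "\<lambda>s a. R (s 0) a"])
    show "dft (\<lambda>s. u (\<lambda>i. s (Suc i)))" by (rule dft_rename) fact
    show "dfn (\<lambda>s. R (s (Suc 0)) (s 0))"
      using dfn_rename[OF assms(1), of "\<lambda>i. if i = 0 then Suc 0 else 0"] by simp
  qed
qed

lemma dfn_comp3:
  assumes "dfn (\<lambda>s. R (s 0) (s (Suc 0)) (s (Suc (Suc 0))))" "dft t" "dft u" "dft v"
  shows "dfn (\<lambda>s. R (t s) (u s) (v s))"
proof (rule dfn_sub[where Q = "\<lambda>s a. R a (u s) (v s)"])
  show "dft t" by fact
  show "dfn (\<lambda>s. R (s 0) (u (\<lambda>i. s (Suc i))) (v (\<lambda>i. s (Suc i))))"
  proof (rule dfn_sub[where Q = "\<lambda>s a. R (s 0) a (v (\<lambda>i. s (Suc i)))"])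
    show "dft (\<lambda>s. u (\<lambda>i. s (Suc i)))" by (rule dft_rename) fact
    show "dfn (\<lambda>s. R (s (Suc 0)) (s 0) (v (\<lambda>i. s (Suc (Suc i)))))"
    proof (rule dfn_sub[where Q = "\<lambda>s a. R (s (Suc 0)) (s 0) a"])
      show "dft (\<lambda>s. v (\<lambda>i. s (Suc (Suc i))))" by (rule dft_rename) fact
      show "dfn (\<lambda>s. R (s (Suc (Suc 0))) (s (Suc 0)) (s 0))"
        using dfn_rename[OF assms(1), of "\<lambda>i. if i = 0 then Suc (Suc 0) else if i = Suc 0 then Suc 0 else 0"]
        by simp
    qed
  qed
qed

lemma dfn_comp4:
  assumes "dfn (\<lambda>s. R (s 0) (s (Suc 0)) (s (Suc (Suc 0))) (s (Suc (Suc (Suc 0)))))"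
    "dft t" "dft u" "dft v" "dft w"
  shows "dfn (\<lambda>s. R (t s) (u s) (v s) (w s))"
proof (rule dfn_sub[where Q = "\<lambda>s a. R a (u s) (v s) (w s)"])
  show "dft t" by fact
  have *: "dfn (\<lambda>s. R (s (Suc (Suc (Suc 0)))) (s 0) (s (Suc 0)) (s (Suc (Suc 0))))"
    using dfn_rename[OF assms(1), of "\<lambda>i. if i = 0 then Suc (Suc (Suc 0)) else i - 1"] by simp
  show "dfn (\<lambda>s. R (s 0) (u (\<lambda>i. s (Suc i))) (v (\<lambda>i. s (Suc i))) (w (\<lambda>i. s (Suc i))))"
  proof (rule dfn_sub[where Q = "\<lambda>s a. R (s 0) a (v (\<lambda>i. s (Suc i))) (w (\<lambda>i. s (Suc i)))"])
    show "dft (\<lambda>s. u (\<lambda>i. s (Suc i)))" by (rule dft_rename) fact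
    show "dfn (\<lambda>s. R (s (Suc 0)) (s 0) (v (\<lambda>i. s (Suc (Suc i)))) (w (\<lambda>i. s (Suc (Suc i)))))"
    proof (rule dfn_sub[where Q = "\<lambda>s a. R (s (Suc 0)) (s 0) a (w (\<lambda>i. s (Suc (Suc i))))"])
      show "dft (\<lambda>s. v (\<lambda>i. s (Suc (Suc i))))" by (rule dft_rename) fact
      show "dfn (\<lambda>s. R (s (Suc (Suc 0))) (s (Suc 0)) (s 0) (w (\<lambda>i. s (Suc (Suc (Suc i))))))"
      proof (rule dfn_sub[where Q = "\<lambda>s a. R (s (Suc (Suc 0))) (s (Suc 0)) (s 0) a"])
        show "dft (\<lambda>s. w (\<lambda>i. s (Suc (Suc (Suc i)))))" by (rule dft_rename) fact
        show "dfn (\<lambda>s. R (s (Suc (Suc (Suc 0)))) (s (Suc (Suc 0))) (s (Suc 0)) (s 0))"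
          using dfn_rename[OF assms(1), of "\<lambda>i. 3 - i"]
          by (simp add: numeral_3_eq_3)
      qed
    qed
  qed
qed

lemma dft_comp1: "dft (\<lambda>s. K (s 0)) \<Longrightarrow> dft t \<Longrightarrow> dft (\<lambda>s. K (t s))"
proof -
  assume K: "dft (\<lambda>s. K (s 0))" and t: "dft t"
  have "dfn (\<lambda>s. s (Suc 0) = K (s 0))"
    using dfn_rename[OF K[unfolded dft_def], of "\<lambda>i. if i = 0 then Suc 0 else 0"] by simp
  from dfn_comp2[OF this, OF dft_rename[OF t, of Suc] dft_var[of 0]]
  show ?thesis unfolding dft_def by simp
qed

lemma dft_comp2: "dft (\<lambda>s. K (s 0) (s (Suc 0))) \<Longrightarrow> dft t \<Longrightarrow> dft u \<Longrightarrow> dft (\<lambda>s. K (t s) (u s))"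
proof -
  assume K: "dft (\<lambda>s. K (s 0) (s (Suc 0)))" and t: "dft t" and u: "dft u"
  from dfn_comp3[OF K[unfolded dft_def] dft_var[of 0] dft_rename[OF t, of Suc] dft_rename[OF u, of Suc]]
  show ?thesis unfolding dft_def by simp
qed

lemma dft_comp3: "dft (\<lambda>s. K (s 0) (s (Suc 0)) (s (Suc (Suc 0)))) \<Longrightarrow> dft t \<Longrightarrow> dft u \<Longrightarrow> dft v \<Longrightarrow>
  dft (\<lambda>s. K (t s) (u s) (v s))"
proof -
  assume K: "dft (\<lambda>s. K (s 0) (s (Suc 0)) (s (Suc (Suc 0))))" and t: "dft t" and u: "dft u" and v: "dft v"
  from dfn_comp4[OF K[unfolded dft_def] dft_var[of 0] dft_rename[OF t, of Suc] dft_rename[OF u, of Suc]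
      dft_rename[OF v, of Suc]]
  show ?thesis unfolding dft_def by simp
qed

lemma dfn_elem [dfi]: "dft t \<Longrightarrow> dft u \<Longrightarrow> dfn (\<lambda>s. t s \<in> elts (u s))"
  unfolding elts_def mem_Collect_eq by (rule dfn_comp2[where R = mem]) (rule dfn_mem_var)

lemma dfn_equal [dfi]: "dft t \<Longrightarrow> dft u \<Longrightarrow> dfn (\<lambda>s. t s = u s)"
  by (rule dfn_comp2[where R = "(=)"]) (rule dfn_eq_var)

lemma dfn_Ex1 [dfi]: "dfn (\<lambda>s. Q (\<lambda>i. s (Suc i)) (s 0)) \<Longrightarrow> dfn (\<lambda>s. \<exists>!a. Q s a)"
proof -
  assume *: "dfn (\<lambda>s. Q (\<lambda>i. s (Suc i)) (s 0))"
  have "dfn (\<lambda>s. Q (\<lambda>i. s (Suc (Suc i))) (s 0))"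
    using dfn_rename[OF *, of "\<lambda>i. if i = 0 then 0 else Suc i"] by simp
  then have "dfn (\<lambda>s. \<exists>a. Q s a \<and> (\<forall>b. Q s b \<longrightarrow> b = a))"
    by (intro dfi *)
  then show ?thesis
    by (simp add: Ex1_def)
qed

lemma dfn_Ball [dfi]: "dft t \<Longrightarrow> dfn (\<lambda>s. Q (\<lambda>i. s (Suc i)) (s 0)) \<Longrightarrow> dfn (\<lambda>s. \<forall>x\<in>elts (t s). Q s x)"
  unfolding Ball_def by (intro dfi dft_rename[of t Suc])

lemma dfn_Bex [dfi]: "dft t \<Longrightarrow> dfn (\<lambda>s. Q (\<lambda>i. s (Suc i)) (s 0)) \<Longrightarrow> dfn (\<lambda>s. \<exists>x\<in>elts (t s). Q s x)"
  unfolding Bex_def by (intro dfi dft_rename[of t Suc])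

lemma dfn_subset [dfi]: "dft t \<Longrightarrow> dft u \<Longrightarrow> dfn (\<lambda>s. elts (t s) \<subseteq> elts (u s))"
  unfolding subset_iff by (intro dfi dft_rename[of t Suc] dft_rename[of u Suc])

lemma dfn_elts_eq [dfi]: "dft t \<Longrightarrow> dft u \<Longrightarrow> dfn (\<lambda>s. elts (t s) = elts (u s))"
  unfolding set_eq_subset by (intro dfi)

lemma dfn_psubset [dfi]: "dft t \<Longrightarrow> dft u \<Longrightarrow> dfn (\<lambda>s. elts (t s) \<subset> elts (u s))"
  unfolding psubset_eq by (intro dfi)

lemma dft_If [dfi]: "dfn P \<Longrightarrow> dft t \<Longrightarrow> dft u \<Longrightarrow> dft (\<lambda>s. if P s then t s else u s)"
proof -
  assume P: "dfn P" and t: "dft t" and u: "dft u"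
  have "dfn (\<lambda>s. (P (\<lambda>i. s (Suc i)) \<longrightarrow> s 0 = t (\<lambda>i. s (Suc i))) \<and>
     (\<not> P (\<lambda>i. s (Suc i)) \<longrightarrow> s 0 = u (\<lambda>i. s (Suc i))))"
    by (intro dfn_And dfn_Imp dfn_Neg dfn_rename[OF P] t[unfolded dft_def] u[unfolded dft_def])
  then show ?thesis unfolding dft_def by (rule dfn_cong) auto
qed

text \<open>The variables from \<open>n\<close> on are frozen to the values of \<open>f\<close> and
  become parameters. This turns a certificate in a larger context into one for a predicate of a
  single variable, the form needed for Separation and Replacement.\<close>

lemma dfn_fix_tail: "dfn P \<Longrightarrow> dfn (\<lambda>s. P (\<lambda>i. if i < n then s i else f i))"
proof (induction arbitrary: f n rule: dfn.induct)
  case (dfn_mem_var i k)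
  have "dft (\<lambda>s. if i < n then s i else f i)" for n :: nat and f i
    by (cases "i < n") (auto intro: dfi)
  then show ?case using dfn_comp2[where R = mem, OF dfn.dfn_mem_var] by simp
next
  case (dfn_eq_var i k)
  have "dft (\<lambda>s. if i < n then s i else f i)" for n :: nat and f i
    by (cases "i < n") (auto intro: dfi)
  then show ?case using dfn_equal by simp
next
  case (dfn_par i c)
  have "dft (\<lambda>s. if i < n then s i else f i)" for n :: nat and f i
    by (cases "i < n") (auto intro: dfi)
  then show ?case using dfn_equal[OF _ dft_const[of c]] by simp
next
  case (dfn_all_shift P)
  have "dfn (\<lambda>s. \<forall>a. P (\<lambda>i. if i < Suc n then case_nat a s i else (case_nat undefined f) i))"
    by (intro dfn.dfn_all_shift dfn_all_shift.IH)
  moreover have "(\<lambda>i. if i < Suc n then case_nat a s i else (case_nat undefined f) i) =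
      case_nat a (\<lambda>i. if i < n then s i else f i)" for a and s :: "nat \<Rightarrow> 'a"
    by (rule ext) (auto split: nat.split)
  ultimately show ?case by simp
qed (auto intro: dfn_Not dfn_conj)

lemma dfn_param: "dfn (\<lambda>s. Q (\<lambda>i. s (Suc i)) (s 0)) \<Longrightarrow> dfn (\<lambda>s. Q e (s 0))"
  by (drule dfn_fix_tail[of _ "Suc 0" "case_nat undefined e"]) simp

lemma dft_param: "dft (\<lambda>s. F (\<lambda>i. s (Suc i)) (s 0)) \<Longrightarrow> dft (\<lambda>s. F e (s 0))"
  unfolding dft_def
  by (drule dfn_fix_tail[of _ "Suc (Suc 0)" "case_nat undefined (case_nat undefined e)"]) simp

lemma dfn_lift1: "dfn (\<lambda>s. P (\<lambda>i. s (Suc i)) (s 0)) \<Longrightarrow> dfn (\<lambda>s. P (\<lambda>i. s (Suc (Suc i))) (s 0))"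
  by (drule dfn_rename[of _ "\<lambda>i. if i = 0 then 0 else Suc i"]) simp

lemma dfn_lift2: "dfn (\<lambda>s. P (\<lambda>i. s (Suc i)) (s 0)) \<Longrightarrow> dfn (\<lambda>s. P (\<lambda>i. s (Suc (Suc (Suc i)))) (s 0))"
  by (drule dfn_rename[of _ "\<lambda>i. if i = 0 then 0 else Suc (Suc i)"]) simp

lemma dft_lift1: "dft (\<lambda>s. F (\<lambda>i. s (Suc i)) (s 0)) \<Longrightarrow> dft (\<lambda>s. F (\<lambda>i. s (Suc (Suc i))) (s 0))"
  by (drule dft_rename[of _ "\<lambda>i. if i = 0 then 0 else Suc i"]) simp

end

section \<open>Separation, Replacement and basic set operations as definable terms\<close>

locale zf = set_structure mem for mem :: "'a \<Rightarrow> 'a \<Rightarrow> bool" +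
  assumes ZF: ZF
begin

lemma elts_inject [simp]: "elts x = elts y \<longleftrightarrow> x = y"
  using ZF unfolding ZF_def extensionality_def by blast

lemma elts_eqI: "(\<And>z. z \<in> elts x \<longleftrightarrow> z \<in> elts y) \<Longrightarrow> x = y"
  using elts_inject by blast

lemma setof_elts [simp]: "setof (elts x) = x"
  unfolding setof_def by simp

lemma setof_eqI: "elts x = S \<Longrightarrow> setof S = x"
  by auto

lemma elts_setof: "\<exists>x. elts x = S \<Longrightarrow> elts (setof S) = S"
  by auto

lemma separation_dfn: "dfn (\<lambda>s. P (s 0)) \<Longrightarrow> \<exists>b. elts b = {x \<in> elts a. P x}"
proof -
  assume "dfn (\<lambda>s. P (s 0))"
  then obtain ps where ps: "expressible (\<lambda>s. P (s 0)) ps"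
    using dfn_expressible by blast
  obtain \<phi> where \<phi>: "\<And>e. (\<And>j. j < length ps \<Longrightarrow> e (Suc j) = ps ! j) \<Longrightarrow> sat \<phi> e = P (e 0)"
    by (rule expressibleE[OF ps, of Suc "\<lambda>i. i"]) blast
  define s where "s = (\<lambda>i. ps ! (i - 1))"
  have "\<exists>b. elts b = {x \<in> elts a. sat \<phi> (s(0 := x))}"
    using ZF unfolding ZF_def separation_def by blast
  moreover have "sat \<phi> (s(0 := x)) = P x" for x
    using \<phi>[of "s(0 := x)"] by (simp add: s_def)
  ultimately show ?thesis by simp
qed

lemma replacement_dfn_total:
  assumes "dfn (\<lambda>s. Q (s 0) (s (Suc 0)))" and ex1: "\<forall>x\<in>elts a. \<exists>!y. Q x y"
  shows "\<exists>b. elts b = {y. \<exists>x\<in>elts a. Q x y}"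
proof -
  obtain ps where ps: "expressible (\<lambda>s. Q (s 0) (s (Suc 0))) ps"
    using dfn_expressible[OF assms(1)] by blast
  obtain \<phi> where \<phi>: "\<And>e. (\<And>j. j < length ps \<Longrightarrow> e (Suc (Suc j)) = ps ! j) \<Longrightarrow>
      sat \<phi> e = Q (e 0) (e (Suc 0))"
    by (rule expressibleE[OF ps, of "\<lambda>j. Suc (Suc j)" "\<lambda>i. i"]) blast
  define s where "s = (\<lambda>i. ps ! (i - 2))"
  have eq: "sat \<phi> (s(0 := x, 1 := y)) = Q x y" for x y
    using \<phi>[of "s(0 := x, 1 := y)"] by (simp add: s_def)
  have "(\<forall>x\<in>elts a. \<exists>!y. sat \<phi> (s(0 := x, 1 := y))) \<longrightarrow>
     (\<exists>b. elts b = {y. \<exists>x\<in>elts a. sat \<phi> (s(0 := x, 1 := y))})"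
    using ZF unfolding ZF_def replacement_def by blast
  with ex1 show ?thesis by (simp only: eq)
qed

text \<open>The axiom asks for a value at every element of \<open>a\<close>, so a partial functional
  relation is first restricted to its domain by Separation.\<close>

lemma replacement_dfn:
  assumes Q: "dfn (\<lambda>s. Q (s 0) (s (Suc 0)))" and "\<And>x y z. x \<in> elts a \<Longrightarrow> Q x y \<Longrightarrow> Q x z \<Longrightarrow> y = z"
  shows "\<exists>b. elts b = {y. \<exists>x\<in>elts a. Q x y}"
proof -
  have "dfn (\<lambda>s. \<exists>y. Q (s 0) y)"
    by (intro dfi dfn_comp2[OF Q])
  then obtain a' where a': "elts a' = {x \<in> elts a. \<exists>y. Q x y}"
    using separation_dfn[of "\<lambda>x. \<exists>y. Q x y"] by blast
  have "\<exists>b. elts b = {y. \<exists>x\<in>elts a'. Q x y}"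
    by (rule replacement_dfn_total[OF Q]) (use a' assms(2) in blast)
  moreover have "{y. \<exists>x\<in>elts a'. Q x y} = {y. \<exists>x\<in>elts a. Q x y}"
    using a' by blast
  ultimately show ?thesis by simp
qed

text \<open>By extensionality, an equation with \<open>t s\<close> is a statement about all members,
  so a formula for membership is enough.\<close>

lemma dft_ext:
  assumes "\<And>s w. w \<in> elts (t s) \<longleftrightarrow> Q s w" and "dfn (\<lambda>s. Q (\<lambda>i. s (Suc i)) (s 0))"
  shows "dft t"
proof -
  have *: "dfn (\<lambda>s. Q (\<lambda>i. s (Suc (Suc i))) (s 0))"
    using dfn_rename[OF assms(2), of "\<lambda>i. if i = 0 then 0 else Suc i"] by simp
  have "dfn (\<lambda>s. \<forall>w. w \<in> elts (s 0) \<longleftrightarrow> Q (\<lambda>i. s (Suc i)) w)"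
    by (intro dfi *)
  then show ?thesis
    unfolding dft_def by (rule dfn_cong) (auto simp: assms(1)[symmetric] intro: elts_eqI)
qed

definition sep :: "'a \<Rightarrow> ('a \<Rightarrow> bool) \<Rightarrow> 'a" where
  "sep a P = setof {x \<in> elts a. P x}"

lemma elts_sep: "dfn (\<lambda>s. P (s 0)) \<Longrightarrow> elts (sep a P) = {x \<in> elts a. P x}"
  unfolding sep_def by (rule elts_setof) (rule separation_dfn)

text \<open>\<open>THE\<close> has an unspecified value when there is no unique witness. With the
  empty set as default, the description of a definable predicate is always a definable term.\<close>

definition iota :: "('a \<Rightarrow> bool) \<Rightarrow> 'a" where
  "iota P = (if \<exists>!x. P x then THE x. P x else setof {})"

lemma ex_empty: "\<exists>x. elts x = {}"
  using separation_dfn[of "\<lambda>x. False" undefined] dfn_const by simp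

text \<open>One formula covers both cases, as \<open>dft_ext\<close> requires: without a unique
  witness it holds of nothing, in agreement with the default.\<close>

lemma elts_iota: "elts (iota P) = {w. \<exists>x. P x \<and> (\<forall>y. P y \<longrightarrow> y = x) \<and> w \<in> elts x}"
proof (cases "\<exists>!x. P x")
  case True
  then have "\<exists>x. P x \<and> (\<forall>y. P y \<longrightarrow> y = x)" by (simp only: Ex1_def)
  then obtain x where x: "P x" "\<forall>y. P y \<longrightarrow> y = x" by (elim exE conjE) (rule that)
  have "(THE x. P x) = x"
    by (rule the_equality, rule x(1), rule x(2)[rule_format])
  then have i: "iota P = x"
    by (simp only: iota_def True if_True)
  show ?thesis
    unfolding i
  proof (intro set_eqI iffI)
    fix w
    assume "w \<in> elts x"
    with x show "w \<in> {w. \<exists>x. P x \<and> (\<forall>y. P y \<longrightarrow> y = x) \<and> w \<in> elts x}"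
      by (intro CollectI exI[of _ x] conjI)
  next
    fix w
    assume "w \<in> {w. \<exists>x. P x \<and> (\<forall>y. P y \<longrightarrow> y = x) \<and> w \<in> elts x}"
    then obtain x' where x': "P x'" "w \<in> elts x'"
      by (elim CollectE exE conjE) (rule that)
    have "x' = x" by (rule x(2)[rule_format, OF x'(1)])
    with x' show "w \<in> elts x" by (simp only:)
  qed
next
  case False
  then have i: "iota P = setof {}" by (simp only: iota_def if_False)
  have "elts (setof {}) = {}" using elts_setof[OF ex_empty] .
  moreover have "{w. \<exists>x. P x \<and> (\<forall>y. P y \<longrightarrow> y = x) \<and> w \<in> elts x} = {}"
  proof (rule equals0I)
    fix w
    assume "w \<in> {w. \<exists>x. P x \<and> (\<forall>y. P y \<longrightarrow> y = x) \<and> w \<in> elts x}"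
    then obtain x where x: "P x" "\<forall>y. P y \<longrightarrow> y = x"
      by (elim CollectE exE conjE) (rule that)
    have "\<exists>!x. P x"
      by (rule ex1I[of P x]) (rule x(1), rule x(2)[rule_format])
    with False show False by (rule notE)
  qed
  ultimately show ?thesis unfolding i by (simp only:)
qed

lemma iota_eq:
  assumes "P x" "\<And>y. P y \<Longrightarrow> y = x"
  shows "iota P = x"
proof -
  have ex: "\<exists>!x. P x" using assms by (rule ex1I)
  have "(THE x. P x) = x" using assms by (rule the_equality)
  with ex show ?thesis
    by (simp only: iota_def if_True)
qed

lemma dft_iota [dfi]: "dfn (\<lambda>s. P (\<lambda>i. s (Suc i)) (s 0)) \<Longrightarrow> dft (\<lambda>s. iota (P s))"
proof (rule dft_ext)
  assume P: "dfn (\<lambda>s. P (\<lambda>i. s (Suc i)) (s 0))"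
  show "w \<in> elts (iota (P s)) \<longleftrightarrow> (\<exists>x. P s x \<and> (\<forall>y. P s y \<longrightarrow> y = x) \<and> w \<in> elts x)" for s w
    unfolding elts_iota mem_Collect_eq by (rule refl)
  show "dfn (\<lambda>s. \<exists>x. P (\<lambda>i. s (Suc i)) x \<and> (\<forall>y. P (\<lambda>i. s (Suc i)) y \<longrightarrow> y = x) \<and> s 0 \<in> elts x)"
    by (intro dfn_Ex dfn_And dfn_All dfn_Imp dfn_equal dfn_elem dft_var dfn_lift1[OF P] dfn_lift2[OF P])
qed

lemma dft_sep [dfi]: "dft t \<Longrightarrow> dfn (\<lambda>s. P (\<lambda>i. s (Suc i)) (s 0)) \<Longrightarrow> dft (\<lambda>s. sep (t s) (P s))"
  by (rule dft_ext[where Q = "\<lambda>s w. w \<in> elts (t s) \<and> P s w"])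
    (simp add: elts_sep[OF dfn_param], intro dfi dft_rename[of t Suc])


lemma elts_setof_sub: "dfn (\<lambda>s. P (s 0)) \<Longrightarrow> (\<And>x. P x \<Longrightarrow> x \<in> elts a) \<Longrightarrow> elts (setof {x. P x}) = {x. P x}"
proof -
  assume P: "dfn (\<lambda>s. P (s 0))" and sub: "\<And>x. P x \<Longrightarrow> x \<in> elts a"
  have "{x \<in> elts a. P x} = {x. P x}" using sub by blast
  with separation_dfn[OF P, of a] show ?thesis by (intro elts_setof) simp
qed

lemma elts_zero [simp]: "elts zero = {}"
  unfolding zero_def by (rule elts_setof[OF ex_empty])

lemma eq_zero_iff: "x = zero \<longleftrightarrow> elts x = {}"
  using elts_inject[of x zero] by simp

definition upair :: "'a \<Rightarrow> 'a \<Rightarrow> 'a" where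
  "upair a b = setof {a, b}"

lemma elts_upair [simp]: "elts (upair a b) = {a, b}"
  unfolding upair_def using ZF by (intro elts_setof) (simp add: ZF_def pairing_def)

lemma opair_upair: "opair a b = upair (upair a a) (upair a b)"
  unfolding opair_def upair_def by simp

lemma upair_inject: "upair a b = upair c d \<Longrightarrow> a = c \<and> b = d \<or> a = d \<and> b = c"
  using elts_upair[of a b] elts_upair[of c d] by (auto simp: doubleton_eq_iff)

lemma opair_inject [simp]: "opair a b = opair c d \<longleftrightarrow> a = c \<and> b = d"
  unfolding opair_upair by (auto dest!: upair_inject)

lemma dft_upair [dfi]: "dft t \<Longrightarrow> dft u \<Longrightarrow> dft (\<lambda>s. upair (t s) (u s))"
  by (rule dft_comp2[of upair], rule dft_ext[where Q = "\<lambda>s w. w = s 0 \<or> w = s (Suc 0)"])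
    (simp, intro dfi)

lemma dft_opair [dfi]: "dft t \<Longrightarrow> dft u \<Longrightarrow> dft (\<lambda>s. opair (t s) (u s))"
  unfolding opair_upair by (intro dfi)

definition bigU :: "'a \<Rightarrow> 'a" where
  "bigU x = setof (\<Union>y\<in>elts x. elts y)"

lemma elts_bigU [simp]: "elts (bigU x) = (\<Union>y\<in>elts x. elts y)"
  unfolding bigU_def using ZF by (intro elts_setof) (simp add: ZF_def union_axiom_def)

lemma dft_bigU [dfi]: "dft t \<Longrightarrow> dft (\<lambda>s. bigU (t s))"
  by (rule dft_comp1[of bigU], rule dft_ext[where Q = "\<lambda>s w. \<exists>y\<in>elts (s 0). w \<in> elts y"])
    (simp, intro dfi)

definition Un2 :: "'a \<Rightarrow> 'a \<Rightarrow> 'a" where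
  "Un2 x y = bigU (upair x y)"

lemma elts_Un2 [simp]: "elts (Un2 x y) = elts x \<union> elts y"
  unfolding Un2_def by simp

lemma dft_Un2 [dfi]: "dft t \<Longrightarrow> dft u \<Longrightarrow> dft (\<lambda>s. Un2 (t s) (u s))"
  unfolding Un2_def by (intro dfi)

definition sing :: "'a \<Rightarrow> 'a" where
  "sing x = upair x x"

lemma elts_sing [simp]: "elts (sing x) = {x}"
  unfolding sing_def by simp

lemma dft_sing [dfi]: "dft t \<Longrightarrow> dft (\<lambda>s. sing (t s))"
  unfolding sing_def by (intro dfi)

lemma suc_Un2: "suc x = Un2 x (sing x)"
  unfolding suc_def by (rule setof_eqI) simp

lemma elts_suc [simp]: "elts (suc x) = insert x (elts x)"
  unfolding suc_Un2 by simp

lemma dft_suc [dfi]: "dft t \<Longrightarrow> dft (\<lambda>s. suc (t s))"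
  unfolding suc_Un2 by (intro dfi)

lemma elts_powerset [simp]: "elts (powerset x) = {y. elts y \<subseteq> elts x}"
  unfolding powerset_def using ZF by (intro elts_setof) (simp add: ZF_def power_set_def)

definition img :: "'a \<Rightarrow> ('a \<Rightarrow> 'a) \<Rightarrow> 'a" where
  "img a F = setof (F ` elts a)"

lemma dfn_graph: "dft (\<lambda>s. F (s 0)) \<Longrightarrow> dfn (\<lambda>s. s (Suc 0) = F (s 0))"
  unfolding dft_def
  using dfn_rename[of "\<lambda>s. s 0 = F (s (Suc 0))" "\<lambda>i. if i = 0 then Suc 0 else 0"] by simp

lemma elts_img: "dft (\<lambda>s. F (s 0)) \<Longrightarrow> elts (img a F) = F ` elts a"
proof -
  assume "dft (\<lambda>s. F (s 0))"
  from replacement_dfn[OF dfn_graph[OF this], of a]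
  have "\<exists>b. elts b = {y. \<exists>x\<in>elts a. y = F x}" by simp
  moreover have "{y. \<exists>x\<in>elts a. y = F x} = F ` elts a" by blast
  ultimately show ?thesis unfolding img_def by (intro elts_setof) simp
qed

lemma dft_img [dfi]:
  assumes "dft t" "dft (\<lambda>s. F (\<lambda>i. s (Suc i)) (s 0))"
  shows "dft (\<lambda>s. img (t s) (F s))"
proof (rule dft_ext)
  show "w \<in> elts (img (t s) (F s)) \<longleftrightarrow> (\<exists>x\<in>elts (t s). w = F s x)" for s w
    using elts_img[OF dft_param[OF assms(2), of s]] by auto
  show "dfn (\<lambda>s. \<exists>x\<in>elts (t (\<lambda>i. s (Suc i))). s 0 = F (\<lambda>i. s (Suc i)) x)"
    by (intro dfn_Bex dft_rename[OF assms(1), of Suc] dfn_equal dft_var dft_lift1[OF assms(2)])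
qed

definition lam :: "'a \<Rightarrow> ('a \<Rightarrow> 'a) \<Rightarrow> 'a" where
  "lam a F = img a (\<lambda>x. opair x (F x))"

lemma dft_pairF: "dft (\<lambda>s. F (\<lambda>i. s (Suc i)) (s 0)) \<Longrightarrow> dft (\<lambda>s. opair (s 0) (F (\<lambda>i. s (Suc i)) (s 0)))"
  by (intro dft_opair dft_var)

lemma dft_lam [dfi]:
  assumes "dft t" "dft (\<lambda>s. F (\<lambda>i. s (Suc i)) (s 0))"
  shows "dft (\<lambda>s. lam (t s) (F s))"
  unfolding lam_def by (intro dft_img dft_pairF assms)

lemma elts_lam: "dft (\<lambda>s. F (s 0)) \<Longrightarrow> elts (lam a F) = (\<lambda>x. opair x (F x)) ` elts a"
  unfolding lam_def by (rule elts_img) (intro dft_opair dft_var)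

section \<open>Products, projections and functions as sets of pairs\<close>

definition prod :: "'a \<Rightarrow> 'a \<Rightarrow> 'a" where
  "prod a b = bigU (img a (\<lambda>x. img b (\<lambda>y. opair x y)))"

lemma elts_prod: "elts (prod a b) = {opair x y | x y. x \<in> elts a \<and> y \<in> elts b}"
proof -
  have "elts (img b (\<lambda>y. opair x y)) = (\<lambda>y. opair x y) ` elts b" for x
    by (rule elts_img) (intro dfi)
  moreover have "elts (img a (\<lambda>x. img b (\<lambda>y. opair x y))) = (\<lambda>x. img b (\<lambda>y. opair x y)) ` elts a"
    by (rule elts_img) (intro dfi)
  ultimately show ?thesis unfolding prod_def by auto
qed

lemma opair_in_prod [simp]: "opair x y \<in> elts (prod a b) \<longleftrightarrow> x \<in> elts a \<and> y \<in> elts b"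
  by (auto simp: elts_prod)

lemma dft_prod [dfi]: "dft t \<Longrightarrow> dft u \<Longrightarrow> dft (\<lambda>s. prod (t s) (u s))"
  by (rule dft_comp2[of prod]) (simp_all only: prod_def, intro dfi)

definition fst' :: "'a \<Rightarrow> 'a" where
  "fst' z = iota (\<lambda>x. \<exists>y. z = opair x y)"

definition snd' :: "'a \<Rightarrow> 'a" where
  "snd' z = iota (\<lambda>y. \<exists>x. z = opair x y)"

lemma fst'_opair [simp]: "fst' (opair x y) = x"
  unfolding fst'_def by (rule iota_eq) auto

lemma snd'_opair [simp]: "snd' (opair x y) = y"
  unfolding snd'_def by (rule iota_eq) auto

lemma dft_fst' [dfi]: "dft t \<Longrightarrow> dft (\<lambda>s. fst' (t s))"
  by (rule dft_comp1[of fst']) (simp_all only: fst'_def, intro dfi)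

lemma dft_snd' [dfi]: "dft t \<Longrightarrow> dft (\<lambda>s. snd' (t s))"
  by (rule dft_comp1[of snd']) (simp_all only: snd'_def, intro dfi)

text \<open>A definable substitute for \<open>app\<close>; the two agree on the domain of a function
  (\<open>app_eq_ap\<close>), and off the domain \<open>ap\<close> has a definite value.\<close>

definition ap :: "'a \<Rightarrow> 'a \<Rightarrow> 'a" where
  "ap f x = iota (\<lambda>y. opair x y \<in> elts f)"

lemma dft_ap [dfi]: "dft t \<Longrightarrow> dft u \<Longrightarrow> dft (\<lambda>s. ap (t s) (u s))"
  by (rule dft_comp2[of ap]) (simp_all only: ap_def, intro dfi)

definition dm :: "'a \<Rightarrow> 'a" where
  "dm f = setof {x. \<exists>y. opair x y \<in> elts f}"

lemma elts_dm: "elts (dm f) = {x. \<exists>y. opair x y \<in> elts f}"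
  unfolding dm_def
\<comment> \<open>The Kuratowski pair of \<open>x\<close> and \<open>y\<close> has the element
  \<open>{x}\<close>, so \<open>x\<close> is found after two unions.\<close>
proof (rule elts_setof_sub[where a = "bigU (bigU f)"])
  show "dfn (\<lambda>s. \<exists>y. opair (s 0) y \<in> elts f)" by (intro dfi)
  fix x assume "\<exists>y. opair x y \<in> elts f"
  then obtain y where "upair (upair x x) (upair x y) \<in> elts f" by (auto simp: opair_upair)
  then have "upair x x \<in> elts (bigU f)" unfolding elts_bigU by (rule UN_I) simp
  then show "x \<in> elts (bigU (bigU f))" unfolding elts_bigU[of "bigU f"] by (rule UN_I) simp
qed

lemma dft_dm [dfi]: "dft t \<Longrightarrow> dft (\<lambda>s. dm (t s))"
  by (rule dft_comp1[of dm], rule dft_ext[where Q = "\<lambda>s w. \<exists>y. opair w y \<in> elts (s 0)"])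
    (simp add: elts_dm, intro dfi)

lemma fun_on_pair_iff: "fun_on f a \<Longrightarrow> opair x y \<in> elts f \<longleftrightarrow> x \<in> elts a \<and> y = ap f x"
proof -
  assume f: "fun_on f a"
  have 1: "x \<in> elts a" if "opair x y \<in> elts f" for y
    using f that unfolding fun_on_def by fastforce
  have 2: "opair x (ap f x) \<in> elts f \<and> (\<forall>y. opair x y \<in> elts f \<longrightarrow> y = ap f x)" if "x \<in> elts a"
  proof -
    from f that have "\<exists>!y. opair x y \<in> elts f" unfolding fun_on_def by blast
    then obtain y where y: "opair x y \<in> elts f" "\<And>z. opair x z \<in> elts f \<Longrightarrow> z = y"
      by (metis (no_types))
    have "ap f x = y" unfolding ap_def by (rule iota_eq) (fact y)+
    with y show ?thesis by metis
  qed
  show ?thesis using 1 2 by metis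
qed

lemma app_eq_ap: "fun_on f a \<Longrightarrow> x \<in> elts a \<Longrightarrow> app f x = ap f x"
  unfolding app_def by (rule the_equality) (simp_all add: fun_on_pair_iff)

lemma dm_fun_on: "fun_on f a \<Longrightarrow> dm f = a"
  by (rule elts_eqI) (simp add: elts_dm fun_on_pair_iff)

lemma fun_on_elts: "fun_on f a \<Longrightarrow> elts f = (\<lambda>x. opair x (ap f x)) ` elts a"
proof -
  assume f: "fun_on f a"
  show ?thesis
  proof (intro set_eqI iffI)
    fix p assume p: "p \<in> elts f"
    with f obtain x y where xy: "p = opair x y" unfolding fun_on_def by blast
    with p fun_on_pair_iff[OF f, of x y] show "p \<in> (\<lambda>x. opair x (ap f x)) ` elts a" by simp
  qed (auto simp: fun_on_pair_iff[OF f])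
qed

lemma fun_ext: "fun_on f a \<Longrightarrow> fun_on g a \<Longrightarrow> (\<And>x. x \<in> elts a \<Longrightarrow> ap f x = ap g x) \<Longrightarrow> f = g"
  using fun_on_elts[of f a] fun_on_elts[of g a] by (metis (no_types, lifting) elts_inject image_cong)

lemma fun_onI:
  assumes "\<And>p. p \<in> elts f \<Longrightarrow> \<exists>x y. x \<in> elts a \<and> p = opair x y"
    and "\<And>x. x \<in> elts a \<Longrightarrow> opair x (F x) \<in> elts f"
    and "\<And>x y. x \<in> elts a \<Longrightarrow> opair x y \<in> elts f \<Longrightarrow> y = F x"
  shows "fun_on f a"
  unfolding fun_on_def using assms by (metis (no_types))

lemma ap_eq: "opair x y \<in> elts f \<Longrightarrow> fun_on f a \<Longrightarrow> ap f x = y"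
  by (simp add: fun_on_pair_iff)

lemma fun_on_lam: "dft (\<lambda>s. F (s 0)) \<Longrightarrow> fun_on (lam a F) a"
  by (rule fun_onI[where F = F]) (auto simp: elts_lam)

lemma ap_lam: "dft (\<lambda>s. F (s 0)) \<Longrightarrow> x \<in> elts a \<Longrightarrow> ap (lam a F) x = F x"
  by (rule ap_eq[OF _ fun_on_lam]) (auto simp: elts_lam)

lemma maps_iff: "maps f a b \<longleftrightarrow> fun_on f a \<and> (\<forall>x\<in>elts a. ap f x \<in> elts b)"
  unfolding maps_def using app_eq_ap by auto

lemma maps_lam: "dft (\<lambda>s. F (s 0)) \<Longrightarrow> (\<And>x. x \<in> elts a \<Longrightarrow> F x \<in> elts b) \<Longrightarrow> maps (lam a F) a b"
  unfolding maps_iff using fun_on_lam ap_lam by simp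

lemma maps_prod: "maps f a b \<Longrightarrow> elts f \<subseteq> elts (prod a b)"
  unfolding maps_iff by (auto simp: fun_on_elts)

lemma dfn_fun_on [dfi]: "dft t \<Longrightarrow> dft u \<Longrightarrow> dfn (\<lambda>s. fun_on (t s) (u s))"
  by (rule dfn_comp2[of fun_on]) (simp_all only: fun_on_def, intro dfi)

lemma dfn_maps [dfi]: "dft t \<Longrightarrow> dft u \<Longrightarrow> dft v \<Longrightarrow> dfn (\<lambda>s. maps (t s) (u s) (v s))"
  by (rule dfn_comp3[of maps]) (simp_all only: maps_iff, intro dfi)

lemma elts_funs: "elts (funs a b) = {f. maps f a b}"
  unfolding funs_def
  by (rule elts_setof_sub[where a = "powerset (prod a b)"]) (intro dfi, simp add: maps_prod)

lemma dft_funs [dfi]: "dft t \<Longrightarrow> dft u \<Longrightarrow> dft (\<lambda>s. funs (t s) (u s))"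
  by (rule dft_comp2[of funs], rule dft_ext[where Q = "\<lambda>s w. maps w (s 0) (s (Suc 0))"])
    (simp add: elts_funs, intro dfi)

lemma elts_restr: "elts (restr f a) = {p \<in> elts f. \<exists>x\<in>elts a. \<exists>y. p = opair x y}"
proof -
  have "dfn (\<lambda>s. \<exists>x\<in>elts a. \<exists>y. s 0 = opair x y)" by (intro dfi)
  from elts_sep[OF this] show ?thesis unfolding restr_def sep_def .
qed

lemma dft_restr [dfi]: "dft t \<Longrightarrow> dft u \<Longrightarrow> dft (\<lambda>s. restr (t s) (u s))"
  by (rule dft_comp2[of restr],
      rule dft_ext[where Q = "\<lambda>s w. w \<in> elts (s 0) \<and> (\<exists>x\<in>elts (s (Suc 0)). \<exists>y. w = opair x y)"])
    (simp add: elts_restr, intro dfi)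

lemma fun_on_restr: "fun_on f b \<Longrightarrow> elts a \<subseteq> elts b \<Longrightarrow> fun_on (restr f a) a"
  by (rule fun_onI[where F = "ap f"]) (auto simp: elts_restr fun_on_pair_iff)

lemma ap_restr: "fun_on f b \<Longrightarrow> elts a \<subseteq> elts b \<Longrightarrow> x \<in> elts a \<Longrightarrow> ap (restr f a) x = ap f x"
  by (rule ap_eq[OF _ fun_on_restr]) (auto simp: elts_restr fun_on_pair_iff)

lemma maps_restr: "maps f b c \<Longrightarrow> elts a \<subseteq> elts b \<Longrightarrow> maps (restr f a) a c"
  unfolding maps_iff using fun_on_restr ap_restr by auto

section \<open>Ordinals\<close>

lemma dfn_transitive [dfi]: "dft t \<Longrightarrow> dfn (\<lambda>s. transitive (t s))"
  by (rule dfn_comp1[of transitive]) (simp_all only: transitive_def, intro dfi)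

lemma dfn_ordinal [dfi]: "dft t \<Longrightarrow> dfn (\<lambda>s. ordinal (t s))"
  by (rule dfn_comp1[of ordinal]) (simp_all only: ordinal_def, intro dfi)

lemma elts_minimal: "elts x \<noteq> {} \<Longrightarrow> \<exists>y\<in>elts x. elts y \<inter> elts x = {}"
  using ZF unfolding ZF_def foundation_def by blast

lemma mem_irrefl [simp]: "x \<notin> elts x"
  using elts_minimal[of "sing x"] by auto

lemma mem_asym: "x \<in> elts y \<Longrightarrow> y \<in> elts x \<Longrightarrow> False"
  using elts_minimal[of "upair x y"] by auto

lemma ord_elem: "ordinal a \<Longrightarrow> b \<in> elts a \<Longrightarrow> ordinal b"
  unfolding ordinal_def transitive_def by blast

lemma ord_trans: "ordinal a \<Longrightarrow> c \<in> elts b \<Longrightarrow> b \<in> elts a \<Longrightarrow> c \<in> elts a"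
  unfolding ordinal_def transitive_def by blast

text \<open>Foundation yields a minimal counterexample inside the set \<open>x\<close>; hence the
  induction hypothesis speaks of members of \<open>y\<close> that lie in \<open>x\<close>.\<close>

lemma set_induct:
  assumes P: "dfn (\<lambda>s. P (s 0))"
    and step: "\<And>y. y \<in> elts x \<Longrightarrow> (\<And>z. z \<in> elts y \<Longrightarrow> z \<in> elts x \<Longrightarrow> P z) \<Longrightarrow> P y"
    and y: "y \<in> elts x"
  shows "P y"
proof (rule ccontr)
  assume "\<not> P y"
  have *: "elts (sep x (\<lambda>y. \<not> P y)) = {y \<in> elts x. \<not> P y}"
    by (rule elts_sep) (intro dfi P)
  with \<open>\<not> P y\<close> y have "elts (sep x (\<lambda>y. \<not> P y)) \<noteq> {}" by blast
  from elts_minimal[OF this] step show False unfolding * by blast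
qed

lemma ord_induct:
  assumes P: "dfn (\<lambda>s. P (s 0))"
    and step: "\<And>a. ordinal a \<Longrightarrow> (\<And>b. b \<in> elts a \<Longrightarrow> P b) \<Longrightarrow> P a"
    and a: "ordinal a"
  shows "P a"
proof (rule set_induct[where P = P and x = "suc a", OF P])
  fix y
  assume y: "y \<in> elts (suc a)" and IH: "\<And>z. z \<in> elts y \<Longrightarrow> z \<in> elts (suc a) \<Longrightarrow> P z"
  from y a have "ordinal y" "elts y \<subseteq> elts (suc a)"
    by (auto intro: ord_elem ord_trans)
  with IH step show "P y" by blast
qed simp

lemma ord_linear: "ordinal a \<Longrightarrow> ordinal b \<Longrightarrow> a \<in> elts b \<or> a = b \<or> b \<in> elts a"
proof -
  let ?C = "\<lambda>a b. a \<in> elts b \<or> a = b \<or> b \<in> elts a"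
  have "ordinal a \<Longrightarrow> \<forall>b. ordinal b \<longrightarrow> ?C a b" for a
  proof (rule ord_induct[where P = "\<lambda>a. \<forall>b. ordinal b \<longrightarrow> ?C a b"], intro dfi)
    fix a
    assume a: "ordinal a" and IH: "\<And>c. c \<in> elts a \<Longrightarrow> \<forall>b. ordinal b \<longrightarrow> ?C c b"
    show "\<forall>b. ordinal b \<longrightarrow> ?C a b"
    proof (intro allI impI)
      fix b
      assume "ordinal b"
      then show "?C a b"
      proof (rule ord_induct[where P = "\<lambda>b. ?C a b", rotated 2], goal_cases)
        case 1
        show ?case by (intro dfi)
      next
        case (2 b)
        show ?case
        proof (rule ccontr)
          assume n: "\<not> ?C a b"
          have "x \<in> elts b" if "x \<in> elts a" for x
            using IH[OF that, rule_format, OF 2(1)] n that a ord_trans by blast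
          moreover have "y \<in> elts a" if "y \<in> elts b" for y
            using 2(2)[OF that] n that 2(1) ord_trans by blast
          ultimately have "a = b" by (intro elts_eqI) blast
          with n show False by simp
        qed
      qed
    qed
  qed
  then show "ordinal a \<Longrightarrow> ordinal b \<Longrightarrow> ?C a b" by blast
qed

lemma ord_subset_iff: "ordinal a \<Longrightarrow> ordinal b \<Longrightarrow> elts a \<subseteq> elts b \<longleftrightarrow> a \<in> elts b \<or> a = b"
  by (metis mem_irrefl ord_linear ord_trans subset_iff subsetI)

lemma ord_not_mem: "ordinal a \<Longrightarrow> ordinal b \<Longrightarrow> a \<notin> elts b \<longleftrightarrow> elts b \<subseteq> elts a"
  by (metis mem_asym mem_irrefl ord_linear ord_subset_iff)

lemma ordinal_zero [simp]: "ordinal zero"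
  by (simp add: ordinal_def transitive_def)

lemma ordinal_suc [simp]: "ordinal (suc a) \<longleftrightarrow> ordinal a"
proof
  show "ordinal (suc a) \<Longrightarrow> ordinal a" by (rule ord_elem[of "suc a"]) simp_all
  show "ordinal a \<Longrightarrow> ordinal (suc a)" unfolding ordinal_def transitive_def by auto
qed

lemma ordinal_bigU: "(\<And>x. x \<in> elts X \<Longrightarrow> ordinal x) \<Longrightarrow> ordinal (bigU X)"
  unfolding ordinal_def transitive_def by fastforce

lemma ordinal_Un2: "ordinal a \<Longrightarrow> ordinal b \<Longrightarrow> ordinal (Un2 a b)"
  unfolding Un2_def by (rule ordinal_bigU) auto

lemma ordinal_transI: "transitive a \<Longrightarrow> (\<And>x. x \<in> elts a \<Longrightarrow> ordinal x) \<Longrightarrow> ordinal a"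
  unfolding ordinal_def by blast

text \<open>Burali-Forti: if all ordinals were in \<open>x\<close>, those in \<open>x\<close> would
  form an ordinal that is a member of itself.\<close>

lemma ordinals_proper: "\<exists>a. ordinal a \<and> a \<notin> elts x"
proof (rule ccontr)
  assume n: "\<not> ?thesis"
  have *: "elts (sep x ordinal) = {a \<in> elts x. ordinal a}"
    by (rule elts_sep) (intro dfi)
  have "ordinal (sep x ordinal)"
  proof (rule ordinal_transI)
    show "transitive (sep x ordinal)"
      unfolding transitive_def * using n ord_elem by blast
  qed (simp add: *)
  with n * have "sep x ordinal \<in> elts (sep x ordinal)" by blast
  then show False by simp
qed

definition lst :: "('a \<Rightarrow> bool) \<Rightarrow> 'a" where
  "lst P = iota (\<lambda>e. ordinal e \<and> P e \<and> (\<forall>e'. ordinal e' \<and> P e' \<longrightarrow> elts e \<subseteq> elts e'))"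

lemma dft_lst [dfi]: "dfn (\<lambda>s. P (\<lambda>i. s (Suc i)) (s 0)) \<Longrightarrow> dft (\<lambda>s. lst (P s))"
proof -
  assume P: "dfn (\<lambda>s. P (\<lambda>i. s (Suc i)) (s 0))"
  have "dfn (\<lambda>s. ordinal (s 0) \<and> P (\<lambda>i. s (Suc i)) (s 0) \<and>
    (\<forall>e'. ordinal e' \<and> P (\<lambda>i. s (Suc i)) e' \<longrightarrow> elts (s 0) \<subseteq> elts e'))"
    by (intro dfi P dfn_lift1[OF P])
  then show ?thesis unfolding lst_def by (rule dft_iota)
qed

lemma lst_exists:
  assumes P: "dfn (\<lambda>s. P (s 0))" and a: "ordinal a" "P a"
  shows "ordinal (lst P) \<and> P (lst P) \<and> (\<forall>e. ordinal e \<longrightarrow> P e \<longrightarrow> elts (lst P) \<subseteq> elts e)"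
proof -
  have "ordinal a \<Longrightarrow> P a \<longrightarrow> (\<exists>e. ordinal e \<and> P e \<and> (\<forall>e'. ordinal e' \<longrightarrow> P e' \<longrightarrow> elts e \<subseteq> elts e'))" for a
  proof (rule ord_induct[where P = "\<lambda>a. P a \<longrightarrow> (\<exists>e. ordinal e \<and> P e \<and> (\<forall>e'. ordinal e' \<longrightarrow> P e' \<longrightarrow> elts e \<subseteq> elts e'))"])
    show "dfn (\<lambda>s. P (s 0) \<longrightarrow> (\<exists>e. ordinal e \<and> P e \<and> (\<forall>e'. ordinal e' \<longrightarrow> P e' \<longrightarrow> elts e \<subseteq> elts e')))"
      by (intro dfi dfn_comp1[OF P])
    fix a
    assume a: "ordinal a" and IH: "\<And>b. b \<in> elts a \<Longrightarrow> P b \<longrightarrow> (\<exists>e. ordinal e \<and> P e \<and> (\<forall>e'. ordinal e' \<longrightarrow> P e' \<longrightarrow> elts e \<subseteq> elts e'))"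
    show "P a \<longrightarrow> (\<exists>e. ordinal e \<and> P e \<and> (\<forall>e'. ordinal e' \<longrightarrow> P e' \<longrightarrow> elts e \<subseteq> elts e'))"
    proof (cases "\<exists>b\<in>elts a. P b")
      case True
      with IH show ?thesis by blast
    next
      case False
      then have "elts a \<subseteq> elts e" if "ordinal e" "P e" for e
        using that a ord_not_mem by blast
      with a show ?thesis by blast
    qed
  qed
  with a obtain e where e: "ordinal e" "P e" "\<And>e'. ordinal e' \<Longrightarrow> P e' \<Longrightarrow> elts e \<subseteq> elts e'"
    by blast
  have "lst P = e"
    unfolding lst_def
  proof (rule iota_eq)
    show "ordinal e \<and> P e \<and> (\<forall>e'. ordinal e' \<and> P e' \<longrightarrow> elts e \<subseteq> elts e')" using e by blast
    fix y
    assume y: "ordinal y \<and> P y \<and> (\<forall>e'. ordinal e' \<and> P e' \<longrightarrow> elts y \<subseteq> elts e')"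
    then have "elts y = elts e" using e by blast
    then show "y = e" by simp
  qed
  with e show ?thesis by blast
qed

lemma lst_mem:
  assumes P: "dfn (\<lambda>s. P (s 0))" and "ordinal a" "P a"
  shows "ordinal (lst P)" "P (lst P)" "lst P \<in> elts (suc a)" "\<And>e. e \<in> elts (lst P) \<Longrightarrow> \<not> P e"
proof -
  note * = lst_exists[OF assms]
  from * show o: "ordinal (lst P)" and "P (lst P)" by blast+
  from * assms(2,3) o show "lst P \<in> elts (suc a)" using ord_subset_iff by auto
  fix e assume e: "e \<in> elts (lst P)"
  show "\<not> P e"
  proof
    assume "P e"
    moreover from e o have "ordinal e" by (rule ord_elem[rotated])
    ultimately have "elts (lst P) \<subseteq> elts e" using * by blast
    with e show False using mem_irrefl by blast
  qed
qed

section \<open>Natural numbers\<close>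

text \<open>A description that avoids \<open>omega\<close>, so that the set given by Infinity can be
  cut down by Separation and then identified with \<open>omega\<close>.\<close>

definition natural :: "'a \<Rightarrow> bool" where
  "natural n \<longleftrightarrow> ordinal n \<and> (\<forall>m\<in>elts (suc n). m = zero \<or> (\<exists>k. m = suc k))"

lemma dfn_natural [dfi]: "dft t \<Longrightarrow> dfn (\<lambda>s. natural (t s))"
  by (rule dfn_comp1[of natural]) (simp_all only: natural_def, intro dfi)

lemma natural_zero: "natural zero"
  by (simp add: natural_def)

lemma natural_suc: "natural n \<Longrightarrow> natural (suc n)"
  unfolding natural_def by auto

lemma natural_elem: "natural n \<Longrightarrow> m \<in> elts n \<Longrightarrow> natural m"
  unfolding natural_def by (auto intro: ord_elem ord_trans)

lemma natural_induct:
  assumes P: "dfn (\<lambda>s. P (s 0))" and zero: "P zero"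
    and step: "\<And>n. natural n \<Longrightarrow> P n \<Longrightarrow> P (suc n)"
    and n: "natural n"
  shows "P n"
proof -
  have "ordinal n \<Longrightarrow> natural n \<longrightarrow> P n" for n
  proof (rule ord_induct[where P = "\<lambda>n. natural n \<longrightarrow> P n"])
    show "dfn (\<lambda>s. natural (s 0) \<longrightarrow> P (s 0))" by (intro dfi P)
    fix n
    assume IH: "\<And>b. b \<in> elts n \<Longrightarrow> natural b \<longrightarrow> P b"
    show "natural n \<longrightarrow> P n"
    proof
      assume n: "natural n"
      then consider "n = zero" | k where "n = suc k" unfolding natural_def by auto
      then show "P n"
      proof cases
        case 2
        then have "k \<in> elts n" by simp
        with n IH step show ?thesis using natural_elem 2 by blast
      qed (simp add: zero)
    qed
  qed
  with n show ?thesis unfolding natural_def by blast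
qed

lemma suc_inject [simp]: "suc a = suc b \<longleftrightarrow> a = b"
proof
  assume "suc a = suc b"
  then have "a \<in> elts (suc b)" "b \<in> elts (suc a)" by (metis elts_suc insertI1)+
  then show "a = b" using mem_asym by auto
qed simp

lemma suc_neq_zero [simp]: "suc a \<noteq> zero" "zero \<noteq> suc a"
  by (simp_all add: eq_zero_iff) (metis elts_suc elts_zero insert_not_empty)

lemma omega_natural: "limit_ordinal omega \<and> elts omega = {n. natural n}"
proof -
  obtain x e where x: "e \<in> elts x" "elts e = {}"
    "\<And>y. y \<in> elts x \<Longrightarrow> \<exists>z\<in>elts x. elts z = insert y (elts y)"
    using ZF unfolding ZF_def infinity_def by blast
  have in_x: "n \<in> elts x" if "natural n" for n
  proof (rule natural_induct[where P = "\<lambda>n. n \<in> elts x"])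
    show "dfn (\<lambda>s. s 0 \<in> elts x)" by (intro dfi)
    from x(1,2) show "zero \<in> elts x" by (simp add: eq_zero_iff[symmetric])
    fix n assume "n \<in> elts x"
    from x(3)[OF this] show "suc n \<in> elts x" by (metis elts_inject elts_suc)
  qed fact
  define w where "w = sep x natural"
  have w: "elts w = {n. natural n}"
  proof -
    have "dfn (\<lambda>s. natural (s 0))" by (intro dfi)
    from elts_sep[OF this, of x] in_x show ?thesis unfolding w_def by blast
  qed
  have lim: "limit_ordinal w"
    unfolding limit_ordinal_def
  proof (intro conjI)
    show "ordinal w"
    proof (rule ordinal_transI)
      show "transitive w" unfolding transitive_def w using natural_elem by blast
      show "ordinal n" if "n \<in> elts w" for n
        using that unfolding w natural_def by blast
    qed
    show "elts w \<noteq> {}" unfolding w using natural_zero by blast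
    show "\<forall>y\<in>elts w. suc y \<in> elts w" unfolding w using natural_suc by blast
  qed
  have nl: "\<not> limit_ordinal n" if "natural n" for n
  proof
    assume n: "limit_ordinal n"
    with that obtain k where "n = suc k" unfolding natural_def limit_ordinal_def by auto
    moreover have "k \<in> elts (suc k)" by simp
    ultimately have "suc k \<in> elts (suc k)" using n unfolding limit_ordinal_def by blast
    then show False using mem_irrefl by blast
  qed
  have "omega = w"
    unfolding omega_def
  proof (rule the_equality)
    show "limit_ordinal w \<and> (\<forall>n\<in>elts w. \<not> limit_ordinal n)" using lim nl w by blast
    fix v assume v: "limit_ordinal v \<and> (\<forall>n\<in>elts v. \<not> limit_ordinal n)"
    with lim nl w show "v = w"
      using ord_linear[of v w] unfolding limit_ordinal_def by blast
  qed
  with lim w show ?thesis by blast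
qed

lemma omega_iff: "n \<in> elts omega \<longleftrightarrow> natural n"
  using omega_natural by blast

lemma ordinal_omega [simp]: "ordinal omega"
  using omega_natural unfolding limit_ordinal_def by blast

lemma zero_omega [simp]: "zero \<in> elts omega"
  by (simp add: omega_iff natural_zero)

lemma suc_omega [simp]: "n \<in> elts omega \<Longrightarrow> suc n \<in> elts omega"
  by (simp add: omega_iff natural_suc)

lemma omega_ord: "n \<in> elts omega \<Longrightarrow> ordinal n"
  using ord_elem ordinal_omega by blast

lemma omega_trans: "n \<in> elts omega \<Longrightarrow> m \<in> elts n \<Longrightarrow> m \<in> elts omega"
  using ord_trans ordinal_omega by blast

lemma omega_cases: "n \<in> elts omega \<Longrightarrow> n = zero \<or> (\<exists>k\<in>elts omega. n = suc k)"
proof -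
  assume "n \<in> elts omega"
  then have n: "natural n" by (simp only: omega_iff)
  then have "n = zero \<or> (\<exists>k. n = suc k)" unfolding natural_def by simp
  then show ?thesis
  proof (elim disjE exE)
    fix k assume k: "n = suc k"
    have "k \<in> elts n" unfolding k by simp
    with n have "k \<in> elts omega" unfolding omega_iff by (rule natural_elem)
    with k show ?thesis by blast
  qed blast
qed

lemma omega_induct [consumes 1, case_names dfn zero suc]:
  assumes "n \<in> elts omega" "dfn (\<lambda>s. P (s 0))" "P zero"
    "\<And>n. n \<in> elts omega \<Longrightarrow> P n \<Longrightarrow> P (suc n)"
  shows "P n"
  using natural_induct[of P n] assms unfolding omega_iff by blast

section \<open>Recursion on ordinals\<close>

text \<open>\<open>H\<close> receives the function of all earlier values and can read the current
  stage off as its domain \<open>dm f\<close>.\<close>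

definition approx :: "('a \<Rightarrow> 'a) \<Rightarrow> 'a \<Rightarrow> 'a \<Rightarrow> bool" where
  "approx H f d \<longleftrightarrow> ordinal d \<and> fun_on f d \<and> (\<forall>z\<in>elts d. ap f z = H (restr f z))"

definition trv :: "('a \<Rightarrow> 'a) \<Rightarrow> 'a \<Rightarrow> 'a" where
  "trv H a = iota (\<lambda>y. \<exists>f. approx H f a \<and> y = H f)"

lemma dft_trv [dfi]:
  assumes H: "dft (\<lambda>s. H (\<lambda>i. s (Suc i)) (s 0))" and t: "dft t"
  shows "dft (\<lambda>s. trv (H s) (t s))"
proof -
  have 1: "dft (\<lambda>s. H (\<lambda>i. s (Suc (Suc i))) (s 0))"
    by (rule dft_lift1[OF H])
  have 3: "dft (\<lambda>s. H (\<lambda>i. s (Suc (Suc (Suc i)))) (restr (s (Suc 0)) (s 0)))"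
  proof (rule dft_sub[where Q = "\<lambda>s a. H (\<lambda>i. s (Suc (Suc (Suc i)))) a"])
    show "dft (\<lambda>s. restr (s (Suc 0)) (s 0))" by (intro dfi)
    show "dft (\<lambda>s. H (\<lambda>i. s (Suc (Suc (Suc (Suc i))))) (s 0))"
      using dft_rename[OF H, of "\<lambda>i. if i = 0 then 0 else Suc (Suc (Suc i))"] by simp
  qed
  show ?thesis
    unfolding trv_def approx_def
    by (intro dfi 1 3 dft_rename[OF t, of "\<lambda>i. Suc (Suc i)"] dft_rename[OF t, of "\<lambda>i. Suc (Suc (Suc i))"])
qed

context
  fixes H :: "'a \<Rightarrow> 'a"
  assumes H: "dft (\<lambda>s. H (s 0))"
begin

lemma dft_H: "dft t \<Longrightarrow> dft (\<lambda>s. H (t s))"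
  by (rule dft_comp1[OF H])

lemma dfn_approx: "dfn (\<lambda>s. approx H (s i) (s k))"
  unfolding approx_def by (intro dfi dft_H)

lemma approx_agree:
  assumes f: "approx H f d" and g: "approx H g e" and z: "z \<in> elts d" "z \<in> elts e"
  shows "ap f z = ap g z"
proof -
  have "z \<in> elts d \<longrightarrow> z \<in> elts e \<longrightarrow> ap f z = ap g z"
  proof (rule ord_induct[where P = "\<lambda>z. z \<in> elts d \<longrightarrow> z \<in> elts e \<longrightarrow> ap f z = ap g z"])
    show "dfn (\<lambda>s. s 0 \<in> elts d \<longrightarrow> s 0 \<in> elts e \<longrightarrow> ap f (s 0) = ap g (s 0))" by (intro dfi)
    show "ordinal z" using f z ord_elem unfolding approx_def by blast
    fix a
    assume IH: "\<And>b. b \<in> elts a \<Longrightarrow> b \<in> elts d \<longrightarrow> b \<in> elts e \<longrightarrow> ap f b = ap g b"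
    show "a \<in> elts d \<longrightarrow> a \<in> elts e \<longrightarrow> ap f a = ap g a"
    proof (intro impI)
      assume a: "a \<in> elts d" "a \<in> elts e"
      then have sub: "elts a \<subseteq> elts d" "elts a \<subseteq> elts e"
        using f g ord_trans unfolding approx_def by blast+
      have "restr f a = restr g a"
        by (rule fun_ext[of _ a]) (use f g sub IH in \<open>auto simp: approx_def fun_on_restr ap_restr subset_iff\<close>)
      with a f g show "ap f a = ap g a" unfolding approx_def by metis
    qed
  qed
  with z show ?thesis by blast
qed

lemma approx_unique: "approx H f d \<Longrightarrow> approx H g d \<Longrightarrow> f = g"
proof (rule fun_ext[of f d g])
  assume f: "approx H f d" and g: "approx H g d"
  then show "fun_on f d" "fun_on g d" unfolding approx_def by blast+
  show "ap f x = ap g x" if "x \<in> elts d" for x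
    using approx_agree[OF f g that that] .
qed

lemma trv_approx: "approx H f a \<Longrightarrow> trv H a = H f"
  unfolding trv_def by (rule iota_eq) (use approx_unique in blast)+

lemma dft_trv_H: "dft (\<lambda>s. trv H (s i))"
  by (intro dft_trv[where H = "\<lambda>s. H"] H dft_var)

lemma approx_lam: "ordinal a \<Longrightarrow> approx H (lam a (trv H)) a"
proof (rule ord_induct[where P = "\<lambda>a. approx H (lam a (trv H)) a"])
  show "dfn (\<lambda>s. approx H (lam (s 0) (trv H)) (s 0))"
    by (rule dfn_comp2[where R = "approx H", OF dfn_approx]) (intro dfi dft_trv_H)+
  fix a
  assume a: "ordinal a" and IH: "\<And>b. b \<in> elts a \<Longrightarrow> approx H (lam b (trv H)) b"
  have eq: "restr (lam a (trv H)) b = lam b (trv H)" if "b \<in> elts a" for b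
  proof -
    have "elts b \<subseteq> elts a" using a that ord_trans by blast
    then show ?thesis
      by (intro elts_eqI) (auto simp: elts_restr elts_lam[OF dft_trv_H])
  qed
  show "approx H (lam a (trv H)) a"
    unfolding approx_def
    using a fun_on_lam[OF dft_trv_H] ap_lam[OF dft_trv_H] eq trv_approx[OF IH] by simp
qed

lemma trv_eq: "ordinal a \<Longrightarrow> trv H a = H (lam a (trv H))"
  using trv_approx[OF approx_lam] .

end


definition rn :: "'a \<Rightarrow> 'a" where
  "rn f = img (dm f) (ap f)"

lemma elts_rn: "elts (rn f) = ap f ` elts (dm f)"
  unfolding rn_def by (rule elts_img) (intro dfi)

lemma dft_rn [dfi]: "dft t \<Longrightarrow> dft (\<lambda>s. rn (t s))"
  by (rule dft_comp1[of rn]) (simp_all only: rn_def, intro dfi)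

lemma dm_lam: "dft (\<lambda>s. F (s 0)) \<Longrightarrow> dm (lam a F) = a"
  by (rule dm_fun_on[OF fun_on_lam])

lemma elts_rn_lam: "dft (\<lambda>s. F (s 0)) \<Longrightarrow> elts (rn (lam a F)) = F ` elts a"
  by (simp add: elts_rn dm_lam ap_lam cong: image_cong)

lemma restr_lam: "dft (\<lambda>s. F (s 0)) \<Longrightarrow> elts b \<subseteq> elts a \<Longrightarrow> restr (lam a F) b = lam b F"
  by (rule elts_eqI) (auto simp: elts_restr elts_lam)

section \<open>Greedy enumerations\<close>

text \<open>
  Choosing again and again the first admissible value of \<open>F\<close> that lies in \<open>T\<close> and has not been
  listed must stop, since the ordinals do not inject into \<open>T\<close>. This closes a set under operations
  that depend on the enumeration of the set itself.
\<close>
lemma greedy_enumeration: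
  assumes F: "dft (\<lambda>s. F (s 0) (s (Suc 0)))"
  obtains d n where "ordinal d" "fun_on n d" "\<And>g. g \<in> elts d \<Longrightarrow> ap n g \<in> elts T"
    "\<And>g h. g \<in> elts d \<Longrightarrow> h \<in> elts d \<Longrightarrow> ap n g = ap n h \<Longrightarrow> g = h"
    "\<And>g. g \<in> elts d \<Longrightarrow> \<exists>k i e. ordinal k \<and> ordinal i \<and> ordinal e \<and>
       ap n g = F (restr n g) (opair k (opair i e)) \<and>
       (\<forall>k'\<in>elts k. \<forall>i' e'. ordinal i' \<longrightarrow> ordinal e' \<longrightarrow>
          F (restr n g) (opair k' (opair i' e')) \<in> elts T \<longrightarrow>
          (\<exists>h\<in>elts g. ap n h = F (restr n g) (opair k' (opair i' e'))))"
    "\<And>k i e. ordinal k \<Longrightarrow> ordinal i \<Longrightarrow> ordinal e \<Longrightarrow> F n (opair k (opair i e)) \<in> elts T \<Longrightarrow>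
       \<exists>h\<in>elts d. ap n h = F n (opair k (opair i e))"
proof -
  have F': "dft t \<Longrightarrow> dft u \<Longrightarrow> dft (\<lambda>s. F (t s) (u s))" for t u
    by (rule dft_comp2[of F, OF F])
  define V where "V n k i e \<longleftrightarrow> ordinal k \<and> ordinal i \<and> ordinal e \<and>
    F n (opair k (opair i e)) \<in> elts T \<and> F n (opair k (opair i e)) \<notin> elts (rn n)" for n k i e
  have V: "dft t \<Longrightarrow> dft u \<Longrightarrow> dft v \<Longrightarrow> dft w \<Longrightarrow> dfn (\<lambda>s. V (t s) (u s) (v s) (w s))" for t u v w
    unfolding V_def by (intro dfi F')
  \<comment> \<open>The least admissible code is taken lexicographically with \<open>k\<close>
    first. Thus \<open>k\<close> acts as a priority: a candidate is listed only when all admissible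
    ones of smaller \<open>k\<close> are already in the list.\<close>
  define lk where "lk n = lst (\<lambda>k. \<exists>i e. V n k i e)" for n
  have lk: "dft t \<Longrightarrow> dft (\<lambda>s. lk (t s))" for t
    by (rule dft_comp1[of lk]) (simp_all only: lk_def, intro dfi V)
  define li where "li n = lst (\<lambda>i. \<exists>e. V n (lk n) i e)" for n
  have li: "dft t \<Longrightarrow> dft (\<lambda>s. li (t s))" for t
    by (rule dft_comp1[of li]) (simp_all only: li_def, intro dfi V lk)
  define le where "le n = lst (\<lambda>e. V n (lk n) (li n) e)" for n
  have le: "dft t \<Longrightarrow> dft (\<lambda>s. le (t s))" for t
    by (rule dft_comp1[of le]) (simp_all only: le_def, intro dfi V lk li)
  define H where "H n = F n (opair (lk n) (opair (li n) (le n)))" for n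
  have H: "dft (\<lambda>s. H (s 0))"
    unfolding H_def by (intro dfi F' lk li le)
  have sel: "V n (lk n) (li n) (le n) \<and> (\<forall>k'\<in>elts (lk n). \<forall>i' e'. \<not> V n k' i' e')"
    if "V n k i e" for n k i e
  proof -
    have 1: "dfn (\<lambda>s. \<exists>i e. V n (s 0) i e)" by (intro dfi V)
    have k: "ordinal k" "\<exists>i e. V n k i e" using that unfolding V_def by blast+
    note K = lst_mem[where P = "\<lambda>k. \<exists>i e. V n k i e", OF 1 k, folded lk_def]
    from K(2) obtain i' e' where i': "V n (lk n) i' e'" by blast
    have 2: "dfn (\<lambda>s. \<exists>e. V n (lk n) (s 0) e)" by (intro dfi V)
    have i: "ordinal i'" "\<exists>e. V n (lk n) i' e" using i' unfolding V_def by blast+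
    note I = lst_mem[where P = "\<lambda>i. \<exists>e. V n (lk n) i e", OF 2 i, folded li_def]
    from I(2) obtain e'' where e'': "V n (lk n) (li n) e''" by blast
    have 3: "dfn (\<lambda>s. V n (lk n) (li n) (s 0))" by (intro dfi V)
    have e: "ordinal e''" using e'' unfolding V_def by blast
    note E = lst_mem[where P = "\<lambda>e. V n (lk n) (li n) e", OF 3 e e'', folded le_def]
    from E(2) K(4) show ?thesis by blast
  qed
  define N where "N = trv H"
  have N: "dft (\<lambda>s. N (s 0))"
    unfolding N_def by (rule dft_trv_H[OF H])
  have N_eq: "N a = H (lam a N)" if "ordinal a" for a
    unfolding N_def by (rule trv_eq[OF H that])
  define bad where "bad a \<longleftrightarrow> (\<forall>k i e. \<not> V (lam a N) k i e)" for a
  have dfn_bad: "dfn (\<lambda>s. bad (s 0))"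
    unfolding bad_def by (intro dfi V dft_comp1[of N, OF N])
  have good: "N a \<in> elts T \<and> N a \<notin> N ` elts a" if a: "ordinal a" and g: "\<not> bad a" for a
  proof -
    from g obtain k i e where "V (lam a N) k i e" unfolding bad_def by blast
    from sel[OF this] have "V (lam a N) (lk (lam a N)) (li (lam a N)) (le (lam a N))" by blast
    then have "N a \<in> elts T \<and> N a \<notin> elts (rn (lam a N))"
      unfolding N_eq[OF a] H_def V_def by blast
    then show ?thesis unfolding elts_rn_lam[OF N] .
  qed
  \<comment> \<open>Otherwise \<open>N\<close> would be injective on all ordinals with values in
    \<open>T\<close>, and Replacement for its inverse would collect the ordinals into a set.\<close>
  have "\<exists>a. ordinal a \<and> bad a"
  proof (rule ccontr)
    assume "\<not> ?thesis"
    then have good': "N a \<in> elts T" "N a \<notin> N ` elts a" if "ordinal a" for a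
      using good that by blast+
    have inj: "a = b" if "ordinal a" "ordinal b" "N a = N b" for a b
      using ord_linear[OF that(1,2)] good'(2)[OF that(1)] good'(2)[OF that(2)] that(3) by (metis imageI)
    have "dfn (\<lambda>s. ordinal (s (Suc 0)) \<and> N (s (Suc 0)) = s 0)"
      by (intro dfi dft_comp1[of N, OF N])
    then have "\<exists>b. elts b = {y. \<exists>x\<in>elts T. ordinal y \<and> N y = x}"
      by (rule replacement_dfn[where Q = "\<lambda>x y. ordinal y \<and> N y = x"]) (use inj in blast)
    then obtain b where "elts b = {y. \<exists>x\<in>elts T. ordinal y \<and> N y = x}" by blast
    with good' ordinals_proper[of b] show False by blast
  qed
  then obtain a where "ordinal a" "bad a" by blast
  note D = lst_mem[where P = bad, OF dfn_bad this]
  define d where "d = lst bad"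
  have d: "ordinal d" "bad d" "\<And>e. e \<in> elts d \<Longrightarrow> \<not> bad e"
    using D unfolding d_def by blast+
  define n where "n = lam d N"
  have ap_n: "ap n g = N g" if "g \<in> elts d" for g
    unfolding n_def by (rule ap_lam[OF N that])
  have og: "ordinal g" if "g \<in> elts d" for g using d(1) that by (rule ord_elem)
  have restr_n: "restr n g = lam g N" if "g \<in> elts d" for g
    unfolding n_def by (rule restr_lam[OF N]) (use d(1) that ord_trans in blast)
  show thesis
  proof (rule that[of d n])
    show "ordinal d" by fact
    show "fun_on n d" unfolding n_def by (rule fun_on_lam[OF N])
    show "ap n g \<in> elts T" if "g \<in> elts d" for g
      unfolding ap_n[OF that] using good[OF og[OF that] d(3)[OF that]] by blast
    show "g = h" if g: "g \<in> elts d" and h: "h \<in> elts d" and "ap n g = ap n h" for g h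
    proof -
      have "N g = N h" using that(3) by (simp only: ap_n[OF g] ap_n[OF h])
      with ord_linear[OF og[OF g] og[OF h]] good[OF og[OF g] d(3)[OF g]] good[OF og[OF h] d(3)[OF h]]
      show ?thesis by (metis imageI)
    qed
    show "\<exists>k i e. ordinal k \<and> ordinal i \<and> ordinal e \<and>
       ap n g = F (restr n g) (opair k (opair i e)) \<and>
       (\<forall>k'\<in>elts k. \<forall>i' e'. ordinal i' \<longrightarrow> ordinal e' \<longrightarrow>
          F (restr n g) (opair k' (opair i' e')) \<in> elts T \<longrightarrow>
          (\<exists>h\<in>elts g. ap n h = F (restr n g) (opair k' (opair i' e'))))"
      if g: "g \<in> elts d" for g
    proof -
      let ?n = "lam g N"
      from d(3)[OF g] obtain k i e where "V ?n k i e" unfolding bad_def by blast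
      from sel[OF this] have s: "V ?n (lk ?n) (li ?n) (le ?n)"
        "\<And>k' i' e'. k' \<in> elts (lk ?n) \<Longrightarrow> \<not> V ?n k' i' e'" by blast+
      have eq: "ap n g = F ?n (opair (lk ?n) (opair (li ?n) (le ?n)))"
        unfolding ap_n[OF g] N_eq[OF og[OF g]] H_def by (rule refl)
      have min: "\<exists>h\<in>elts g. ap n h = F ?n (opair k' (opair i' e'))"
        if "k' \<in> elts (lk ?n)" "ordinal i'" "ordinal e'" "F ?n (opair k' (opair i' e')) \<in> elts T"
        for k' i' e'
      proof -
        have "ordinal k'" using s(1) that(1) unfolding V_def by (blast intro: ord_elem)
        with s(2)[OF that(1), of i' e'] that have "F ?n (opair k' (opair i' e')) \<in> elts (rn ?n)"
          unfolding V_def by blast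
        then obtain h where h: "h \<in> elts g" "F ?n (opair k' (opair i' e')) = N h"
          unfolding elts_rn_lam[OF N] by blast
        moreover have "h \<in> elts d" using d(1) g h(1) ord_trans by blast
        ultimately show ?thesis using ap_n by metis
      qed
      from s(1) eq min show ?thesis
        unfolding restr_n[OF g] V_def by (intro exI[of _ "lk ?n"] exI[of _ "li ?n"] exI[of _ "le ?n"]) blast
    qed
    show "\<exists>h\<in>elts d. ap n h = F n (opair k (opair i e))"
      if "ordinal k" "ordinal i" "ordinal e" "F n (opair k (opair i e)) \<in> elts T" for k i e
    proof -
      have "\<not> V n k i e" using d(2) unfolding bad_def n_def by blast
      with that have "F n (opair k (opair i e)) \<in> elts (rn n)" unfolding V_def by blast
      then show ?thesis unfolding n_def elts_rn_lam[OF N] using ap_n unfolding n_def by force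
    qed
  qed
qed

section \<open>Transitive closure and recursion on the natural numbers\<close>

lemma bigU_suc: "ordinal n \<Longrightarrow> bigU (suc n) = n"
  by (rule elts_eqI) (auto intro: ord_trans)

text \<open>At a successor stage \<open>dm f\<close>, the union \<open>bigU (dm f)\<close> is the
  predecessor (\<open>bigU_suc\<close>).\<close>

definition nrec :: "'a \<Rightarrow> ('a \<Rightarrow> 'a \<Rightarrow> 'a) \<Rightarrow> 'a \<Rightarrow> 'a" where
  "nrec a G = trv (\<lambda>f. if dm f = zero then a else G (bigU (dm f)) (ap f (bigU (dm f))))"

context
  fixes G :: "'a \<Rightarrow> 'a \<Rightarrow> 'a"
  assumes G: "dft (\<lambda>s. G (s 0) (s (Suc 0)))"
begin

lemma dft_nrec_step: "dft (\<lambda>s. if dm (s 0) = zero then a else G (bigU (dm (s 0))) (ap (s 0) (bigU (dm (s 0)))))"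
  by (intro dfi dft_comp2[of G, OF G])

lemma dft_nrec: "dft t \<Longrightarrow> dft (\<lambda>s. nrec a G (t s))"
  by (rule dft_comp1[of "nrec a G"]) (unfold nrec_def, rule dft_trv_H[OF dft_nrec_step])

lemma nrec_zero: "nrec a G zero = a"
  unfolding nrec_def
  by (subst trv_eq[OF dft_nrec_step]) (simp_all add: dm_lam[OF dft_trv_H[OF dft_nrec_step]])

lemma nrec_suc: "n \<in> elts omega \<Longrightarrow> nrec a G (suc n) = G n (nrec a G n)"
proof -
  assume n: "n \<in> elts omega"
  let ?H = "\<lambda>f. if dm f = zero then a else G (bigU (dm f)) (ap f (bigU (dm f)))"
  have o: "ordinal n" using n by (rule omega_ord)
  have "trv ?H (suc n) = ?H (lam (suc n) (trv ?H))"
    by (rule trv_eq[OF dft_nrec_step]) (simp add: o)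
  also have "\<dots> = G n (trv ?H n)"
    by (simp add: dm_lam[OF dft_trv_H[OF dft_nrec_step]] ap_lam[OF dft_trv_H[OF dft_nrec_step]] bigU_suc[OF o])
  finally show ?thesis unfolding nrec_def .
qed

end

text \<open>Start with \<open>{x}\<close>, take unions again and again through \<open>omega\<close>,
  and unite the results: an element of an element appears one stage later.\<close>

lemma ex_transitive: "\<exists>t. transitive t \<and> x \<in> elts t"
proof -
  define C where "C = nrec (sing x) (\<lambda>n y. bigU y)"
  have G: "dft (\<lambda>s. bigU (s (Suc 0)))" by (intro dfi)
  have C: "dft (\<lambda>s. C (s 0))" unfolding C_def by (rule dft_nrec[OF G]) (rule dft_var)
  have Cs: "C (suc n) = bigU (C n)" if "n \<in> elts omega" for n
    unfolding C_def by (rule nrec_suc[OF G that])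
  have C0: "C zero = sing x"
    unfolding C_def by (rule nrec_zero[OF G])
  define t where "t = bigU (img omega C)"
  have t: "elts t = (\<Union>n\<in>elts omega. elts (C n))"
    unfolding t_def by (simp add: elts_img[OF C])
  have "transitive t"
    unfolding transitive_def
  proof (intro ballI subsetI)
    fix y z assume "y \<in> elts t" "z \<in> elts y"
    then obtain n where n: "n \<in> elts omega" "y \<in> elts (C n)" unfolding t by blast
    with \<open>z \<in> elts y\<close> have "z \<in> elts (C (suc n))" by (auto simp: Cs)
    with n(1) show "z \<in> elts t" unfolding t using suc_omega by blast
  qed
  moreover have "x \<in> elts t" unfolding t by (rule UN_I[OF zero_omega]) (simp add: C0)
  ultimately show ?thesis by blast
qed

lemma elts_trcl: "elts (trcl x) = {z. \<forall>t. transitive t \<and> elts x \<subseteq> elts t \<longrightarrow> z \<in> elts t}"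
proof -
  obtain t where t: "transitive t" "x \<in> elts t" using ex_transitive by blast
  then have "elts x \<subseteq> elts t" unfolding transitive_def by blast
  with t show ?thesis
    unfolding trcl_def
    by (intro elts_setof_sub[where a = t]) (intro dfi, blast)
qed

lemma transitive_trcl: "transitive (trcl x)"
  unfolding transitive_def elts_trcl by blast

lemma trcl_superset: "elts x \<subseteq> elts (trcl x)"
  unfolding elts_trcl by blast

lemma trcl_least: "transitive t \<Longrightarrow> elts x \<subseteq> elts t \<Longrightarrow> elts (trcl x) \<subseteq> elts t"
  unfolding elts_trcl by blast

section \<open>Even and odd numbers, pairs of reals\<close>

definition dbl :: "'a \<Rightarrow> 'a" where
  "dbl = nrec zero (\<lambda>n y. suc (suc y))"

lemma dft_dbl_step: "dft (\<lambda>s. suc (suc (s (Suc 0))))"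
  by (intro dfi)

lemma dft_dbl [dfi]: "dft t \<Longrightarrow> dft (\<lambda>s. dbl (t s))"
  unfolding dbl_def by (rule dft_nrec[OF dft_dbl_step])

lemma dbl_zero [simp]: "dbl zero = zero"
  unfolding dbl_def by (rule nrec_zero[OF dft_dbl_step])

lemma dbl_suc [simp]: "n \<in> elts omega \<Longrightarrow> dbl (suc n) = suc (suc (dbl n))"
  unfolding dbl_def by (rule nrec_suc[OF dft_dbl_step])

lemma dbl_omega [simp]: "n \<in> elts omega \<Longrightarrow> dbl n \<in> elts omega"
proof (induction n rule: omega_induct)
  case dfn
  show ?case by (intro dfi)
qed simp_all

lemma parity: "n \<in> elts omega \<Longrightarrow> \<exists>k\<in>elts omega. n = dbl k \<or> n = suc (dbl k)"
proof (induction n rule: omega_induct)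
  case dfn
  show ?case by (intro dfi)
next
  case zero
  then show ?case by (intro bexI[of _ zero]) simp_all
next
  case (suc n)
  then obtain k where k: "k \<in> elts omega" "n = dbl k \<or> n = suc (dbl k)" by blast
  then have "suc n = suc (dbl k) \<or> suc n = dbl (suc k)" by auto
  with k(1) suc_omega show ?case by blast
qed

lemma dbl_neq_suc_dbl:
  assumes "n \<in> elts omega" "m \<in> elts omega"
  shows "dbl n \<noteq> suc (dbl m)"
proof -
  have "\<forall>m\<in>elts omega. dbl n \<noteq> suc (dbl m)"
    using assms(1)
  proof (induction n rule: omega_induct)
    case dfn
    show ?case by (intro dfi)
  next
    case (suc n)
    show ?case
    proof
      fix m assume "m \<in> elts omega"
      then consider "m = zero" | k where "k \<in> elts omega" "m = suc k" using omega_cases by blast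
      then show "dbl (suc n) \<noteq> suc (dbl m)"
        by cases (use suc in simp_all)
    qed
  qed simp
  with assms(2) show ?thesis by blast
qed

lemma dbl_inject:
  assumes "n \<in> elts omega" "m \<in> elts omega"
  shows "dbl n = dbl m \<longleftrightarrow> n = m"
proof -
  have "\<forall>m\<in>elts omega. dbl n = dbl m \<longrightarrow> n = m"
    using assms(1)
  proof (induction n rule: omega_induct)
    case dfn
    show ?case by (intro dfi)
  next
    case zero
    show ?case
    proof
      fix m assume "m \<in> elts omega"
      then consider "m = zero" | k where "k \<in> elts omega" "m = suc k" using omega_cases by blast
      then show "dbl zero = dbl m \<longrightarrow> zero = m" by cases simp_all
    qed
  next
    case (suc n)
    show ?case
    proof
      fix m assume "m \<in> elts omega"
      then consider "m = zero" | k where "k \<in> elts omega" "m = suc k" using omega_cases by blast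
      then show "dbl (suc n) = dbl m \<longrightarrow> suc n = m"
        by cases (use suc in simp_all)
    qed
  qed
  with assms(2) show ?thesis by blast
qed

text \<open>The range of \<open>dbl\<close> on \<open>omega\<close> is one of the sets over which
  \<open>even_nat\<close> quantifies; conversely, induction puts each \<open>dbl k\<close> into all
  of them.\<close>

lemma even_nat_iff: "n \<in> elts omega \<Longrightarrow> even_nat n \<longleftrightarrow> (\<exists>k\<in>elts omega. n = dbl k)"
proof
  assume n: "n \<in> elts omega" and "even_nat n"
  have e: "elts (img omega dbl) = dbl ` elts omega"
    by (rule elts_img) (intro dfi)
  have "zero \<in> elts (img omega dbl)"
    unfolding e by (rule image_eqI[of _ _ zero]) simp_all
  moreover have "\<forall>k\<in>elts (img omega dbl). suc (suc k) \<in> elts (img omega dbl)"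
  proof
    fix k assume "k \<in> elts (img omega dbl)"
    then obtain m where "m \<in> elts omega" "k = dbl m" unfolding e by blast
    then show "suc (suc k) \<in> elts (img omega dbl)"
      unfolding e by (intro image_eqI[of _ _ "suc m"]) simp_all
  qed
  ultimately have "n \<in> elts (img omega dbl)"
    using \<open>even_nat n\<close> unfolding even_nat_def by blast
  then show "\<exists>k\<in>elts omega. n = dbl k" unfolding e by blast
next
  assume "\<exists>k\<in>elts omega. n = dbl k"
  then obtain k where k: "k \<in> elts omega" "n = dbl k" by blast
  have "dbl k \<in> elts e" if e: "zero \<in> elts e" "\<And>k. k \<in> elts e \<Longrightarrow> suc (suc k) \<in> elts e" for e
    using k(1)
  proof (induction k rule: omega_induct)
    case dfn
    show ?case by (intro dfi)
  qed (use e in simp_all)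
  with k show "even_nat n" unfolding even_nat_def by blast
qed

lemma reals_iff: "x \<in> elts reals \<longleftrightarrow> maps x omega omega"
  unfolding reals_def elts_funs by simp

lemma reals_ap [simp]: "x \<in> elts reals \<Longrightarrow> n \<in> elts omega \<Longrightarrow> ap x n \<in> elts omega"
  unfolding reals_iff maps_iff by blast

lemma lam_reals: "dft (\<lambda>s. F (s 0)) \<Longrightarrow> (\<And>n. n \<in> elts omega \<Longrightarrow> F n \<in> elts omega) \<Longrightarrow> lam omega F \<in> elts reals"
  unfolding reals_iff by (rule maps_lam)

lemma reals_ext: "x \<in> elts reals \<Longrightarrow> y \<in> elts reals \<Longrightarrow> (\<And>n. n \<in> elts omega \<Longrightarrow> ap x n = ap y n) \<Longrightarrow> x = y"
  unfolding reals_iff maps_iff by (blast intro: fun_ext)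

text \<open>Pairs of reals are coded by interleaving digits. For a play of a game on
  \<open>omega\<close>, \<open>fstr\<close> then collects the moves of player I and
  \<open>sndr\<close> those of player II, as used in \<open>Wadge\<close>.\<close>

definition fstr :: "'a \<Rightarrow> 'a" where
  "fstr z = lam omega (\<lambda>n. ap z (dbl n))"

definition sndr :: "'a \<Rightarrow> 'a" where
  "sndr z = lam omega (\<lambda>n. ap z (suc (dbl n)))"

definition pairr :: "'a \<Rightarrow> 'a \<Rightarrow> 'a" where
  "pairr x y = lam omega (\<lambda>n. iota (\<lambda>v. \<exists>k\<in>elts omega. n = dbl k \<and> v = ap x k \<or> n = suc (dbl k) \<and> v = ap y k))"

lemma dft_fstr [dfi]: "dft t \<Longrightarrow> dft (\<lambda>s. fstr (t s))"
  by (rule dft_comp1[of fstr]) (simp_all only: fstr_def, intro dfi)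

lemma dft_sndr [dfi]: "dft t \<Longrightarrow> dft (\<lambda>s. sndr (t s))"
  by (rule dft_comp1[of sndr]) (simp_all only: sndr_def, intro dfi)

lemma ap_fstr [simp]: "n \<in> elts omega \<Longrightarrow> ap (fstr z) n = ap z (dbl n)"
  unfolding fstr_def by (rule ap_lam) (intro dfi)

lemma ap_sndr [simp]: "n \<in> elts omega \<Longrightarrow> ap (sndr z) n = ap z (suc (dbl n))"
  unfolding sndr_def by (rule ap_lam) (intro dfi)

lemma ap_pairr_even: "n \<in> elts omega \<Longrightarrow> ap (pairr x y) (dbl n) = ap x n"
proof -
  assume n: "n \<in> elts omega"
  have "ap (pairr x y) (dbl n) = iota (\<lambda>v. \<exists>k\<in>elts omega. dbl n = dbl k \<and> v = ap x k \<or> dbl n = suc (dbl k) \<and> v = ap y k)"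
    unfolding pairr_def by (rule ap_lam) (intro dfi, simp add: n)
  also have "\<dots> = ap x n"
    by (rule iota_eq) (use n dbl_inject dbl_neq_suc_dbl in blast)+
  finally show ?thesis .
qed

lemma ap_pairr_odd: "n \<in> elts omega \<Longrightarrow> ap (pairr x y) (suc (dbl n)) = ap y n"
proof -
  assume n: "n \<in> elts omega"
  have "ap (pairr x y) (suc (dbl n)) = iota (\<lambda>v. \<exists>k\<in>elts omega. suc (dbl n) = dbl k \<and> v = ap x k \<or> suc (dbl n) = suc (dbl k) \<and> v = ap y k)"
    unfolding pairr_def by (rule ap_lam) (intro dfi, simp add: n)
  also have "\<dots> = ap y n"
    by (rule iota_eq) (use n dbl_inject dbl_neq_suc_dbl suc_inject in metis)+
  finally show ?thesis .
qed

lemma fstr_reals [simp]: "z \<in> elts reals \<Longrightarrow> fstr z \<in> elts reals"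
  unfolding fstr_def by (rule lam_reals) (intro dfi, simp)

lemma sndr_reals [simp]: "z \<in> elts reals \<Longrightarrow> sndr z \<in> elts reals"
  unfolding sndr_def by (rule lam_reals) (intro dfi, simp)

lemma pairr_reals [simp]: "x \<in> elts reals \<Longrightarrow> y \<in> elts reals \<Longrightarrow> pairr x y \<in> elts reals"
proof -
  assume x: "x \<in> elts reals" and y: "y \<in> elts reals"
  have fo: "fun_on (pairr x y) omega"
    unfolding pairr_def by (rule fun_on_lam) (intro dfi)
  have "ap (pairr x y) n \<in> elts omega" if n: "n \<in> elts omega" for n
  proof -
    obtain k where "k \<in> elts omega" "n = dbl k \<or> n = suc (dbl k)" using parity[OF n] by blast
    then show ?thesis using x y by (auto simp: ap_pairr_even ap_pairr_odd)
  qed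
  with fo show ?thesis unfolding reals_iff maps_iff by blast
qed

lemma fstr_pairr [simp]: "x \<in> elts reals \<Longrightarrow> y \<in> elts reals \<Longrightarrow> fstr (pairr x y) = x"
  by (rule reals_ext) (simp_all add: ap_pairr_even)

lemma sndr_pairr [simp]: "x \<in> elts reals \<Longrightarrow> y \<in> elts reals \<Longrightarrow> sndr (pairr x y) = y"
  by (rule reals_ext) (simp_all add: ap_pairr_odd)

definition constr :: "'a \<Rightarrow> 'a" where
  "constr n = lam omega (\<lambda>k. n)"

lemma constr_reals [simp]: "n \<in> elts omega \<Longrightarrow> constr n \<in> elts reals"
  unfolding constr_def by (rule lam_reals) (intro dfi, simp)

lemma ap_constr [simp]: "k \<in> elts omega \<Longrightarrow> ap (constr n) k = n"
  unfolding constr_def by (rule ap_lam) (intro dfi)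

section \<open>Surjective images of the reals\<close>

text \<open>\<open>f\<close> may be any set, and its values may leave \<open>Y\<close>. Hence
  subsets inherit the property with the same \<open>f\<close>, and the empty set is
  included.\<close>

definition Rsmall :: "'a \<Rightarrow> bool" where
  "Rsmall Y \<longleftrightarrow> (\<exists>f. \<forall>y\<in>elts Y. \<exists>x\<in>elts reals. ap f x = y)"

lemma dfn_Rsmall [dfi]: "dft t \<Longrightarrow> dfn (\<lambda>s. Rsmall (t s))"
  by (rule dfn_comp1[of Rsmall]) (simp_all only: Rsmall_def, intro dfi)

lemma RsmallI: "dft (\<lambda>s. F (s 0)) \<Longrightarrow> (\<And>y. y \<in> elts Y \<Longrightarrow> \<exists>x\<in>elts reals. y = F x) \<Longrightarrow> Rsmall Y"
  unfolding Rsmall_def by (rule exI[of _ "lam reals F"]) (metis ap_lam)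

lemma Rsmall_subset: "Rsmall Y \<Longrightarrow> elts Z \<subseteq> elts Y \<Longrightarrow> Rsmall Z"
  unfolding Rsmall_def by blast

lemma Rsmall_image:
  assumes "Rsmall Y" "dft (\<lambda>s. F (s 0))" "\<And>z. z \<in> elts Z \<Longrightarrow> \<exists>y\<in>elts Y. z = F y"
  shows "Rsmall Z"
proof -
  obtain f where f: "\<And>y. y \<in> elts Y \<Longrightarrow> \<exists>x\<in>elts reals. ap f x = y"
    using assms(1) unfolding Rsmall_def by blast
  show ?thesis
  proof (rule RsmallI[where F = "\<lambda>x. F (ap f x)"])
    show "dft (\<lambda>s. F (ap f (s 0)))" by (rule dft_comp1[OF assms(2)]) (intro dfi)
    show "\<exists>x\<in>elts reals. z = F (ap f x)" if "z \<in> elts Z" for z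
      using assms(3)[OF that] f by blast
  qed
qed

lemma Rsmall_prod:
  assumes "Rsmall Y" "Rsmall Z"
  shows "Rsmall (prod Y Z)"
proof -
  obtain f where f: "\<And>y. y \<in> elts Y \<Longrightarrow> \<exists>x\<in>elts reals. ap f x = y"
    using assms(1) unfolding Rsmall_def by blast
  obtain g where g: "\<And>y. y \<in> elts Z \<Longrightarrow> \<exists>x\<in>elts reals. ap g x = y"
    using assms(2) unfolding Rsmall_def by blast
  show ?thesis
  proof (rule RsmallI[where F = "\<lambda>x. opair (ap f (fstr x)) (ap g (sndr x))"])
    show "dft (\<lambda>s. opair (ap f (fstr (s 0))) (ap g (sndr (s 0))))" by (intro dfi)
    fix p assume "p \<in> elts (prod Y Z)"
    then obtain y z where p: "p = opair y z" "y \<in> elts Y" "z \<in> elts Z" unfolding elts_prod by blast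
    obtain u where u: "u \<in> elts reals" "ap f u = y" using f p(2) by blast
    obtain v where v: "v \<in> elts reals" "ap g v = z" using g p(3) by blast
    show "\<exists>x\<in>elts reals. p = opair (ap f (fstr x)) (ap g (sndr x))"
      by (rule bexI[of _ "pairr u v"]) (use p u v in simp_all)
  qed
qed

lemma Rsmall_image2:
  assumes "Rsmall Y" "Rsmall Y'" "dft (\<lambda>s. F (s 0) (s (Suc 0)))"
    "\<And>z. z \<in> elts Z \<Longrightarrow> \<exists>y\<in>elts Y. \<exists>y'\<in>elts Y'. z = F y y'"
  shows "Rsmall Z"
proof (rule Rsmall_image[OF Rsmall_prod[OF assms(1,2)], where F = "\<lambda>p. F (fst' p) (snd' p)"])
  show "dft (\<lambda>s. F (fst' (s 0)) (snd' (s 0)))" by (rule dft_comp2[of F, OF assms(3)]) (intro dfi)+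
  fix z assume "z \<in> elts Z"
  from assms(4)[OF this] obtain y y' where "y \<in> elts Y" "y' \<in> elts Y'" "z = F y y'" by blast
  then show "\<exists>p\<in>elts (prod Y Y'). z = F (fst' p) (snd' p)"
    by (intro bexI[of _ "opair y y'"]) simp_all
qed

lemma Rsmall_reals [simp]: "Rsmall reals"
  by (rule RsmallI[where F = "\<lambda>x. x"]) (intro dfi, blast)

lemma Rsmall_omega [simp]: "Rsmall omega"
proof (rule RsmallI[where F = "\<lambda>x. ap x zero"])
  show "dft (\<lambda>s. ap (s 0) zero)" by (intro dfi)
  show "\<exists>x\<in>elts reals. n = ap x zero" if "n \<in> elts omega" for n
    using that by (intro bexI[of _ "constr n"]) simp_all
qed

lemma Rsmall_Un2:
  assumes "Rsmall Y" "Rsmall Z"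
  shows "Rsmall (Un2 Y Z)"
proof -
  obtain f where f: "\<And>y. y \<in> elts Y \<Longrightarrow> \<exists>x\<in>elts reals. ap f x = y"
    using assms(1) unfolding Rsmall_def by blast
  obtain g where g: "\<And>y. y \<in> elts Z \<Longrightarrow> \<exists>x\<in>elts reals. ap g x = y"
    using assms(2) unfolding Rsmall_def by blast
  let ?F = "\<lambda>x. if ap (fstr x) zero = zero then ap f (sndr x) else ap g (sndr x)"
  show ?thesis
  proof (rule RsmallI[where F = ?F])
    show "dft (\<lambda>s. ?F (s 0))" by (intro dfi)
    fix y assume "y \<in> elts (Un2 Y Z)"
    then consider "y \<in> elts Y" | "y \<in> elts Z" by auto
    then show "\<exists>x\<in>elts reals. y = ?F x"
    proof cases
      case 1
      then obtain u where "u \<in> elts reals" "ap f u = y" using f by blast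
      then show ?thesis by (intro bexI[of _ "pairr (constr zero) u"]) (simp_all del: ap_fstr ap_sndr)
    next
      case 2
      then obtain u where "u \<in> elts reals" "ap g u = y" using g by blast
      then show ?thesis by (intro bexI[of _ "pairr (constr (suc zero)) u"]) (simp_all del: ap_fstr ap_sndr)
    qed
  qed
qed

lemma Rsmall_sing [simp]: "Rsmall (sing y)"
proof (rule RsmallI[where F = "\<lambda>x. y"])
  show "dft (\<lambda>s. y)" by (intro dfi)
  show "\<exists>x\<in>elts reals. z = y" if "z \<in> elts (sing y)" for z
    using that by (intro bexI[of _ "constr zero"]) simp_all
qed

lemma Rsmall_powerset_omega: "Rsmall (powerset omega)"
proof (rule RsmallI[where F = "\<lambda>x. sep omega (\<lambda>n. ap x n = zero)"])
  show "dft (\<lambda>s. sep omega (\<lambda>n. ap (s 0) n = zero))" by (intro dfi)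
  fix y assume y: "y \<in> elts (powerset omega)"
  let ?F = "\<lambda>n. if n \<in> elts y then zero else suc zero"
  have F: "dft (\<lambda>s. ?F (s 0))" by (intro dfi)
  have d: "dfn (\<lambda>s. ap (lam omega ?F) (s 0) = zero)" by (intro dfi)
  have "elts (sep omega (\<lambda>n. ap (lam omega ?F) n = zero)) = {n \<in> elts omega. ap (lam omega ?F) n = zero}"
    by (rule elts_sep[OF d])
  also have "\<dots> = {n \<in> elts omega. ?F n = zero}"
    by (rule Collect_cong, rule conj_cong[OF refl], subst ap_lam[OF F]) simp_all
  also have "\<dots> = elts y" using y by (auto split: if_splits)
  finally have "y = sep omega (\<lambda>n. ap (lam omega ?F) n = zero)" by simp
  moreover have "lam omega ?F \<in> elts reals" by (rule lam_reals[OF F]) simp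
  ultimately show "\<exists>x\<in>elts reals. y = sep omega (\<lambda>n. ap x n = zero)" by blast
qed


section \<open>The ordinal Theta\<close>

definition onto :: "'a \<Rightarrow> 'a \<Rightarrow> bool" where
  "onto h a \<longleftrightarrow> maps h reals a \<and> (\<forall>y\<in>elts a. \<exists>x\<in>elts reals. ap h x = y)"

lemma dfn_onto [dfi]: "dft t \<Longrightarrow> dft u \<Longrightarrow> dfn (\<lambda>s. onto (t s) (u s))"
  by (rule dfn_comp2[of onto]) (simp_all only: onto_def, intro dfi)

lemma surj_image_iff: "surj_image_of_reals a \<longleftrightarrow> (\<exists>h. onto h a)"
  unfolding surj_image_of_reals_def onto_def
  using app_eq_ap unfolding maps_iff by (metis (no_types, lifting))

text \<open>The prewellordering of the reals induced by \<open>h\<close>, stored as a single set of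
  reals by means of \<open>pairr\<close>. Through it ordinals below Theta are coded by sets of
  reals.\<close>

definition pwo :: "'a \<Rightarrow> 'a" where
  "pwo h = sep reals (\<lambda>z. elts (ap h (fstr z)) \<subseteq> elts (ap h (sndr z)))"

lemma dft_pwo [dfi]: "dft t \<Longrightarrow> dft (\<lambda>s. pwo (t s))"
  by (rule dft_comp1[of pwo]) (simp_all only: pwo_def, intro dfi)

lemma elts_pwo: "elts (pwo h) = {z \<in> elts reals. elts (ap h (fstr z)) \<subseteq> elts (ap h (sndr z))}"
  unfolding pwo_def by (rule elts_sep) (intro dfi)

lemma pwo_pairr: "x \<in> elts reals \<Longrightarrow> y \<in> elts reals \<Longrightarrow> pairr x y \<in> elts (pwo h) \<longleftrightarrow> elts (ap h x) \<subseteq> elts (ap h y)"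
  unfolding elts_pwo by simp

text \<open>Since \<open>h\<close> is onto an ordinal, \<open>ap h x\<close> is the rank of
  \<open>x\<close> in the prewellordering: the set of values at strictly smaller reals. Induction on
  the value shows that equal prewellorderings have equal rank functions.\<close>

lemma pwo_determines:
  assumes a: "ordinal a" "onto h a" and b: "ordinal b" "onto k b" and eq: "pwo h = pwo k"
  shows "a = b \<and> h = k"
proof -
  have oh: "ordinal (ap h x)" and ok: "ordinal (ap k x)"
    and ha: "ap h x \<in> elts a" and kb: "ap k x \<in> elts b" if "x \<in> elts reals" for x
    using that a b unfolding onto_def maps_iff by (blast intro: ord_elem)+
  have sub: "elts (ap h x) \<subseteq> elts (ap h y) \<longleftrightarrow> elts (ap k x) \<subseteq> elts (ap k y)"
    if "x \<in> elts reals" "y \<in> elts reals" for x y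
    using pwo_pairr[OF that, of h] pwo_pairr[OF that, of k] unfolding eq by blast
  have less: "ap h x \<in> elts (ap h y) \<longleftrightarrow> ap k x \<in> elts (ap k y)"
    if "x \<in> elts reals" "y \<in> elts reals" for x y
    using sub[OF that(2,1)] ord_not_mem[OF oh[OF that(1)] oh[OF that(2)]]
      ord_not_mem[OF ok[OF that(1)] ok[OF that(2)]] by blast
  have below: "elts (ap h x) = ap h ` {y \<in> elts reals. ap h y \<in> elts (ap h x)}" if "x \<in> elts reals" for x
  proof -
    have "\<exists>y\<in>elts reals. ap h y = v" if "v \<in> elts (ap h x)" for v
      using a ha[OF \<open>x \<in> elts reals\<close>] that ord_trans unfolding onto_def by blast
    then show ?thesis by blast
  qed
  have below': "elts (ap k x) = ap k ` {y \<in> elts reals. ap k y \<in> elts (ap k x)}" if "x \<in> elts reals" for x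
  proof -
    have "\<exists>y\<in>elts reals. ap k y = v" if "v \<in> elts (ap k x)" for v
      using b kb[OF \<open>x \<in> elts reals\<close>] that ord_trans unfolding onto_def by blast
    then show ?thesis by blast
  qed
  have "ordinal c \<Longrightarrow> \<forall>x\<in>elts reals. ap h x = c \<longrightarrow> ap k x = c" for c
  proof (rule ord_induct[where P = "\<lambda>c. \<forall>x\<in>elts reals. ap h x = c \<longrightarrow> ap k x = c"], intro dfi)
    fix c
    assume "ordinal c" and IH: "\<And>d. d \<in> elts c \<Longrightarrow> \<forall>x\<in>elts reals. ap h x = d \<longrightarrow> ap k x = d"
    show "\<forall>x\<in>elts reals. ap h x = c \<longrightarrow> ap k x = c"
    proof (intro ballI impI)
      fix x assume x: "x \<in> elts reals" and c: "ap h x = c"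
      let ?L = "{y \<in> elts reals. ap h y \<in> elts (ap h x)}"
      have L: "{y \<in> elts reals. ap k y \<in> elts (ap k x)} = ?L" using less x by blast
      have "ap k ` ?L = ap h ` ?L"
        by (rule image_cong) (use IH c in auto)
      then have "elts (ap k x) = elts (ap h x)" using below[OF x] below'[OF x] L by simp
      with c show "ap k x = c" by simp
    qed
  qed
  then have ap: "ap k x = ap h x" if "x \<in> elts reals" for x using oh that by blast
  have "h = k"
    by (rule fun_ext[of _ reals]) (use a b ap in \<open>auto simp: onto_def maps_iff\<close>)
  moreover have "elts a = ap h ` elts reals" "elts b = ap k ` elts reals"
    using a(2) b(2) unfolding onto_def maps_iff by auto
  ultimately show ?thesis by (metis elts_inject)
qed

text \<open>By \<open>pwo_determines\<close> the relevant ordinals are a functional image of the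
  power set of the reals, so Replacement makes them a set and their union exists.\<close>

lemma elts_Theta: "elts Theta = (\<Union>a\<in>{a. ordinal a \<and> (\<exists>h. onto h a)}. elts a)"
proof -
  have "dfn (\<lambda>s. ordinal (s (Suc 0)) \<and> (\<exists>h. onto h (s (Suc 0)) \<and> pwo h = s 0))" by (intro dfi)
  then have "\<exists>X. elts X = {a. \<exists>r\<in>elts (powerset reals). ordinal a \<and> (\<exists>h. onto h a \<and> pwo h = r)}"
    by (rule replacement_dfn[where Q = "\<lambda>r a. ordinal a \<and> (\<exists>h. onto h a \<and> pwo h = r)"])
      (use pwo_determines in blast)
  then obtain X where X: "elts X = {a. \<exists>r\<in>elts (powerset reals). ordinal a \<and> (\<exists>h. onto h a \<and> pwo h = r)}"
    by blast
  have "pwo h \<in> elts (powerset reals)" for h by (auto simp: elts_pwo)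
  with X have "elts X = {a. ordinal a \<and> (\<exists>h. onto h a)}" by blast
  then have "elts (bigU X) = (\<Union>a\<in>{a. ordinal a \<and> (\<exists>h. onto h a)}. elts a)" by simp
  then show ?thesis unfolding Theta_def surj_image_iff by (intro elts_setof) blast
qed

lemma ordinal_Theta: "ordinal Theta"
proof (rule ordinal_transI)
  show "transitive Theta" unfolding transitive_def elts_Theta using ord_trans by blast
  show "ordinal x" if "x \<in> elts Theta" for x using that unfolding elts_Theta by (blast intro: ord_elem)
qed

lemma Theta_ord: "a \<in> elts Theta \<Longrightarrow> ordinal a"
  using ord_elem ordinal_Theta by blast

lemma Rsmall_onto: "Rsmall Y \<Longrightarrow> y \<in> elts Y \<Longrightarrow> \<exists>h. onto h Y"
proof -
  assume "Rsmall Y" and y: "y \<in> elts Y"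
  then obtain f where f: "\<And>y. y \<in> elts Y \<Longrightarrow> \<exists>x\<in>elts reals. ap f x = y" unfolding Rsmall_def by blast
  let ?F = "\<lambda>x. if ap f x \<in> elts Y then ap f x else y"
  have F: "dft (\<lambda>s. ?F (s 0))" by (intro dfi)
  have "onto (lam reals ?F) Y"
    unfolding onto_def
  proof (intro conjI ballI)
    show "maps (lam reals ?F) reals Y" by (rule maps_lam[OF F]) (use y in simp)
    fix z assume z: "z \<in> elts Y"
    then obtain x where x: "x \<in> elts reals" "ap f x = z" using f by blast
    with z show "\<exists>x\<in>elts reals. ap (lam reals ?F) x = z"
      by (intro bexI[of _ x]) (simp_all add: ap_lam[OF F])
  qed
  then show ?thesis by blast
qed

text \<open>Going from \<open>a\<close> to \<open>suc a\<close> has two effects: \<open>a\<close>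
  becomes a member of an ordinal onto which the reals map, and that ordinal is nonempty, as
  \<open>Rsmall_onto\<close> demands.\<close>

lemma Theta_iff: "ordinal a \<Longrightarrow> a \<in> elts Theta \<longleftrightarrow> Rsmall a"
proof
  assume a: "ordinal a"
  show "a \<in> elts Theta \<Longrightarrow> Rsmall a"
  proof -
    assume "a \<in> elts Theta"
    then obtain b h where b: "ordinal b" "onto h b" "a \<in> elts b" unfolding elts_Theta by blast
    then have "elts a \<subseteq> elts b" using ord_trans by blast
    with b(2) show "Rsmall a" unfolding Rsmall_def onto_def by blast
  qed
  assume "Rsmall a"
  then have "Rsmall (suc a)" unfolding suc_Un2 by (simp add: Rsmall_Un2)
  with Rsmall_onto[of "suc a" a] obtain h where "onto h (suc a)" by auto
  with a show "a \<in> elts Theta" unfolding elts_Theta by (intro UN_I[of "suc a"]) auto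
qed

lemma Theta_not_Rsmall: "\<not> Rsmall Theta"
  using Theta_iff[OF ordinal_Theta] by simp

lemma omega_in_Theta: "omega \<in> elts Theta"
  by (simp add: Theta_iff)

lemma Theta_suc: "a \<in> elts Theta \<Longrightarrow> suc a \<in> elts Theta"
proof -
  assume a: "a \<in> elts Theta"
  have o: "ordinal a" using a by (rule Theta_ord)
  have "Rsmall (suc a)" unfolding suc_Un2 using a Theta_iff[OF o] by (simp add: Rsmall_Un2)
  then show ?thesis using Theta_iff[of "suc a"] o by simp
qed

lemma Theta_trans: "a \<in> elts Theta \<Longrightarrow> b \<in> elts a \<Longrightarrow> b \<in> elts Theta"
  using ord_trans[OF ordinal_Theta] by blast

lemma Theta_Un2: "a \<in> elts Theta \<Longrightarrow> b \<in> elts Theta \<Longrightarrow> Un2 a b \<in> elts Theta"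
  using Theta_iff[of a] Theta_iff[of b] Theta_iff[of "Un2 a b"] Theta_ord[of a] Theta_ord[of b]
  by (simp add: Rsmall_Un2 ordinal_Un2)

lemma zero_in_Theta: "zero \<in> elts Theta"
  using Theta_trans[OF omega_in_Theta zero_omega] .

text \<open>
  Regularity speaks about functions on ordinals below Theta. A set of ordinals that is a
  surjective image of the reals is reduced to that case by collapsing it to an ordinal.
\<close>
lemma Rsmall_bounded:
  assumes reg: "regular Theta" and X: "Rsmall X" "elts X \<subseteq> elts Theta"
  shows "\<exists>b\<in>elts Theta. elts X \<subseteq> elts b"
proof -
  \<comment> \<open>The recursion makes \<open>c\<close> the collapsing map of \<open>X\<close>:
    \<open>c a\<close> is the set of all \<open>c b\<close> with \<open>b\<close> in both
    \<open>a\<close> and \<open>X\<close>.\<close>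
  define H where "H f = img (sep (dm f) (\<lambda>e. e \<in> elts X)) (ap f)" for f
  have H: "dft (\<lambda>s. H (s 0))" unfolding H_def by (intro dfi)
  define c where "c = trv H"
  have c: "dft (\<lambda>s. c (s 0))" unfolding c_def by (rule dft_trv_H[OF H])
  have elts_c: "elts (c a) = c ` (elts a \<inter> elts X)" if "ordinal a" for a
  proof -
    have "c a = H (lam a c)" unfolding c_def by (rule trv_eq[OF H that])
    moreover have "elts (H (lam a c)) = ap (lam a c) ` elts (sep a (\<lambda>e. e \<in> elts X))"
      unfolding H_def dm_lam[OF c] by (rule elts_img) (intro dfi)
    moreover have "elts (sep a (\<lambda>e. e \<in> elts X)) = {e \<in> elts a. e \<in> elts X}"
      by (rule elts_sep) (intro dfi)
    ultimately show ?thesis by (auto simp: ap_lam[OF c])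
  qed
  have oX: "ordinal a" if "a \<in> elts X" for a using X(2) that Theta_ord by blast
  have less: "c a \<in> elts (c b)" if "a \<in> elts X" "b \<in> elts X" "a \<in> elts b" for a b
    using elts_c[OF oX[OF that(2)]] that by blast
  have inj: "a = b" if "a \<in> elts X" "b \<in> elts X" "c a = c b" for a b
    using ord_linear[OF oX[OF that(1)] oX[OF that(2)]] less[OF that(1,2)] less[OF that(2,1)] that(3) by auto
  define d where "d = img X c"
  have d: "elts d = c ` elts X" unfolding d_def by (rule elts_img[OF c])
  have tr: "transitive (c a)" if aX: "a \<in> elts X" for a
    unfolding transitive_def
  proof (intro ballI subsetI)
    fix y z assume "y \<in> elts (c a)" "z \<in> elts y"
    then obtain b where b: "b \<in> elts a" "b \<in> elts X" "y = c b" using elts_c[OF oX[OF aX]] by blast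
    with \<open>z \<in> elts y\<close> obtain e where "e \<in> elts b" "e \<in> elts X" "z = c e"
      using elts_c[OF oX[OF b(2)]] by blast
    moreover from \<open>e \<in> elts b\<close> b(1) have "e \<in> elts a" using oX[OF aX] ord_trans by blast
    ultimately show "z \<in> elts (c a)" using elts_c[OF oX[OF aX]] by blast
  qed
  have "ordinal d"
    unfolding ordinal_def
  proof (intro conjI ballI)
    show "transitive d"
      unfolding transitive_def d using elts_c oX by blast
    show "transitive y" if "y \<in> elts d" for y
      using that tr unfolding d by blast
  qed
  have "Rsmall d"
    by (rule Rsmall_image[OF X(1) c]) (simp add: d Bex_def image_iff)
  with Theta_iff[OF \<open>ordinal d\<close>] have dT: "d \<in> elts Theta" by blast
  \<comment> \<open>The inverse of the collapse is a function on the ordinal \<open>d\<close>, which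
    lies below Theta; to this function regularity applies.\<close>
  define F where "F y = iota (\<lambda>a. a \<in> elts X \<and> c a = y)" for y
  have F: "dft (\<lambda>s. F (s 0))" unfolding F_def by (intro dfi dft_comp1[of c, OF c])
  have Fc: "F (c a) = a" if "a \<in> elts X" for a
    unfolding F_def by (rule iota_eq) (use inj that in blast)+
  have m: "maps (lam d F) d Theta"
    by (rule maps_lam[OF F]) (use X(2) Fc d in auto)
  from reg dT m obtain b where b: "b \<in> elts Theta" "\<And>x. x \<in> elts d \<Longrightarrow> app (lam d F) x \<in> elts b"
    unfolding regular_def by blast
  have "a \<in> elts b" if "a \<in> elts X" for a
  proof -
    have ca: "c a \<in> elts d" using that d by blast
    have "app (lam d F) (c a) = a"
      using app_eq_ap[OF fun_on_lam[OF F] ca] ap_lam[OF F ca] Fc[OF that] by simp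
    with b(2)[OF ca] show ?thesis by simp
  qed
  with b(1) show ?thesis by blast
qed


lemma iota_cases: "P (iota P) \<or> iota P = zero"
proof (cases "\<exists>!x. P x")
  case True
  have "P (iota P)" unfolding iota_def if_P[OF True] by (rule theI'[OF True])
  then show ?thesis ..
next
  case False
  have "iota P = zero" unfolding iota_def if_not_P[OF False] zero_def by (rule refl)
  then show ?thesis ..
qed

section \<open>Finite sequences of natural numbers\<close>

lemma elts_finite_seqs: "elts (finite_seqs a) = {s. \<exists>n\<in>elts omega. maps s n a}"
  unfolding finite_seqs_def
proof (rule elts_setof_sub[where a = "powerset (prod omega a)"])
  show "dfn (\<lambda>s. \<exists>n\<in>elts omega. maps (s 0) n a)" by (intro dfi)
  fix s assume "\<exists>n\<in>elts omega. maps s n a"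
  then obtain n where n: "n \<in> elts omega" "maps s n a" by blast
  have "elts (prod n a) \<subseteq> elts (prod omega a)"
    using omega_trans[OF n(1)] unfolding elts_prod by blast
  with maps_prod[OF n(2)] show "s \<in> elts (powerset (prod omega a))" by auto
qed

text \<open>This is the number 2^a (2 b + 1); comparing parities and halving shows that it
  determines \<open>a\<close> and \<open>b\<close>.\<close>

definition pairn :: "'a \<Rightarrow> 'a \<Rightarrow> 'a" where
  "pairn a b = nrec (suc (dbl b)) (\<lambda>n y. dbl y) a"

lemma dft_nrec' [dfi]:
  assumes "dft t" "dft u" "dft (\<lambda>s. G (\<lambda>i. s (Suc i)) (bigU (dm (s 0))) (ap (s 0) (bigU (dm (s 0)))))"
  shows "dft (\<lambda>s. nrec (t s) (G s) (u s))"
  unfolding nrec_def by (intro dfi assms dft_rename[OF assms(1), of Suc])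

lemma dft_pairn [dfi]: "dft t \<Longrightarrow> dft u \<Longrightarrow> dft (\<lambda>s. pairn (t s) (u s))"
  by (rule dft_comp2[of pairn]) (simp_all only: pairn_def, intro dfi)

lemma dft_snd_dbl: "dft (\<lambda>s. dbl (s (Suc 0)))"
  by (intro dfi)

lemma pairn_zero: "pairn zero b = suc (dbl b)"
  unfolding pairn_def by (rule nrec_zero[OF dft_snd_dbl])

lemma pairn_suc: "a \<in> elts omega \<Longrightarrow> pairn (suc a) b = dbl (pairn a b)"
  unfolding pairn_def by (rule nrec_suc[OF dft_snd_dbl])

lemma pairn_omega: "a \<in> elts omega \<Longrightarrow> b \<in> elts omega \<Longrightarrow> pairn a b \<in> elts omega"
proof (induction a rule: omega_induct)
  case dfn
  show ?case by (intro dfi)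
qed (simp_all add: pairn_zero pairn_suc)

lemma pairn_inject:
  assumes a: "a \<in> elts omega" and "c \<in> elts omega" "b \<in> elts omega" "d \<in> elts omega"
    and "pairn a b = pairn c d"
  shows "a = c \<and> b = d"
proof -
  have "\<forall>c\<in>elts omega. \<forall>b\<in>elts omega. \<forall>d\<in>elts omega. pairn a b = pairn c d \<longrightarrow> a = c \<and> b = d"
    using a
  proof (induction a rule: omega_induct)
    case dfn
    show ?case by (intro dfi)
  next
    case zero
    show ?case
    proof (intro ballI impI)
      fix c b d
      assume c: "c \<in> elts omega" and bd: "b \<in> elts omega" "d \<in> elts omega" and eq: "pairn zero b = pairn c d"
      from omega_cases[OF c] show "zero = c \<and> b = d"
      proof (elim disjE bexE)
        assume "c = zero"
        with eq bd show ?thesis by (simp add: pairn_zero dbl_inject)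
      next
        fix k assume k: "k \<in> elts omega" "c = suc k"
        with eq have "suc (dbl b) = dbl (pairn k d)" by (simp add: pairn_zero pairn_suc)
        with dbl_neq_suc_dbl[OF pairn_omega[OF k(1) bd(2)] bd(1)] show ?thesis by simp
      qed
    qed
  next
    case (suc n)
    show ?case
    proof (intro ballI impI)
      fix c b d
      assume c: "c \<in> elts omega" and bd: "b \<in> elts omega" "d \<in> elts omega" and eq: "pairn (suc n) b = pairn c d"
      from omega_cases[OF c] show "suc n = c \<and> b = d"
      proof (elim disjE bexE)
        assume "c = zero"
        with eq suc(1) have "dbl (pairn n b) = suc (dbl d)" by (simp add: pairn_zero pairn_suc)
        with dbl_neq_suc_dbl[OF pairn_omega[OF suc(1) bd(1)] bd(2)] show ?thesis by simp
      next
        fix k assume k: "k \<in> elts omega" "c = suc k"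
        with eq suc(1) have "dbl (pairn n b) = dbl (pairn k d)" by (simp add: pairn_suc)
        then have "pairn n b = pairn k d"
          using dbl_inject[OF pairn_omega[OF suc(1) bd(1)] pairn_omega[OF k(1) bd(2)]] by simp
        with suc(2) k bd show ?thesis by simp
      qed
    qed
  qed
  with assms show ?thesis by blast
qed

definition seq_code :: "'a \<Rightarrow> 'a \<Rightarrow> 'a" where
  "seq_code s = nrec zero (\<lambda>k y. pairn y (ap s k))"

lemma dft_seq_code [dfi]: "dft t \<Longrightarrow> dft u \<Longrightarrow> dft (\<lambda>s. seq_code (t s) (u s))"
  by (rule dft_comp2[of seq_code]) (simp_all only: seq_code_def, intro dfi)

lemma dft_seq_code_step: "dft (\<lambda>z. pairn (z (Suc 0)) (ap s (z 0)))"
  by (intro dfi)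

lemma seq_code_suc: "n \<in> elts omega \<Longrightarrow> seq_code s (suc n) = pairn (seq_code s n) (ap s n)"
  unfolding seq_code_def by (rule nrec_suc[OF dft_seq_code_step])

lemma seq_code_omega: "n \<in> elts omega \<Longrightarrow> (\<forall>k\<in>elts n. ap s k \<in> elts omega) \<longrightarrow> seq_code s n \<in> elts omega"
proof (induction n rule: omega_induct)
  case dfn
  show ?case by (intro dfi)
next
  case zero
  show ?case unfolding seq_code_def by (simp add: nrec_zero[OF dft_seq_code_step])
qed (simp add: seq_code_suc pairn_omega)

lemma seq_code_inject: "n \<in> elts omega \<Longrightarrow> (\<forall>k\<in>elts n. ap s k \<in> elts omega) \<and> (\<forall>k\<in>elts n. ap t k \<in> elts omega) \<and>
    seq_code s n = seq_code t n \<longrightarrow> (\<forall>k\<in>elts n. ap s k = ap t k)"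
proof (induction n rule: omega_induct)
  case dfn
  show ?case by (intro dfi)
next
  case (suc n)
  show ?case
  proof
    assume a: "(\<forall>k\<in>elts (suc n). ap s k \<in> elts omega) \<and> (\<forall>k\<in>elts (suc n). ap t k \<in> elts omega) \<and>
      seq_code s (suc n) = seq_code t (suc n)"
    then have "pairn (seq_code s n) (ap s n) = pairn (seq_code t n) (ap t n)"
      using suc(1) by (simp add: seq_code_suc)
    with a suc(1) have "seq_code s n = seq_code t n \<and> ap s n = ap t n"
      by (intro pairn_inject) (simp_all add: seq_code_omega)
    with suc(2) a show "\<forall>k\<in>elts (suc n). ap s k = ap t k" by simp
  qed
qed simp

text \<open>The length is recorded as well, because \<open>seq_code_inject\<close> compares
  sequences of one and the same length.\<close>

definition seq_number :: "'a \<Rightarrow> 'a" where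
  "seq_number s = pairn (dm s) (seq_code s (dm s))"

lemma dft_seq_number [dfi]: "dft t \<Longrightarrow> dft (\<lambda>s. seq_number (t s))"
  by (rule dft_comp1[of seq_number]) (simp_all only: seq_number_def, intro dfi)

lemma seq_number_omega: "s \<in> elts (finite_seqs omega) \<Longrightarrow> seq_number s \<in> elts omega"
  unfolding elts_finite_seqs seq_number_def
  using dm_fun_on by (auto simp: maps_iff seq_code_omega intro!: pairn_omega)

lemma seq_number_inject:
  assumes "s \<in> elts (finite_seqs omega)" "t \<in> elts (finite_seqs omega)" "seq_number s = seq_number t"
  shows "s = t"
proof -
  from assms obtain n m where n: "n \<in> elts omega" "fun_on s n" "\<forall>k\<in>elts n. ap s k \<in> elts omega"
    and m: "m \<in> elts omega" "fun_on t m" "\<forall>k\<in>elts m. ap t k \<in> elts omega"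
    unfolding elts_finite_seqs maps_iff by blast
  have "n = m \<and> seq_code s n = seq_code t m"
    using assms(3) unfolding seq_number_def dm_fun_on[OF n(2)] dm_fun_on[OF m(2)]
    by (intro pairn_inject) (use n m seq_code_omega in blast)+
  with seq_code_inject[OF n(1), of s t] n m show ?thesis by (blast intro: fun_ext)
qed

lemma Rsmall_strategies: "Rsmall (funs (finite_seqs omega) omega)"
proof (rule RsmallI[where F = "\<lambda>x. lam (finite_seqs omega) (\<lambda>s. ap x (seq_number s))"])
  show "dft (\<lambda>s. lam (finite_seqs omega) (\<lambda>t. ap (s 0) (seq_number t)))" by (intro dfi)
  fix g assume "g \<in> elts (funs (finite_seqs omega) omega)"
  then have g: "fun_on g (finite_seqs omega)" "\<And>s. s \<in> elts (finite_seqs omega) \<Longrightarrow> ap g s \<in> elts omega"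
    unfolding elts_funs maps_iff by blast+
  \<comment> \<open>At a number that belongs to no sequence the default of \<open>iota\<close> is
    \<open>zero\<close>, a natural number, so \<open>lam omega F\<close> is a real.\<close>
  define F where "F j = iota (\<lambda>v. \<exists>s\<in>elts (finite_seqs omega). seq_number s = j \<and> v = ap g s)" for j
  have F: "dft (\<lambda>s. F (s 0))" unfolding F_def by (intro dfi)
  have F_eq: "F (seq_number s) = ap g s" if s: "s \<in> elts (finite_seqs omega)" for s
    unfolding F_def
  proof (rule iota_eq)
    show "\<exists>t\<in>elts (finite_seqs omega). seq_number t = seq_number s \<and> ap g s = ap g t" using s by blast
    fix v assume "\<exists>t\<in>elts (finite_seqs omega). seq_number t = seq_number s \<and> v = ap g t"
    then obtain t where t: "t \<in> elts (finite_seqs omega)" "seq_number t = seq_number s" "v = ap g t" by blast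
    from seq_number_inject[OF t(1) s t(2)] t(3) show "v = ap g s" by simp
  qed
  have "F j \<in> elts omega" for j
    using iota_cases[of "\<lambda>v. \<exists>s\<in>elts (finite_seqs omega). seq_number s = j \<and> v = ap g s", folded F_def] g(2)
    by auto
  then have r: "lam omega F \<in> elts reals" by (intro lam_reals[OF F])
  have d: "dft (\<lambda>s. ap (lam omega F) (seq_number (s 0)))" by (intro dfi)
  have "g = lam (finite_seqs omega) (\<lambda>s. ap (lam omega F) (seq_number s))"
    by (rule fun_ext[OF g(1) fun_on_lam[OF d]]) (simp add: ap_lam[OF d] ap_lam[OF F] seq_number_omega F_eq)
  with r show "\<exists>x\<in>elts reals. g = lam (finite_seqs omega) (\<lambda>s. ap x (seq_number s))" by blast
qed

section \<open>Lipschitz maps and Wadge's lemma\<close>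

text \<open>Digit \<open>n\<close> of the value may depend on digits 0 to \<open>n\<close> of the
  argument. This is the information player II has when making move \<open>n\<close> in response to
  player I.\<close>

definition isLip :: "'a \<Rightarrow> bool" where
  "isLip f \<longleftrightarrow> maps f reals reals \<and> (\<forall>x\<in>elts reals. \<forall>y\<in>elts reals. \<forall>n\<in>elts omega.
     (\<forall>m\<in>elts (suc n). ap x m = ap y m) \<longrightarrow> ap (ap f x) n = ap (ap f y) n)"

lemma dfn_isLip [dfi]: "dft t \<Longrightarrow> dfn (\<lambda>s. isLip (t s))"
  by (rule dfn_comp1[of isLip]) (simp_all only: isLip_def, intro dfi)

definition LipS :: 'a where
  "LipS = sep (funs reals reals) isLip"

lemma elts_LipS: "elts LipS = {f. isLip f}"
proof -
  have "dfn (\<lambda>s. isLip (s 0))" by (intro dfi)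
  from elts_sep[OF this, of "funs reals reals"] show ?thesis
    unfolding LipS_def elts_funs isLip_def by blast
qed

lemma initial_seq: "x \<in> elts reals \<Longrightarrow> n \<in> elts omega \<Longrightarrow> restr x n \<in> elts (finite_seqs omega)"
  unfolding elts_finite_seqs reals_iff using maps_restr omega_trans by blast

lemma omega_subset: "n \<in> elts omega \<Longrightarrow> elts n \<subseteq> elts omega"
  using omega_trans by blast

lemma restr_eq_iff:
  assumes "x \<in> elts reals" "y \<in> elts reals" "n \<in> elts omega" "m \<in> elts omega"
  shows "restr x n = restr y m \<longleftrightarrow> n = m \<and> (\<forall>k\<in>elts n. ap x k = ap y k)"
proof -
  have x: "fun_on x omega" and y: "fun_on y omega" using assms(1,2) unfolding reals_iff maps_iff by blast+
  note rx = fun_on_restr[OF x omega_subset[OF assms(3)]] ap_restr[OF x omega_subset[OF assms(3)]]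
  note ry = fun_on_restr[OF y omega_subset[OF assms(4)]] ap_restr[OF y omega_subset[OF assms(4)]]
  show ?thesis
  proof
    assume eq: "restr x n = restr y m"
    then have "n = m" using dm_fun_on[OF rx(1)] dm_fun_on[OF ry(1)] by simp
    have "ap x k = ap y k" if k: "k \<in> elts n" for k
    proof -
      have "ap x k = ap (restr x n) k" using rx(2)[OF k] by simp
      also have "\<dots> = ap y k" unfolding eq by (rule ry(2)) (use k \<open>n = m\<close> in simp)
      finally show ?thesis .
    qed
    with \<open>n = m\<close> show "n = m \<and> (\<forall>k\<in>elts n. ap x k = ap y k)" by blast
  next
    assume a: "n = m \<and> (\<forall>k\<in>elts n. ap x k = ap y k)"
    show "restr x n = restr y m"
    proof (rule fun_ext[OF rx(1)])
      show "fun_on (restr y m) n" using ry(1) a by simp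
      fix k assume k: "k \<in> elts n"
      then have "ap (restr y m) k = ap y k" using a by (intro ry(2)) simp
      with rx(2)[OF k] a k show "ap (restr x n) k = ap (restr y m) k" by simp
    qed
  qed
qed

text \<open>Digit \<open>n\<close> of the value is a function of the initial segment of length
  \<open>suc n\<close>, so a Lipschitz map amounts to a function on finite sequences, like a
  strategy.\<close>

lemma Rsmall_LipS: "Rsmall LipS"
proof (rule Rsmall_image[OF Rsmall_strategies, where F = "\<lambda>g. lam reals (\<lambda>x. lam omega (\<lambda>n. ap g (restr x (suc n))))"])
  show "dft (\<lambda>s. lam reals (\<lambda>x. lam omega (\<lambda>n. ap (s 0) (restr x (suc n)))))" by (intro dfi)
  fix f assume "f \<in> elts LipS"
  then have f: "fun_on f reals" "\<And>x. x \<in> elts reals \<Longrightarrow> ap f x \<in> elts reals"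
    "\<And>x y n. x \<in> elts reals \<Longrightarrow> y \<in> elts reals \<Longrightarrow> n \<in> elts omega \<Longrightarrow>
       (\<forall>m\<in>elts (suc n). ap x m = ap y m) \<Longrightarrow> ap (ap f x) n = ap (ap f y) n"
    unfolding elts_LipS isLip_def maps_iff by blast+
  define F where "F s = iota (\<lambda>v. \<exists>x\<in>elts reals. \<exists>n\<in>elts omega. s = restr x (suc n) \<and> v = ap (ap f x) n)" for s
  have F: "dft (\<lambda>s. F (s 0))" unfolding F_def by (intro dfi)
  have F_eq: "F (restr x (suc n)) = ap (ap f x) n" if x: "x \<in> elts reals" and n: "n \<in> elts omega" for x n
    unfolding F_def
  proof (rule iota_eq)
    show "\<exists>y\<in>elts reals. \<exists>m\<in>elts omega. restr x (suc n) = restr y (suc m) \<and> ap (ap f x) n = ap (ap f y) m"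
      using x n by blast
    fix v assume "\<exists>y\<in>elts reals. \<exists>m\<in>elts omega. restr x (suc n) = restr y (suc m) \<and> v = ap (ap f y) m"
    then obtain y m where y: "y \<in> elts reals" "m \<in> elts omega" "restr x (suc n) = restr y (suc m)" "v = ap (ap f y) m"
      by blast
    from y(3) have e: "suc n = suc m \<and> (\<forall>k\<in>elts (suc n). ap x k = ap y k)"
      using restr_eq_iff[OF x y(1) suc_omega[OF n] suc_omega[OF y(2)]] by blast
    then have "n = m" by simp
    moreover from e have "\<forall>k\<in>elts (suc n). ap x k = ap y k" by blast
    ultimately    show "v = ap (ap f x) n" using f(3)[OF x y(1) n] y(4) by metis
  qed
  have "F s \<in> elts omega" for s
    using iota_cases[of "\<lambda>v. \<exists>x\<in>elts reals. \<exists>n\<in>elts omega. s = restr x (suc n) \<and> v = ap (ap f x) n", folded F_def] f(2)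
    by auto
  then have m: "lam (finite_seqs omega) F \<in> elts (funs (finite_seqs omega) omega)"
    unfolding elts_funs using maps_lam[OF F] by blast
  have d1: "dft (\<lambda>s. lam omega (\<lambda>n. ap (lam (finite_seqs omega) F) (restr (s 0) (suc n))))" by (intro dfi)
  have d2: "dft (\<lambda>s. ap (lam (finite_seqs omega) F) (restr x (suc (s 0))))" for x by (intro dfi)
  have "f = lam reals (\<lambda>x. lam omega (\<lambda>n. ap (lam (finite_seqs omega) F) (restr x (suc n))))"
  proof (rule fun_ext[OF f(1) fun_on_lam[OF d1]])
    fix x assume x: "x \<in> elts reals"
    have "ap f x = lam omega (\<lambda>n. ap (lam (finite_seqs omega) F) (restr x (suc n)))"
    proof (rule fun_ext[of _ omega])
      show "fun_on (ap f x) omega" using f(2)[OF x] unfolding reals_iff maps_iff by blast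
      show "fun_on (lam omega (\<lambda>n. ap (lam (finite_seqs omega) F) (restr x (suc n)))) omega"
        by (rule fun_on_lam[OF d2])
      fix n assume n: "n \<in> elts omega"
      show "ap (ap f x) n = ap (lam omega (\<lambda>n. ap (lam (finite_seqs omega) F) (restr x (suc n)))) n"
        by (simp only: ap_lam[OF d2 n] ap_lam[OF F initial_seq[OF x suc_omega[OF n]]] F_eq[OF x n])
    qed
    then show "ap f x = ap (lam reals (\<lambda>x. lam omega (\<lambda>n. ap (lam (finite_seqs omega) F) (restr x (suc n))))) x"
      by (simp only: ap_lam[OF d1 x])
  qed
  with m show "\<exists>g\<in>elts (funs (finite_seqs omega) omega).
      f = lam reals (\<lambda>x. lam omega (\<lambda>n. ap g (restr x (suc n))))" by blast
qed

definition pre :: "'a \<Rightarrow> 'a \<Rightarrow> 'a" where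
  "pre f A = sep reals (\<lambda>x. ap f x \<in> elts A)"

lemma dft_pre [dfi]: "dft t \<Longrightarrow> dft u \<Longrightarrow> dft (\<lambda>s. pre (t s) (u s))"
  by (rule dft_comp2[of pre]) (simp_all only: pre_def, intro dfi)

lemma elts_pre: "elts (pre f A) = {x \<in> elts reals. ap f x \<in> elts A}"
  unfolding pre_def by (rule elts_sep) (intro dfi)

lemma isLip_id: "isLip (lam reals (\<lambda>x. x))"
proof -
  have d: "dft (\<lambda>s. s 0)" by (intro dfi)
  show ?thesis
    unfolding isLip_def using maps_lam[OF d, of reals reals] by (simp add: ap_lam[OF d])
qed

lemma pre_id: "elts A \<subseteq> elts reals \<Longrightarrow> pre (lam reals (\<lambda>x. x)) A = A"
proof -
  have d: "dft (\<lambda>s. s 0)" by (intro dfi)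
  assume "elts A \<subseteq> elts reals"
  then show ?thesis by (intro elts_eqI) (auto simp: elts_pre ap_lam[OF d])
qed

lemma isLip_comp:
  assumes f: "isLip f" and g: "isLip g"
  shows "isLip (lam reals (\<lambda>x. ap f (ap g x)))" "pre (lam reals (\<lambda>x. ap f (ap g x))) A = pre g (pre f A)"
proof -
  have d: "dft (\<lambda>s. ap f (ap g (s 0)))" by (intro dfi)
  have fr: "ap f x \<in> elts reals" "ap g x \<in> elts reals" if "x \<in> elts reals" for x
    using f g that unfolding isLip_def maps_iff by blast+
  show "isLip (lam reals (\<lambda>x. ap f (ap g x)))"
    unfolding isLip_def
  proof (intro conjI ballI impI)
    show "maps (lam reals (\<lambda>x. ap f (ap g x))) reals reals"
      by (rule maps_lam[OF d]) (simp add: fr)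
    fix x y n
    assume x: "x \<in> elts reals" and y: "y \<in> elts reals" and n: "n \<in> elts omega"
      and agree: "\<forall>m\<in>elts (suc n). ap x m = ap y m"
    have "ap (ap g x) m = ap (ap g y) m" if "m \<in> elts (suc n)" for m
    proof -
      have "m \<in> elts omega" using omega_trans[OF suc_omega[OF n] that] .
      moreover have "elts (suc m) \<subseteq> elts (suc n)"
        using that omega_ord[OF n] ord_trans by auto
      ultimately show ?thesis using g x y agree unfolding isLip_def by blast
    qed
    then have "ap (ap f (ap g x)) n = ap (ap f (ap g y)) n"
      using f fr(2)[OF x] fr(2)[OF y] n unfolding isLip_def by blast
    then show "ap (ap (lam reals (\<lambda>x. ap f (ap g x))) x) n = ap (ap (lam reals (\<lambda>x. ap f (ap g x))) y) n"
      by (simp only: ap_lam[OF d x] ap_lam[OF d y])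
  qed
  show "pre (lam reals (\<lambda>x. ap f (ap g x))) A = pre g (pre f A)"
    by (rule elts_eqI) (auto simp: elts_pre ap_lam[OF d] fr)
qed

lemma dbl_gap: "m \<in> elts omega \<Longrightarrow> \<forall>k\<in>elts m. elts (suc (suc (dbl k))) \<subseteq> elts (dbl m)"
proof (induction m rule: omega_induct)
  case dfn
  show ?case by (intro dfi)
qed auto

lemma dbl_less: "m \<in> elts omega \<Longrightarrow> k \<in> elts omega \<Longrightarrow> dbl m \<in> elts (suc (suc (dbl k))) \<Longrightarrow> m \<in> elts (suc k)"
proof (rule ccontr)
  assume m: "m \<in> elts omega" and k: "k \<in> elts omega" and less: "dbl m \<in> elts (suc (suc (dbl k)))" "m \<notin> elts (suc k)"
  then have "k \<in> elts m" using ord_linear[OF omega_ord omega_ord, OF m k] by auto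
  with dbl_gap[OF m] less(1) have "dbl m \<in> elts (dbl m)" by blast
  then show False by simp
qed

text \<open>
  \<open>play x\<close> is the run of the game in which the strategy \<open>\<sigma>\<close> moves at the positions
  \<open>D2 k\<close> and its opponent plays \<open>x k\<close> at the positions \<open>D1 k\<close>.
\<close>
lemma strategy_map:
  assumes D1: "dft (\<lambda>s. D1 (s 0))" and D2: "dft (\<lambda>s. D2 (s 0))"
    and cover: "\<And>n. n \<in> elts omega \<Longrightarrow> \<exists>k\<in>elts omega. n = D1 k \<or> n = D2 k"
    and D_omega: "\<And>k. k \<in> elts omega \<Longrightarrow> D1 k \<in> elts omega" "\<And>k. k \<in> elts omega \<Longrightarrow> D2 k \<in> elts omega"
    and inj: "\<And>k m. k \<in> elts omega \<Longrightarrow> m \<in> elts omega \<Longrightarrow> D1 k = D1 m \<Longrightarrow> k = m"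
    and disj: "\<And>k m. k \<in> elts omega \<Longrightarrow> m \<in> elts omega \<Longrightarrow> D1 k \<noteq> D2 m"
    and loc: "\<And>k m. k \<in> elts omega \<Longrightarrow> m \<in> elts omega \<Longrightarrow> D1 m \<in> elts (suc (D2 k)) \<Longrightarrow> m \<in> elts (suc k)"
    and \<sigma>: "maps \<sigma> (finite_seqs omega) omega"
  shows "\<exists>f. isLip f \<and> (\<forall>x\<in>elts reals. \<exists>z\<in>elts reals. \<forall>k\<in>elts omega.
    ap z (D1 k) = ap x k \<and> ap z (D2 k) = ap \<sigma> (restr z (D2 k)) \<and> ap (ap f x) k = ap z (D2 k))"
proof -
  \<comment> \<open>The next move as a function of the history \<open>f\<close>; its domain is the
    current position and decides whose turn it is.\<close>
  define H where "H x f = iota (\<lambda>v. \<exists>k\<in>elts omega. dm f = D1 k \<and> v = ap x k \<or> dm f = D2 k \<and> v = ap \<sigma> f)" for x f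
  have H2: "dft (\<lambda>s. H (s i) (s k))" for i k
    unfolding H_def by (intro dfi dft_comp1[of D1, OF D1] dft_comp1[of D2, OF D2])
  have H: "dft (\<lambda>s. H x (s 0))" for x
    unfolding H_def by (intro dfi dft_comp1[of D1, OF D1] dft_comp1[of D2, OF D2])
  have H_D1: "H x f = ap x k" if "dm f = D1 k" "k \<in> elts omega" for x f k
    unfolding H_def by (rule iota_eq) (use that inj disj in metis)+
  have H_D2: "H x f = ap \<sigma> f" if "dm f = D2 k" "k \<in> elts omega" for x f k
    unfolding H_def by (rule iota_eq) (use that disj in metis)+
  define Z where "Z x = trv (H x)" for x
  have Z: "dft (\<lambda>s. Z x (s 0))" for x unfolding Z_def by (rule dft_trv_H[OF H])
  have Z2: "dft (\<lambda>s. Z (s i) (s k))" for i k unfolding Z_def by (intro dfi H2)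
  have Z2': "dft t \<Longrightarrow> dft u \<Longrightarrow> dft (\<lambda>s. Z (t s) (u s))" for t u
    by (rule dft_comp2[of Z, OF Z2])
  have Z_eq: "Z x n = H x (lam n (Z x))" if "n \<in> elts omega" for x n
    unfolding Z_def by (rule trv_eq[OF H omega_ord[OF that]])
  have Z_D1: "Z x (D1 k) = ap x k" if "k \<in> elts omega" for x k
    using Z_eq[OF D_omega(1)[OF that], of x] H_D1[OF dm_lam[OF Z] that] by simp
  have Z_D2: "Z x (D2 k) = ap \<sigma> (lam (D2 k) (Z x))" if "k \<in> elts omega" for x k
    using Z_eq[OF D_omega(2)[OF that], of x] H_D2[OF dm_lam[OF Z] that] by simp
  have Z_omega: "Z x n \<in> elts omega" if x: "x \<in> elts reals" and n: "n \<in> elts omega" for x n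
  proof -
    have "n \<in> elts omega \<longrightarrow> Z x n \<in> elts omega"
    proof (rule ord_induct[where P = "\<lambda>n. n \<in> elts omega \<longrightarrow> Z x n \<in> elts omega"])
      show "dfn (\<lambda>s. s 0 \<in> elts omega \<longrightarrow> Z x (s 0) \<in> elts omega)" by (intro dfi Z2')
      show "ordinal n" using n by (rule omega_ord)
      fix n assume IH: "\<And>b. b \<in> elts n \<Longrightarrow> b \<in> elts omega \<longrightarrow> Z x b \<in> elts omega"
      show "n \<in> elts omega \<longrightarrow> Z x n \<in> elts omega"
      proof
        assume n: "n \<in> elts omega"
        then obtain k where k: "k \<in> elts omega" "n = D1 k \<or> n = D2 k" using cover by blast
        from k(2) show "Z x n \<in> elts omega"
        proof
          assume "n = D1 k"
          with k(1) x show ?thesis by (simp add: Z_D1)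
        next
          assume nk: "n = D2 k"
          have "maps (lam n (Z x)) n omega"
            by (rule maps_lam[OF Z]) (use IH omega_trans[OF n] in blast)
          with n have "lam n (Z x) \<in> elts (finite_seqs omega)" unfolding elts_finite_seqs by blast
          with \<sigma> have "ap \<sigma> (lam n (Z x)) \<in> elts omega" unfolding maps_iff by blast
          with Z_D2[OF k(1)] nk show ?thesis by simp
        qed
      qed
    qed
    with n show ?thesis by blast
  qed
  define z where "z x = lam omega (Z x)" for x
  have z_reals: "z x \<in> elts reals" if "x \<in> elts reals" for x
    unfolding z_def by (rule lam_reals[OF Z]) (rule Z_omega[OF that])
  have ap_z: "ap (z x) n = Z x n" if "n \<in> elts omega" for x n
    unfolding z_def by (rule ap_lam[OF Z that])
  have restr_z: "restr (z x) n = lam n (Z x)" if "n \<in> elts omega" for x n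
    unfolding z_def by (rule restr_lam[OF Z omega_subset[OF that]])
  \<comment> \<open>The run up to position \<open>n\<close> depends only on those moves of the
    opponent that are made at positions up to \<open>n\<close>. With \<open>loc\<close> this becomes
    the Lipschitz condition.\<close>
  have local: "Z x n = Z y n" if n: "n \<in> elts omega"
    and agree: "\<forall>m\<in>elts omega. D1 m \<in> elts (suc n) \<longrightarrow> ap x m = ap y m" for x y n
  proof -
    let ?P = "\<lambda>n. n \<in> elts omega \<longrightarrow> (\<forall>m\<in>elts omega. D1 m \<in> elts (suc n) \<longrightarrow> ap x m = ap y m) \<longrightarrow> Z x n = Z y n"
    have "?P n"
    proof (rule ord_induct[where P = ?P])
      show "dfn (\<lambda>s. ?P (s 0))" by (intro dfi Z2' dft_comp1[of D1, OF D1])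
      show "ordinal n" using n by (rule omega_ord)
      fix n assume o: "ordinal n" and IH: "\<And>b. b \<in> elts n \<Longrightarrow> ?P b"
      show "?P n"
      proof (intro impI)
        assume n: "n \<in> elts omega" and agree: "\<forall>m\<in>elts omega. D1 m \<in> elts (suc n) \<longrightarrow> ap x m = ap y m"
        have "Z x b = Z y b" if "b \<in> elts n" for b
        proof -
          have "elts (suc b) \<subseteq> elts (suc n)" using that o ord_trans by auto
          with IH[OF that] omega_trans[OF n that] agree show ?thesis by blast
        qed
        then have eq: "lam n (Z x) = lam n (Z y)"
          by (intro fun_ext[OF fun_on_lam[OF Z] fun_on_lam[OF Z]]) (simp add: ap_lam[OF Z])
        obtain k where k: "k \<in> elts omega" "n = D1 k \<or> n = D2 k" using cover[OF n] by blast
        from k(2) show "Z x n = Z y n"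
        proof
          assume nk: "n = D1 k"
          then have "ap x k = ap y k" using agree k(1) by simp
          with nk k(1) show ?thesis by (simp add: Z_D1)
        next
          assume "n = D2 k"
          with k(1) eq show ?thesis by (simp add: Z_D2)
        qed
      qed
    qed
    with n agree show ?thesis by blast
  qed
  define F where "F x = lam omega (\<lambda>k. Z x (D2 k))" for x
  have F: "dft (\<lambda>s. F (s 0))" unfolding F_def by (intro dfi Z2' dft_comp1[of D2, OF D2])
  have ZD2: "dft (\<lambda>s. Z x (D2 (s 0)))" for x by (intro Z2' dft_const D2)
  have F_reals: "F x \<in> elts reals" if "x \<in> elts reals" for x
    unfolding F_def by (rule lam_reals[OF ZD2]) (use that Z_omega D_omega(2) in blast)
  have ap_F: "ap (F x) k = Z x (D2 k)" if "k \<in> elts omega" for x k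
    unfolding F_def by (rule ap_lam[OF ZD2 that])
  have "isLip (lam reals F)"
    unfolding isLip_def
  proof (intro conjI ballI impI)
    show "maps (lam reals F) reals reals" by (rule maps_lam[OF F F_reals])
    fix x y n
    assume x: "x \<in> elts reals" and y: "y \<in> elts reals" and n: "n \<in> elts omega"
      and agree: "\<forall>m\<in>elts (suc n). ap x m = ap y m"
    have "Z x (D2 n) = Z y (D2 n)"
      by (rule local[OF D_omega(2)[OF n]]) (use agree loc[OF n] in blast)
    then show "ap (ap (lam reals F) x) n = ap (ap (lam reals F) y) n"
      by (simp only: ap_lam[OF F x] ap_lam[OF F y] ap_F[OF n])
  qed
  moreover have "\<exists>z\<in>elts reals. \<forall>k\<in>elts omega.
      ap z (D1 k) = ap x k \<and> ap z (D2 k) = ap \<sigma> (restr z (D2 k)) \<and> ap (ap (lam reals F) x) k = ap z (D2 k)"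
    if x: "x \<in> elts reals" for x
    by (rule bexI[OF _ z_reals[OF x]])
      (simp add: ap_z D_omega Z_D1 Z_D2 restr_z ap_lam[OF F x] ap_F)
  ultimately show ?thesis by blast
qed

lemma determined_cases:
  assumes "determined omega (elts B)"
  shows "(\<exists>\<sigma>. maps \<sigma> (finite_seqs omega) omega \<and> (\<forall>x\<in>elts reals.
      (\<forall>k\<in>elts omega. ap x (dbl k) = ap \<sigma> (restr x (dbl k))) \<longrightarrow> x \<in> elts B)) \<or>
    (\<exists>\<sigma>. maps \<sigma> (finite_seqs omega) omega \<and> (\<forall>x\<in>elts reals.
      (\<forall>k\<in>elts omega. ap x (suc (dbl k)) = ap \<sigma> (restr x (suc (dbl k)))) \<longrightarrow> x \<notin> elts B))"
proof -
  have ax: "app x n = ap x n" if "x \<in> elts reals" "n \<in> elts omega" for x n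
    using that app_eq_ap unfolding reals_iff maps_iff by blast
  have as: "app \<sigma> (restr x n) = ap \<sigma> (restr x n)"
    if "maps \<sigma> (finite_seqs omega) omega" "x \<in> elts reals" "n \<in> elts omega" for \<sigma> x n
    using app_eq_ap[of \<sigma> "finite_seqs omega"] that initial_seq unfolding maps_iff by blast
  have odd: "\<not> even_nat n \<longleftrightarrow> (\<exists>k\<in>elts omega. n = suc (dbl k))" if "n \<in> elts omega" for n
    using parity[OF that] dbl_neq_suc_dbl even_nat_iff[OF that] by metis
  have 1: "(\<forall>n\<in>elts omega. even_nat n \<longrightarrow> app x n = app \<sigma> (restr x n)) \<longleftrightarrow>
      (\<forall>k\<in>elts omega. ap x (dbl k) = ap \<sigma> (restr x (dbl k)))"
    if "maps \<sigma> (finite_seqs omega) omega" "x \<in> elts reals" for \<sigma> x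
    using ax[OF that(2)] as[OF that] even_nat_iff dbl_omega by metis
  have 2: "(\<forall>n\<in>elts omega. \<not> even_nat n \<longrightarrow> app x n = app \<sigma> (restr x n)) \<longleftrightarrow>
      (\<forall>k\<in>elts omega. ap x (suc (dbl k)) = ap \<sigma> (restr x (suc (dbl k))))"
    if "maps \<sigma> (finite_seqs omega) omega" "x \<in> elts reals" for \<sigma> x
    using ax[OF that(2)] as[OF that] odd suc_omega[OF dbl_omega] by metis
  show ?thesis
    using assms unfolding determined_def reals_def[symmetric]
    using 1 2 by metis
qed

definition compl :: "'a \<Rightarrow> 'a" where
  "compl A = sep reals (\<lambda>x. x \<notin> elts A)"

lemma elts_compl: "elts (compl A) = {x \<in> elts reals. x \<notin> elts A}"
  unfolding compl_def by (rule elts_sep) (intro dfi)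

text \<open>Let I play \<open>fstr z\<close>, let II play \<open>sndr z\<close>, and let I win when
  exactly one of \<open>fstr z \<in> elts A\<close> and \<open>sndr z \<in> elts C\<close> holds. A
  winning strategy of II reduces \<open>A\<close> to \<open>C\<close>; one of I reduces
  \<open>C\<close> to the complement of \<open>A\<close>.\<close>

lemma Wadge:
  assumes AD and A: "elts A \<subseteq> elts reals" and C: "elts C \<subseteq> elts reals"
  shows "(\<exists>f. isLip f \<and> A = pre f C) \<or> (\<exists>f. isLip f \<and> C = pre f (compl A))"
proof -
  define B where "B = sep reals (\<lambda>z. fstr z \<in> elts A \<longleftrightarrow> sndr z \<notin> elts C)"
  have B: "elts B = {z \<in> elts reals. fstr z \<in> elts A \<longleftrightarrow> sndr z \<notin> elts C}"
    unfolding B_def by (rule elts_sep) (intro dfi)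
  then have "determined omega (elts B)" using \<open>AD\<close> unfolding AD_def by blast
  from determined_cases[OF this] show ?thesis
  proof (elim disjE exE conjE)
    fix \<sigma>
    assume \<sigma>: "maps \<sigma> (finite_seqs omega) omega" and win: "\<forall>x\<in>elts reals.
      (\<forall>k\<in>elts omega. ap x (dbl k) = ap \<sigma> (restr x (dbl k))) \<longrightarrow> x \<in> elts B"
    have "\<exists>f. isLip f \<and> (\<forall>x\<in>elts reals. \<exists>z\<in>elts reals. \<forall>k\<in>elts omega.
      ap z (suc (dbl k)) = ap x k \<and> ap z (dbl k) = ap \<sigma> (restr z (dbl k)) \<and> ap (ap f x) k = ap z (dbl k))"
    proof (rule strategy_map[where ?D1.0 = "\<lambda>k. suc (dbl k)" and ?D2.0 = dbl])
      show "dft (\<lambda>s. suc (dbl (s 0)))" "dft (\<lambda>s. dbl (s 0))" by (intro dfi)+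
      show "\<exists>k\<in>elts omega. n = suc (dbl k) \<or> n = dbl k" if "n \<in> elts omega" for n
        using parity[OF that] by blast
      show "m \<in> elts (suc k)" if "k \<in> elts omega" "m \<in> elts omega" "suc (dbl m) \<in> elts (suc (dbl k))" for k m
      proof -
        have "dbl m \<in> elts (suc (suc (dbl k)))"
          using that ord_trans[of "suc (suc (dbl k))" "dbl m" "suc (dbl m)"] omega_ord[OF dbl_omega[OF that(1)]]
          by simp
        with that dbl_less show ?thesis by blast
      qed
    qed (use \<sigma> dbl_inject dbl_neq_suc_dbl in \<open>auto dest: sym\<close>)
    then obtain f where f: "isLip f" "\<And>x. x \<in> elts reals \<Longrightarrow> \<exists>z\<in>elts reals. \<forall>k\<in>elts omega.
      ap z (suc (dbl k)) = ap x k \<and> ap z (dbl k) = ap \<sigma> (restr z (dbl k)) \<and> ap (ap f x) k = ap z (dbl k)"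
      by blast
    have fr: "ap f x \<in> elts reals" if "x \<in> elts reals" for x
      using f(1) that unfolding isLip_def maps_iff by blast
    have "x \<in> elts C \<longleftrightarrow> ap f x \<in> elts (compl A)" if x: "x \<in> elts reals" for x
    proof -
      obtain z where z: "z \<in> elts reals" "\<And>k. k \<in> elts omega \<Longrightarrow>
        ap z (suc (dbl k)) = ap x k \<and> ap z (dbl k) = ap \<sigma> (restr z (dbl k)) \<and> ap (ap f x) k = ap z (dbl k)"
        using f(2)[OF x] by blast
      have "z \<in> elts B" using win z by blast
      then have "fstr z \<in> elts A \<longleftrightarrow> sndr z \<notin> elts C" unfolding B by blast
      moreover have "sndr z = x" by (rule reals_ext) (use z x in simp_all)
      moreover have "fstr z = ap f x" by (rule reals_ext) (use z fr[OF x] in simp_all)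
      ultimately show ?thesis using fr[OF x] unfolding elts_compl by auto
    qed
    then have "C = pre f (compl A)" using C by (intro elts_eqI) (auto simp: elts_pre)
    with f(1) show ?thesis by blast
  next
    fix \<sigma>
    assume \<sigma>: "maps \<sigma> (finite_seqs omega) omega" and win: "\<forall>x\<in>elts reals.
      (\<forall>k\<in>elts omega. ap x (suc (dbl k)) = ap \<sigma> (restr x (suc (dbl k)))) \<longrightarrow> x \<notin> elts B"
    have "\<exists>f. isLip f \<and> (\<forall>x\<in>elts reals. \<exists>z\<in>elts reals. \<forall>k\<in>elts omega.
      ap z (dbl k) = ap x k \<and> ap z (suc (dbl k)) = ap \<sigma> (restr z (suc (dbl k))) \<and> ap (ap f x) k = ap z (suc (dbl k)))"
    proof (rule strategy_map[where ?D1.0 = dbl and ?D2.0 = "\<lambda>k. suc (dbl k)"])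
      show "dft (\<lambda>s. suc (dbl (s 0)))" "dft (\<lambda>s. dbl (s 0))" by (intro dfi)+
    qed (use \<sigma> parity dbl_inject dbl_neq_suc_dbl dbl_less in \<open>auto dest: sym\<close>)
    then obtain f where f: "isLip f" "\<And>x. x \<in> elts reals \<Longrightarrow> \<exists>z\<in>elts reals. \<forall>k\<in>elts omega.
      ap z (dbl k) = ap x k \<and> ap z (suc (dbl k)) = ap \<sigma> (restr z (suc (dbl k))) \<and> ap (ap f x) k = ap z (suc (dbl k))"
      by blast
    have fr: "ap f x \<in> elts reals" if "x \<in> elts reals" for x
      using f(1) that unfolding isLip_def maps_iff by blast
    have "x \<in> elts A \<longleftrightarrow> ap f x \<in> elts C" if x: "x \<in> elts reals" for x
    proof -
      obtain z where z: "z \<in> elts reals" "\<And>k. k \<in> elts omega \<Longrightarrow>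
        ap z (dbl k) = ap x k \<and> ap z (suc (dbl k)) = ap \<sigma> (restr z (suc (dbl k))) \<and> ap (ap f x) k = ap z (suc (dbl k))"
        using f(2)[OF x] by blast
      have "z \<notin> elts B" using win z by blast
      then have "\<not> (fstr z \<in> elts A \<longleftrightarrow> sndr z \<notin> elts C)" unfolding B using z(1) by blast
      moreover have "fstr z = x" by (rule reals_ext) (use z x in simp_all)
      moreover have "sndr z = ap f x" by (rule reals_ext) (use z fr[OF x] in simp_all)
      ultimately show ?thesis by auto
    qed
    then have "A = pre f C" using A by (intro elts_eqI) (auto simp: elts_pre)
    with f(1) show ?thesis by blast
  qed
qed

section \<open>Sets of reals graded by surjective images of the reals\<close>

text \<open>\<open>Lg A a\<close>: some prewellordering of length \<open>a\<close> is a Lipschitz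
  preimage of \<open>A\<close>. The lengths obtained in this way serve as a rank for
  \<open>A\<close>, increasing along Lipschitz reducibility (\<open>Lg_mono\<close>).\<close>

definition Lg :: "'a \<Rightarrow> 'a \<Rightarrow> bool" where
  "Lg A a \<longleftrightarrow> a \<in> elts Theta \<and> (\<exists>f h. isLip f \<and> onto h a \<and> pwo h = pre f A)"

lemma dfn_Lg [dfi]: "dft t \<Longrightarrow> dft u \<Longrightarrow> dfn (\<lambda>s. Lg (t s) (u s))"
  by (rule dfn_comp2[of Lg]) (simp_all only: Lg_def, intro dfi)

lemma Lg_mono: "isLip f \<Longrightarrow> A = pre f C \<Longrightarrow> Lg A a \<Longrightarrow> Lg C a"
  unfolding Lg_def using isLip_comp by metis

definition Zs :: "'a \<Rightarrow> 'a" where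
  "Zs b = sep (powerset reals) (\<lambda>B. \<forall>a. Lg B a \<longrightarrow> a \<in> elts b)"

lemma dft_Zs [dfi]: "dft t \<Longrightarrow> dft (\<lambda>s. Zs (t s))"
  by (rule dft_comp1[of Zs]) (simp_all only: Zs_def, intro dfi)

lemma elts_Zs: "elts (Zs b) = {B. elts B \<subseteq> elts reals \<and> (\<forall>a. Lg B a \<longrightarrow> a \<in> elts b)}"
proof -
  have "dfn (\<lambda>s. \<forall>a. Lg (s 0) a \<longrightarrow> a \<in> elts b)" by (intro dfi)
  from elts_sep[OF this] show ?thesis unfolding Zs_def by simp
qed

lemma Zs_mono: "elts b \<subseteq> elts c \<Longrightarrow> elts (Zs b) \<subseteq> elts (Zs c)"
  unfolding elts_Zs by blast

text \<open>A Lipschitz map \<open>f\<close> determines the length of the prewellordering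
  \<open>pre f A\<close>, if it is one. So the lengths for \<open>A\<close> form an
  \<open>Rsmall\<close> subset of Theta, and regularity bounds them.\<close>

lemma Zs_cover:
  assumes "regular Theta" "elts A \<subseteq> elts reals"
  shows "\<exists>b\<in>elts Theta. A \<in> elts (Zs b)"
proof -
  define F where "F f = iota (\<lambda>a. ordinal a \<and> (\<exists>h. onto h a \<and> pwo h = pre f A))" for f
  have F: "dft (\<lambda>s. F (s 0))" unfolding F_def by (intro dfi)
  define X where "X = sep Theta (Lg A)"
  have X: "elts X = {a \<in> elts Theta. Lg A a}" unfolding X_def by (rule elts_sep) (intro dfi)
  have "Rsmall X"
  proof (rule Rsmall_image[OF Rsmall_LipS F])
    fix a assume "a \<in> elts X"
    then obtain f h where a: "ordinal a" and f: "isLip f" and h: "onto h a" "pwo h = pre f A"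
      using Theta_ord unfolding X Lg_def by blast
    have "F f = a"
      unfolding F_def by (rule iota_eq) (use a h pwo_determines in metis)+
    with f show "\<exists>f\<in>elts LipS. a = F f" unfolding elts_LipS by blast
  qed
  from Rsmall_bounded[OF assms(1) this] obtain b where "b \<in> elts Theta" "elts X \<subseteq> elts b"
    unfolding X by blast
  with assms(2) show ?thesis unfolding elts_Zs X Lg_def by blast
qed

text \<open>A prewellordering \<open>C\<close> of length \<open>suc b\<close> does not reduce to any
  member of \<open>Zs b\<close>. By \<open>Wadge\<close> all members reduce to the complement of
  this one set, and there are only \<open>Rsmall\<close> many reductions.\<close>

lemma Zs_Rsmall:
  assumes AD and b: "b \<in> elts Theta"
  shows "Rsmall (Zs b)"
proof -
  \<comment> \<open>The successor is nonempty even when \<open>b\<close> is not, so that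
    \<open>Rsmall_onto\<close> provides a surjection onto it.\<close>
  have sb: "suc b \<in> elts Theta" using Theta_suc[OF b] .
  have "Rsmall (suc b)" using sb Theta_iff[of "suc b"] Theta_ord[OF sb] by blast
  then obtain h where h: "onto h (suc b)" using Rsmall_onto[of "suc b" b] by auto
  define C where "C = pwo h"
  have C: "elts C \<subseteq> elts reals" unfolding C_def elts_pwo by blast
  have lgC: "Lg C (suc b)"
    unfolding Lg_def using sb isLip_id h pre_id[OF C] C_def by metis
  show ?thesis
  proof (rule Rsmall_image[OF Rsmall_LipS, where F = "\<lambda>f. pre f (compl C)"])
    show "dft (\<lambda>s. pre (s 0) (compl C))" by (intro dfi)
    fix B assume B: "B \<in> elts (Zs b)"
    then have "\<not> Lg B (suc b)" unfolding elts_Zs using mem_asym[of b "suc b"] by auto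
    then have "\<not> (\<exists>f. isLip f \<and> C = pre f B)" using Lg_mono lgC by blast
    with Wadge[OF \<open>AD\<close> C, of B] B obtain f where "isLip f" "B = pre f (compl C)"
      unfolding elts_Zs by blast
    then show "\<exists>f\<in>elts LipS. B = pre f (compl C)" unfolding elts_LipS by blast
  qed
qed

text \<open>Determinacy of games on \<open>omega\<close> is ordinal determinacy with the identity as
  the continuous map.\<close>

lemma AD_plus_AD: "AD_plus \<Longrightarrow> AD"
  unfolding AD_def
proof (intro allI impI)
  fix A assume "AD_plus" and A: "elts A \<subseteq> elts reals"
  have d: "dft (\<lambda>s. s 0)" by (intro dfi)
  let ?f = "lam reals (\<lambda>x. x)"
  have fo: "fun_on ?f reals" by (rule fun_on_lam[OF d])
  have ap: "app ?f x = x" if "x \<in> elts reals" for x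
    using app_eq_ap[OF fo that] ap_lam[OF d that] by simp
  have "maps ?f reals reals" by (rule maps_lam[OF d])
  then have "continuous_map omega ?f"
    unfolding continuous_map_def reals_def[symmetric] using ap by auto
  then have c: "continuous_map omega ?f \<and> elts A \<subseteq> elts reals" using A by blast
  have "ordinal_determinacy" using \<open>AD_plus\<close> unfolding AD_plus_def by (elim conjE)
  moreover have "omega \<noteq> zero" by (metis zero_omega elts_zero empty_iff)
  ultimately have "determined omega {x \<in> elts (funs omega omega). app ?f x \<in> elts A}"
    unfolding ordinal_determinacy_def using omega_in_Theta c by blast
  then have "determined omega {x \<in> elts reals. app ?f x \<in> elts A}"
    unfolding reals_def .
  moreover have "{x \<in> elts reals. app ?f x \<in> elts A} = elts A" using ap A by auto
  ultimately show "determined omega (elts A)" by simp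
qed


section \<open>Definable relations\<close>

text \<open>\<open>upd\<close> as a definable term; \<open>upd_eq\<close> identifies the two for
  functions on \<open>omega\<close>.\<close>

definition updf :: "'a \<Rightarrow> 'a \<Rightarrow> 'a \<Rightarrow> 'a" where
  "updf s i a = lam omega (\<lambda>k. if k = i then a else ap s k)"

lemma dft_updf [dfi]: "dft t \<Longrightarrow> dft u \<Longrightarrow> dft v \<Longrightarrow> dft (\<lambda>s. updf (t s) (u s) (v s))"
  by (rule dft_comp3[of updf]) (simp_all only: updf_def, intro dfi)

lemma ap_updf: "k \<in> elts omega \<Longrightarrow> ap (updf s i a) k = (if k = i then a else ap s k)"
  unfolding updf_def by (rule ap_lam) (intro dfi)

lemma fun_on_updf: "fun_on (updf s i a) omega"
  unfolding updf_def by (rule fun_on_lam) (intro dfi)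

lemma funs_iff: "s \<in> elts (funs a b) \<longleftrightarrow> fun_on s a \<and> (\<forall>x\<in>elts a. ap s x \<in> elts b)"
  by (simp add: elts_funs maps_iff)

lemma updf_funs: "s \<in> elts (funs omega A) \<Longrightarrow> a \<in> elts A \<Longrightarrow> updf s i a \<in> elts (funs omega A)"
  by (simp add: funs_iff fun_on_updf ap_updf)

lemma upd_eq: "fun_on s omega \<Longrightarrow> i \<in> elts omega \<Longrightarrow> upd s i a = updf s i a"
proof -
  assume s: "fun_on s omega" and i: "i \<in> elts omega"
  have d: "dft (\<lambda>z. if z 0 = i then a else ap s (z 0))" by (intro dfi)
  have "elts (updf s i a) = (\<lambda>k. opair k (if k = i then a else ap s k)) ` elts omega"
    unfolding updf_def by (rule elts_lam[OF d])
  also have "\<dots> = insert (opair i a) {opair k (app s k) | k. k \<in> elts omega \<and> k \<noteq> i}"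
    using i app_eq_ap[OF s] by auto
  finally show ?thesis unfolding upd_def by (metis setof_elts)
qed

definition rmem :: "'a \<Rightarrow> 'a \<Rightarrow> 'a \<Rightarrow> 'a" where
  "rmem A i k = sep (funs omega A) (\<lambda>s. ap s i \<in> elts (ap s k))"

definition req :: "'a \<Rightarrow> 'a \<Rightarrow> 'a \<Rightarrow> 'a" where
  "req A i k = sep (funs omega A) (\<lambda>s. ap s i = ap s k)"

definition rneg :: "'a \<Rightarrow> 'a \<Rightarrow> 'a" where
  "rneg A R = sep (funs omega A) (\<lambda>s. s \<notin> elts R)"

definition rcap :: "'a \<Rightarrow> 'a \<Rightarrow> 'a" where
  "rcap R S = sep R (\<lambda>s. s \<in> elts S)"

definition rex :: "'a \<Rightarrow> 'a \<Rightarrow> 'a \<Rightarrow> 'a" where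
  "rex A i R = sep (funs omega A) (\<lambda>s. \<exists>a\<in>elts A. updf s i a \<in> elts R)"

lemma dft_rmem [dfi]: "dft t \<Longrightarrow> dft u \<Longrightarrow> dft v \<Longrightarrow> dft (\<lambda>s. rmem (t s) (u s) (v s))"
  by (rule dft_comp3[of rmem]) (simp_all only: rmem_def, intro dfi)

lemma dft_req [dfi]: "dft t \<Longrightarrow> dft u \<Longrightarrow> dft v \<Longrightarrow> dft (\<lambda>s. req (t s) (u s) (v s))"
  by (rule dft_comp3[of req]) (simp_all only: req_def, intro dfi)

lemma dft_rneg [dfi]: "dft t \<Longrightarrow> dft u \<Longrightarrow> dft (\<lambda>s. rneg (t s) (u s))"
  by (rule dft_comp2[of rneg]) (simp_all only: rneg_def, intro dfi)

lemma dft_rcap [dfi]: "dft t \<Longrightarrow> dft u \<Longrightarrow> dft (\<lambda>s. rcap (t s) (u s))"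
  by (rule dft_comp2[of rcap]) (simp_all only: rcap_def, intro dfi)

lemma dft_rex [dfi]: "dft t \<Longrightarrow> dft u \<Longrightarrow> dft v \<Longrightarrow> dft (\<lambda>s. rex (t s) (u s) (v s))"
  by (rule dft_comp3[of rex]) (simp_all only: rex_def, intro dfi)

lemma elts_rmem: "elts (rmem A i k) = {s \<in> elts (funs omega A). ap s i \<in> elts (ap s k)}"
  unfolding rmem_def by (rule elts_sep) (intro dfi)

lemma elts_req: "elts (req A i k) = {s \<in> elts (funs omega A). ap s i = ap s k}"
  unfolding req_def by (rule elts_sep) (intro dfi)

lemma elts_rneg: "elts (rneg A R) = {s \<in> elts (funs omega A). s \<notin> elts R}"
  unfolding rneg_def by (rule elts_sep) (intro dfi)

lemma elts_rcap: "elts (rcap R S) = elts R \<inter> elts S"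
proof -
  have "dfn (\<lambda>s. s 0 \<in> elts S)" by (intro dfi)
  from elts_sep[OF this, of R] show ?thesis unfolding rcap_def by blast
qed

lemma elts_rex: "elts (rex A i R) = {s \<in> elts (funs omega A). \<exists>a\<in>elts A. updf s i a \<in> elts R}"
  unfolding rex_def by (rule elts_sep) (intro dfi)

lemma definability_closed_iff:
  "definability_closed A D \<longleftrightarrow>
     (\<forall>i\<in>elts omega. \<forall>k\<in>elts omega. rmem A i k \<in> elts D \<and> req A i k \<in> elts D) \<and>
     (\<forall>R\<in>elts D. rneg A R \<in> elts D) \<and>
     (\<forall>R\<in>elts D. \<forall>S\<in>elts D. rcap R S \<in> elts D) \<and>
     (\<forall>R\<in>elts D. \<forall>i\<in>elts omega. rex A i R \<in> elts D)"
proof -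
  have f: "fun_on s omega" if "s \<in> elts (funs omega A)" for s using that unfolding funs_iff by blast
  have apA: "app s n = ap s n" if "s \<in> elts (funs omega A)" "n \<in> elts omega" for s n
    using app_eq_ap[OF f[OF that(1)] that(2)] .
  have 1: "setof {s \<in> elts (funs omega A). app s i \<in> elts (app s k)} = rmem A i k"
    if "i \<in> elts omega" "k \<in> elts omega" for i k
    by (rule setof_eqI) (auto simp: elts_rmem apA that)
  have 2: "setof {s \<in> elts (funs omega A). app s i = app s k} = req A i k"
    if "i \<in> elts omega" "k \<in> elts omega" for i k
    by (rule setof_eqI) (auto simp: elts_req apA that)
  have 3: "setof (elts (funs omega A) - elts R) = rneg A R" for R
    by (rule setof_eqI) (auto simp: elts_rneg)
  have 4: "setof (elts R \<inter> elts S) = rcap R S" for R S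
    by (rule setof_eqI) (rule elts_rcap)
  have 5: "setof {s \<in> elts (funs omega A). \<exists>a\<in>elts A. upd s i a \<in> elts R} = rex A i R"
    if "i \<in> elts omega" for i R
    by (rule setof_eqI) (use f upd_eq that in \<open>auto simp: elts_rex\<close>)
  show ?thesis
    unfolding definability_closed_def 3 4 using 1 2 5 by (simp cong: ball_cong)
qed

lemma dfn_definability_closed [dfi]: "dft t \<Longrightarrow> dft u \<Longrightarrow> dfn (\<lambda>s. definability_closed (t s) (u s))"
  by (rule dfn_comp2[of definability_closed]) (simp_all only: definability_closed_iff, intro dfi)

lemma dfn_definable_relation [dfi]: "dft t \<Longrightarrow> dft u \<Longrightarrow> dfn (\<lambda>s. definable_relation (t s) (u s))"
  by (rule dfn_comp2[of definable_relation]) (simp_all only: definable_relation_def, intro dfi)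

definition Pdef :: "'a \<Rightarrow> 'a \<Rightarrow> 'a \<Rightarrow> 'a" where
  "Pdef A R s = sep A (\<lambda>w. updf s zero w \<in> elts R)"

lemma dft_Pdef [dfi]: "dft t \<Longrightarrow> dft u \<Longrightarrow> dft v \<Longrightarrow> dft (\<lambda>s. Pdef (t s) (u s) (v s))"
  by (rule dft_comp3[of Pdef]) (simp_all only: Pdef_def, intro dfi)

lemma elts_Pdef: "elts (Pdef A R s) = {w \<in> elts A. updf s zero w \<in> elts R}"
  unfolding Pdef_def by (rule elts_sep) (intro dfi)

lemma elts_Def: "elts (Def A) = {x. \<exists>R s. definable_relation A R \<and> s \<in> elts (funs omega A) \<and> x = Pdef A R s}"
proof -
  have eq: "elts x = {a \<in> elts A. upd s zero a \<in> elts R} \<longleftrightarrow> x = Pdef A R s" if "s \<in> elts (funs omega A)" for x R s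
  proof -
    have "fun_on s omega" using that unfolding funs_iff by blast
    then have "{a \<in> elts A. upd s zero a \<in> elts R} = elts (Pdef A R s)"
      by (simp add: elts_Pdef upd_eq)
    then show ?thesis by simp
  qed
  have "{x. \<exists>R s. definable_relation A R \<and> s \<in> elts (funs omega A) \<and> elts x = {a \<in> elts A. upd s zero a \<in> elts R}} =
      {x. \<exists>R s. definable_relation A R \<and> s \<in> elts (funs omega A) \<and> x = Pdef A R s}"
    using eq by blast
  moreover have "elts (setof {x. \<exists>R s. definable_relation A R \<and> s \<in> elts (funs omega A) \<and> x = Pdef A R s}) =
      {x. \<exists>R s. definable_relation A R \<and> s \<in> elts (funs omega A) \<and> x = Pdef A R s}"
  proof (rule elts_setof_sub[where a = "powerset A"])
    show "dfn (\<lambda>z. \<exists>R s. definable_relation A R \<and> s \<in> elts (funs omega A) \<and> z 0 = Pdef A R s)" by (intro dfi)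
  qed (auto simp: elts_Pdef)
  ultimately show ?thesis unfolding Def_def by simp
qed

text \<open>Digit 0 of \<open>c\<close> names the connective and digits 1 and 2 name variables. The
  last clause takes every remaining value of digit 0, so that each real codes an operation.\<close>

definition rop :: "'a \<Rightarrow> 'a \<Rightarrow> 'a \<Rightarrow> 'a \<Rightarrow> 'a" where
  "rop A c R S =
    (if ap c zero = zero then rmem A (ap c (suc zero)) (ap c (suc (suc zero)))
     else if ap c zero = suc zero then req A (ap c (suc zero)) (ap c (suc (suc zero)))
     else if ap c zero = suc (suc zero) then rneg A R
     else if ap c zero = suc (suc (suc zero)) then rcap R S
     else rex A (ap c (suc zero)) R)"

lemma dft_rop [dfi]: "dft t \<Longrightarrow> dft u \<Longrightarrow> dft v \<Longrightarrow> dft (\<lambda>s. rop A (t s) (u s) (v s))"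
  by (rule dft_comp3[of "rop A"]) (simp_all only: rop_def, intro dfi)

lemma rop_subset: "elts R \<subseteq> elts (funs omega A) \<Longrightarrow> elts (rop A c R S) \<subseteq> elts (funs omega A)"
  unfolding rop_def by (auto simp: elts_rmem elts_req elts_rneg elts_rcap elts_rex)

text \<open>
  Formulas are coded by reals: \<open>fstr z\<close> holds the outermost connective and \<open>sndr z\<close> the codes of
  its two arguments. The evaluation of codes is the least set closed under this clause, which is
  a function because the clause can be inverted.
\<close>
lemma definable_Rsmall: "\<exists>D. Rsmall D \<and> (\<forall>R. definable_relation A R \<longrightarrow> R \<in> elts D)"
proof -
  define U where "U = powerset (funs omega A)"
  define base where "base z \<longleftrightarrow> ap (fstr z) zero = zero \<or> ap (fstr z) zero = suc zero" for z
  define ev where "ev W z R \<longleftrightarrow> z \<in> elts reals \<and>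
    (base z \<and> R = rop A (fstr z) zero zero \<or>
     (\<exists>R1 R2. opair (fstr (sndr z)) R1 \<in> elts W \<and> opair (sndr (sndr z)) R2 \<in> elts W \<and> R = rop A (fstr z) R1 R2))"
    for W z R
  have dbase: "dft t \<Longrightarrow> dfn (\<lambda>s. base (t s))" for t
    by (rule dfn_comp1[of base]) (simp_all only: base_def, intro dfi)
  have dev: "dft t \<Longrightarrow> dft u \<Longrightarrow> dft v \<Longrightarrow> dfn (\<lambda>s. ev (t s) (u s) (v s))" for t u v
    by (rule dfn_comp3[of ev]) (simp_all only: ev_def, intro dfi dbase)
  define cl where "cl W \<longleftrightarrow> (\<forall>z R. ev W z R \<longrightarrow> opair z R \<in> elts W)" for W
  have dcl: "dft t \<Longrightarrow> dfn (\<lambda>s. cl (t s))" for t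
    by (rule dfn_comp1[of cl]) (simp_all only: cl_def, intro dfi dev)
  have rop_base: "rop A (fstr z) R S = rop A (fstr z) R' S'" if "base z" for z R S R' S'
    using that unfolding base_def rop_def by auto
  have ev_U: "R \<in> elts U" if "ev W z R" "elts W \<subseteq> elts (prod reals U)" for W z R
  proof -
    have "R1 \<in> elts U" if "opair x R1 \<in> elts W" for x R1
      using that \<open>elts W \<subseteq> _\<close> by (meson opair_in_prod subsetD)
    then have sub: "elts R1 \<subseteq> elts (funs omega A)" if "opair x R1 \<in> elts W" for x R1
      using that unfolding U_def by simp
    from that(1) obtain R1 R2 where "R = rop A (fstr z) R1 R2" "elts R1 \<subseteq> elts (funs omega A)"
      unfolding ev_def
    proof (elim conjE disjE exE)
      assume "\<And>R1 R2. R = rop A (fstr z) R1 R2 \<Longrightarrow> elts R1 \<subseteq> elts (funs omega A) \<Longrightarrow> thesis"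
        "R = rop A (fstr z) zero zero"
      then show thesis by simp
    next
      fix R1 R2
      assume "\<And>R1 R2. R = rop A (fstr z) R1 R2 \<Longrightarrow> elts R1 \<subseteq> elts (funs omega A) \<Longrightarrow> thesis"
        "opair (fstr (sndr z)) R1 \<in> elts W" "R = rop A (fstr z) R1 R2"
      with sub show thesis by blast
    qed
    then show ?thesis unfolding U_def using rop_subset by simp
  qed
  \<comment> \<open>The least closed relation between codes and values, as an intersection within
    the set \<open>prod reals U\<close>.\<close>
  define V where "V = sep (prod reals U) (\<lambda>p. \<forall>W. cl W \<longrightarrow> p \<in> elts W)"
  have V: "elts V = {p \<in> elts (prod reals U). \<forall>W. cl W \<longrightarrow> p \<in> elts W}"
    unfolding V_def by (rule elts_sep) (intro dfi dcl)
  have V_sub: "elts V \<subseteq> elts (prod reals U)" unfolding V by blast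
  have ev_mono: "ev W z R" if "ev W' z R" "elts W' \<subseteq> elts W" for W W' z R
    using that unfolding ev_def by blast
  have "cl V"
    unfolding cl_def
  proof (intro allI impI)
    fix z R assume e: "ev V z R"
    have "opair z R \<in> elts W" if "cl W" for W
    proof -
      have "elts V \<subseteq> elts W" using that unfolding V by blast
      with ev_mono[OF e this] that show ?thesis unfolding cl_def by blast
    qed
    moreover have "z \<in> elts reals" using e unfolding ev_def by blast
    ultimately show "opair z R \<in> elts V" using ev_U[OF e V_sub] unfolding V by simp
  qed
  have least: "elts V \<subseteq> elts W" if "cl W" for W
    using that unfolding V by blast
  \<comment> \<open>Inversion: the pairs of \<open>V\<close> that are justified by the clause
    already form a closed set, so leastness gives all of \<open>V\<close>.\<close>
  have inv: "ev V z R" if zR: "opair z R \<in> elts V" for z R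
  proof -
    define W where "W = sep V (\<lambda>p. ev V (fst' p) (snd' p))"
    have W: "elts W = {p \<in> elts V. ev V (fst' p) (snd' p)}"
      unfolding W_def by (rule elts_sep) (intro dfi dev)
    have "cl W"
      unfolding cl_def
    proof (intro allI impI)
      fix z R assume "ev W z R"
      then have "ev V z R" by (rule ev_mono) (auto simp: W)
      with \<open>cl V\<close> show "opair z R \<in> elts W" unfolding W cl_def by simp
    qed
    from least[OF this] zR have "opair z R \<in> elts W" by blast
    then show ?thesis unfolding W by simp
  qed
  \<comment> \<open>Again by leastness: the pairs of \<open>V\<close> whose code has no second value
    in \<open>V\<close> form a closed set.\<close>
  have single: "R = R'" if zR: "opair z R \<in> elts V" "opair z R' \<in> elts V" for z R R'
  proof -
    define W where "W = sep V (\<lambda>p. \<forall>R'. opair (fst' p) R' \<in> elts V \<longrightarrow> R' = snd' p)"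
    have W: "elts W = {p \<in> elts V. \<forall>R'. opair (fst' p) R' \<in> elts V \<longrightarrow> R' = snd' p}"
      unfolding W_def by (rule elts_sep) (intro dfi)
    have WD: "R' = R" if "opair z R \<in> elts W" "opair z R' \<in> elts V" for z R R'
      using that unfolding W by simp
    have "cl W"
      unfolding cl_def
    proof (intro allI impI)
      fix z R assume e: "ev W z R"
      then have "ev V z R" by (rule ev_mono) (auto simp: W)
      then have zV: "opair z R \<in> elts V" using \<open>cl V\<close> unfolding cl_def by blast
      have uniq: "R' = R" if "opair z R' \<in> elts V" for R'
      proof (cases "base z")
        case True
        from inv[OF that] e rop_base[OF True] show ?thesis unfolding ev_def by metis
      next
        case False
        from e False obtain R1 R2 where 1: "opair (fstr (sndr z)) R1 \<in> elts W"
          "opair (sndr (sndr z)) R2 \<in> elts W" "R = rop A (fstr z) R1 R2" unfolding ev_def by blast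
        from inv[OF that] False obtain R1' R2' where 2: "opair (fstr (sndr z)) R1' \<in> elts V"
          "opair (sndr (sndr z)) R2' \<in> elts V" "R' = rop A (fstr z) R1' R2'" unfolding ev_def by blast
        from WD[OF 1(1) 2(1)] WD[OF 1(2) 2(2)] 1(3) 2(3) show ?thesis by simp
      qed
      show "opair z R \<in> elts W"
        unfolding W mem_Collect_eq fst'_opair snd'_opair using zV uniq by (intro conjI allI impI)
    qed
    from least[OF this] zR WD show ?thesis by blast
  qed
  define D where "D = sep U (\<lambda>R. \<exists>z. opair z R \<in> elts V)"
  have D: "elts D = {R. \<exists>z. opair z R \<in> elts V}"
  proof -
    have "dfn (\<lambda>s. \<exists>z. opair z (s 0) \<in> elts V)" by (intro dfi)
    from elts_sep[OF this, of U] V_sub show ?thesis unfolding D_def by (auto dest: subsetD)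
  qed
  have "Rsmall D"
  proof (rule RsmallI[where F = "\<lambda>z. iota (\<lambda>R. opair z R \<in> elts V)"])
    show "dft (\<lambda>s. iota (\<lambda>R. opair (s 0) R \<in> elts V))" by (intro dfi)
    fix R assume "R \<in> elts D"
    then obtain z where z: "opair z R \<in> elts V" unfolding D by blast
    have "iota (\<lambda>R. opair z R \<in> elts V) = R"
    proof (rule iota_eq)
      show "opair z R \<in> elts V" by (rule z)
      show "R' = R" if "opair z R' \<in> elts V" for R' using that z by (rule single)
    qed
    moreover have "z \<in> elts reals" using z V_sub by (auto dest: subsetD)
    ultimately show "\<exists>z\<in>elts reals. R = iota (\<lambda>R. opair z R \<in> elts V)" by blast
  qed
  moreover have "definability_closed A D"
  proof -
    define c where "c t i k = lam omega (\<lambda>n. if n = zero then t else if n = suc zero then i else k)" for t i k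
    have c: "c t i k \<in> elts reals" "ap (c t i k) zero = t" "ap (c t i k) (suc zero) = i"
      "ap (c t i k) (suc (suc zero)) = k"
      if "t \<in> elts omega" "i \<in> elts omega" "k \<in> elts omega" for t i k
    proof -
      have d: "dft (\<lambda>s. if s 0 = zero then t else if s 0 = suc zero then i else k)" by (intro dfi)
      show "c t i k \<in> elts reals" unfolding c_def by (rule lam_reals[OF d]) (simp add: that)
      show "ap (c t i k) zero = t" "ap (c t i k) (suc zero) = i" "ap (c t i k) (suc (suc zero)) = k"
        unfolding c_def by (simp_all add: ap_lam[OF d])
    qed
    have in_D: "R \<in> elts D" if "ev V z R" for z R
      using that \<open>cl V\<close> unfolding D cl_def by blast
    have step: "rop A (c t i k) R1 R2 \<in> elts D" if "t \<in> elts omega" "i \<in> elts omega" "k \<in> elts omega"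
      "R1 \<in> elts D" "R2 \<in> elts D" for t i k R1 R2
    proof -
      from that obtain x y where xy: "opair x R1 \<in> elts V" "opair y R2 \<in> elts V" unfolding D by blast
      then have "x \<in> elts reals" "y \<in> elts reals" using V_sub by (meson opair_in_prod subsetD)+
      then have "ev V (pairr (c t i k) (pairr x y)) (rop A (c t i k) R1 R2)"
        unfolding ev_def using xy c(1)[OF that(1-3)] by auto
      then show ?thesis by (rule in_D)
    qed
    have start: "rop A (c t i k) zero zero \<in> elts D" if "t = zero \<or> t = suc zero" "i \<in> elts omega" "k \<in> elts omega" for t i k
    proof -
      have t: "t \<in> elts omega" using that by auto
      have "ev V (pairr (c t i k) (constr zero)) (rop A (c t i k) zero zero)"
        unfolding ev_def base_def using that c(1,2)[OF t that(2,3)] by (simp del: ap_fstr)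
      then show ?thesis by (rule in_D)
    qed
    show ?thesis
      unfolding definability_closed_iff
    proof (intro conjI ballI)
      fix i k assume ik: "i \<in> elts omega" "k \<in> elts omega"
      show "rmem A i k \<in> elts D" using start[of zero i k] ik by (simp add: rop_def c)
      show "req A i k \<in> elts D" using start[of "suc zero" i k] ik by (simp add: rop_def c)
    next
      \<comment> \<open>A compound code always carries two arguments, so for negation, and likewise
        for the quantifier, \<open>R\<close> is supplied twice.\<close>
      fix R assume "R \<in> elts D"
      then show "rneg A R \<in> elts D"
        using step[of "suc (suc zero)" zero zero R R] by (simp add: rop_def c)
    next
      fix R S assume "R \<in> elts D" "S \<in> elts D"
      then show "rcap R S \<in> elts D"
        using step[of "suc (suc (suc zero))" zero zero R S] by (simp add: rop_def c)
    next
      fix R i assume "R \<in> elts D" "i \<in> elts omega"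
      then show "rex A i R \<in> elts D"
        using step[of "suc (suc (suc (suc zero)))" i zero R R] by (simp add: rop_def c)
    qed
  qed
  ultimately show ?thesis unfolding definable_relation_def by blast
qed

lemma omega_common_bound: "i \<in> elts omega \<Longrightarrow> k \<in> elts omega \<Longrightarrow> \<exists>m\<in>elts omega. elts (suc i) \<subseteq> elts m \<and> elts (suc k) \<subseteq> elts m"
proof -
  assume i: "i \<in> elts omega" and k: "k \<in> elts omega"
  from ord_linear[OF omega_ord[OF i] omega_ord[OF k]] show ?thesis
  proof (elim disjE)
    assume "i \<in> elts k"
    with k ord_trans[OF omega_ord[OF k]] show ?thesis by (intro bexI[of _ "suc k"]) auto
  next
    assume "k \<in> elts i"
    with i ord_trans[OF omega_ord[OF i]] show ?thesis by (intro bexI[of _ "suc i"]) auto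
  next
    assume "i = k"
    with k show ?thesis by (intro bexI[of _ "suc k"]) auto
  qed
qed

definition support :: "'a \<Rightarrow> 'a \<Rightarrow> 'a \<Rightarrow> bool" where
  "support A R m \<longleftrightarrow> (\<forall>s\<in>elts (funs omega A). \<forall>t\<in>elts (funs omega A).
     (\<forall>k\<in>elts m. ap s k = ap t k) \<longrightarrow> (s \<in> elts R \<longleftrightarrow> t \<in> elts R))"

lemma dfn_support [dfi]: "dft t \<Longrightarrow> dft u \<Longrightarrow> dft v \<Longrightarrow> dfn (\<lambda>s. support (t s) (u s) (v s))"
  by (rule dfn_comp3[of support]) (simp_all only: support_def, intro dfi)

lemma support_mono: "support A R m \<Longrightarrow> elts m \<subseteq> elts n \<Longrightarrow> support A R n"
  unfolding support_def by blast

text \<open>The relations with a finite support contain the atomic ones and are closed under all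
  clauses. A quantifier keeps the support, because assignments that agree on \<open>m\<close> still
  agree there after the same update.\<close>

lemma definable_support:
  assumes "definable_relation A R"
  shows "\<exists>m\<in>elts omega. support A R m"
proof -
  define D where "D = sep (powerset (funs omega A)) (\<lambda>R. \<exists>m\<in>elts omega. support A R m)"
  have D: "elts D = {R. elts R \<subseteq> elts (funs omega A) \<and> (\<exists>m\<in>elts omega. support A R m)}"
  proof -
    have "dfn (\<lambda>s. \<exists>m\<in>elts omega. support A (s 0) m)" by (intro dfi)
    from elts_sep[OF this] show ?thesis unfolding D_def by simp
  qed
  have in_D: "R \<in> elts D" if "elts R \<subseteq> elts (funs omega A)" "m \<in> elts omega" "support A R m" for R m
    using that unfolding D by blast
  have "definability_closed A D"
    unfolding definability_closed_iff
  proof (intro conjI ballI)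
    fix i k assume "i \<in> elts omega" "k \<in> elts omega"
    from omega_common_bound[OF this] obtain m where m: "m \<in> elts omega" "i \<in> elts m" "k \<in> elts m" by auto
    have "support A (rmem A i k) m" "support A (req A i k) m"
      unfolding support_def elts_rmem elts_req using m by auto
    then show "rmem A i k \<in> elts D" "req A i k \<in> elts D"
      using m(1) by (auto simp: elts_rmem elts_req intro!: in_D)
  next
    fix R assume "R \<in> elts D"
    then obtain m where m: "m \<in> elts omega" "support A R m" unfolding D by blast
    then have "support A (rneg A R) m" unfolding support_def elts_rneg by blast
    with m(1) show "rneg A R \<in> elts D" by (intro in_D) (auto simp: elts_rneg)
  next
    fix R S assume "R \<in> elts D" "S \<in> elts D"
    then obtain m n where m: "m \<in> elts omega" "support A R m" and n: "n \<in> elts omega" "support A S n"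
      and R: "elts R \<subseteq> elts (funs omega A)" unfolding D by blast
    obtain l where l: "l \<in> elts omega" "elts (suc m) \<subseteq> elts l" "elts (suc n) \<subseteq> elts l"
      using omega_common_bound[OF m(1) n(1)] by blast
    have "support A R l" "support A S l" using support_mono m(2) n(2) l(2,3) by auto
    then have "support A (rcap R S) l" unfolding support_def elts_rcap by blast
    with l(1) R show "rcap R S \<in> elts D" by (intro in_D) (auto simp: elts_rcap)
  next
    fix R i assume "R \<in> elts D" "i \<in> elts omega"
    then obtain m where m: "m \<in> elts omega" "support A R m" unfolding D by blast
    have "support A (rex A i R) m"
      unfolding support_def elts_rex
    proof (intro ballI impI)
      fix s t assume s: "s \<in> elts (funs omega A)" and t: "t \<in> elts (funs omega A)" and "\<forall>k\<in>elts m. ap s k = ap t k"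
      then have "\<forall>k\<in>elts m. ap (updf s i a) k = ap (updf t i a) k" for a
        using omega_trans[OF m(1)] by (simp add: ap_updf)
      then have "updf s i a \<in> elts R \<longleftrightarrow> updf t i a \<in> elts R" if "a \<in> elts A" for a
        using m(2) updf_funs[OF s that] updf_funs[OF t that] unfolding support_def by blast
      with s t show "s \<in> {s \<in> elts (funs omega A). \<exists>a\<in>elts A. updf s i a \<in> elts R} \<longleftrightarrow>
        t \<in> {s \<in> elts (funs omega A). \<exists>a\<in>elts A. updf s i a \<in> elts R}" by blast
    qed
    with m(1) show "rex A i R \<in> elts D" by (intro in_D) (auto simp: elts_rex)
  qed
  with assms have "R \<in> elts D" unfolding definable_relation_def by blast
  then show ?thesis unfolding D by blast
qed

text \<open>A definition sees finitely many parameters; the others may be replaced by arbitrary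
  members of \<open>A\<close>. \<open>Rsmall_cover\<close> uses this to trade the given parameters
  for entries of a list.\<close>

lemma Pdef_support:
  assumes "support A R m" "m \<in> elts omega" "s \<in> elts (funs omega A)" "t \<in> elts (funs omega A)"
    "\<And>k. k \<in> elts m \<Longrightarrow> ap s k = ap t k"
  shows "Pdef A R s = Pdef A R t"
proof -
  have "\<forall>k\<in>elts m. ap (updf s zero a) k = ap (updf t zero a) k" for a
    using assms(5) omega_trans[OF assms(2)] by (simp add: ap_updf)
  then have "updf s zero a \<in> elts R \<longleftrightarrow> updf t zero a \<in> elts R" if "a \<in> elts A" for a
    using assms(1) updf_funs[OF assms(3) that] updf_funs[OF assms(4) that] unfolding support_def by blast
  then show ?thesis by (intro elts_eqI) (auto simp: elts_Pdef)
qed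


section \<open>Covering sets by few surjective images of the reals\<close>

definition cons :: "'a \<Rightarrow> 'a \<Rightarrow> 'a" where
  "cons x \<sigma> = lam omega (\<lambda>n. if n = zero then x else ap \<sigma> (bigU n))"

text \<open>Composition with a real: \<open>y\<close> selects which entries of the list
  \<open>\<sigma>\<close> act as parameters and in which order. Hence the choice of parameters from
  a given list ranges over the reals.\<close>

definition reindex :: "'a \<Rightarrow> 'a \<Rightarrow> 'a" where
  "reindex \<sigma> y = lam omega (\<lambda>n. ap \<sigma> (ap y n))"

lemma dft_cons [dfi]: "dft t \<Longrightarrow> dft u \<Longrightarrow> dft (\<lambda>s. cons (t s) (u s))"
  by (rule dft_comp2[of cons]) (simp_all only: cons_def, intro dfi)

lemma dft_reindex [dfi]: "dft t \<Longrightarrow> dft u \<Longrightarrow> dft (\<lambda>s. reindex (t s) (u s))"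
  by (rule dft_comp2[of reindex]) (simp_all only: reindex_def, intro dfi)

lemma ap_cons: "ap (cons x \<sigma>) zero = x" "n \<in> elts omega \<Longrightarrow> ap (cons x \<sigma>) (suc n) = ap \<sigma> n"
proof -
  have d: "dft (\<lambda>s. if s 0 = zero then x else ap \<sigma> (bigU (s 0)))" by (intro dfi)
  show "ap (cons x \<sigma>) zero = x" unfolding cons_def by (simp add: ap_lam[OF d])
  show "n \<in> elts omega \<Longrightarrow> ap (cons x \<sigma>) (suc n) = ap \<sigma> n"
    unfolding cons_def by (simp add: ap_lam[OF d] bigU_suc omega_ord)
qed

lemma fun_on_cons: "fun_on (cons x \<sigma>) omega"
  unfolding cons_def by (rule fun_on_lam) (intro dfi)

lemma cons_funs: "\<sigma> \<in> elts (funs omega A) \<Longrightarrow> x \<in> elts A \<Longrightarrow> cons x \<sigma> \<in> elts (funs omega A)"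
  unfolding funs_iff using fun_on_cons omega_cases ap_cons by metis

lemma ap_reindex: "n \<in> elts omega \<Longrightarrow> ap (reindex \<sigma> y) n = ap \<sigma> (ap y n)"
  unfolding reindex_def by (rule ap_lam) (intro dfi)

lemma fun_on_reindex: "fun_on (reindex \<sigma> y) omega"
  unfolding reindex_def by (rule fun_on_lam) (intro dfi)

lemma ord_cases: "ordinal b \<Longrightarrow> b = zero \<or> (\<exists>c. b = suc c) \<or> limit_ordinal b"
proof (rule ccontr)
  assume b: "ordinal b" and n: "\<not> (b = zero \<or> (\<exists>c. b = suc c) \<or> limit_ordinal b)"
  then obtain y where y: "y \<in> elts b" "suc y \<notin> elts b"
    unfolding limit_ordinal_def eq_zero_iff by blast
  have "ordinal y" using b y(1) by (rule ord_elem)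
  with ord_linear[of "suc y" b] b y n have "b \<in> elts (suc y)" by auto
  with y(1) show False using mem_asym by auto
qed

lemma zero_in_suc: "ordinal a \<Longrightarrow> zero \<in> elts (suc a)"
  using ord_linear[of zero "suc a"] by auto

text \<open>Together with the sets of reals this exhausts the transitive closure of
  \<open>{P(R)}\<close>. Reals are sets of pairs from \<open>omega\<close>; the Kuratowski pairs
  consist of subsets of \<open>omega\<close>, which accounts for the power set.\<close>

definition below_sets :: 'a where
  "below_sets = Un2 (sing (powerset reals))
     (Un2 reals (Un2 (prod omega omega) (Un2 (powerset omega) omega)))"

lemma Rsmall_below_sets: "Rsmall below_sets"
  unfolding below_sets_def
  by (intro Rsmall_Un2 Rsmall_sing Rsmall_reals Rsmall_prod Rsmall_omega Rsmall_powerset_omega)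

lemma trcl_powerset_reals: "elts (trcl (sing (powerset reals))) \<subseteq> elts (Un2 (powerset reals) below_sets)"
proof (rule trcl_least)
  show "elts (sing (powerset reals)) \<subseteq> elts (Un2 (powerset reals) below_sets)"
    unfolding below_sets_def by simp
  show "transitive (Un2 (powerset reals) below_sets)"
    unfolding transitive_def
  proof (intro ballI subsetI)
    fix y z assume y: "y \<in> elts (Un2 (powerset reals) below_sets)" and z: "z \<in> elts y"
    from y consider "y = powerset reals" | "elts y \<subseteq> elts reals" | "y \<in> elts reals"
      | "y \<in> elts (prod omega omega)" | "elts y \<subseteq> elts omega" | "y \<in> elts omega"
      unfolding below_sets_def by auto
    then show "z \<in> elts (Un2 (powerset reals) below_sets)"
    proof cases
      case 3
      then have "elts y \<subseteq> elts (prod omega omega)" unfolding reals_iff by (rule maps_prod)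
      with z show ?thesis unfolding below_sets_def by auto
    next
      case 4
      then obtain n m where nm: "n \<in> elts omega" "m \<in> elts omega" "y = opair n m" unfolding elts_prod by blast
      then have "elts z \<subseteq> elts omega" using z unfolding opair_upair by auto
      then show ?thesis unfolding below_sets_def by simp
    next
      case 6
      with z omega_trans show ?thesis unfolding below_sets_def by auto
    qed (use z in \<open>auto simp: below_sets_def\<close>)
  qed
qed

text \<open>
  Members of the hierarchy are collected in lists of parameters (the sequences \<open>\<sigma>\<close>). Extending
  every list of an \<open>Rsmall\<close> family by everything definable over a fixed level from the list yields
  an \<open>Rsmall\<close> family again, and finitely many such steps reach any given set. The families so
  obtained are enumerated by ordinals.
\<close>
lemma Rsmall_cover:
  assumes VL: "V_eq_L_over (powerset reals)" and AD and reg: "regular Theta"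
  shows "\<exists>d p. ordinal d \<and> (\<forall>g\<in>elts d. Rsmall (ap p g)) \<and> (\<forall>y\<in>elts Y. \<exists>g\<in>elts d. y \<in> elts (ap p g))"
proof -
  obtain a f where L: "L_hierarchy (powerset reals) a f" and Ya: "Y \<in> elts (app f a)"
    using VL unfolding V_eq_L_over_def by blast
  have oa: "ordinal a" and fo: "fun_on f (suc a)" using L unfolding L_hierarchy_def by blast+
  have osa: "ordinal (suc a)" using oa by simp
  have app_f: "app f b = ap f b" if "b \<in> elts (suc a)" for b using app_eq_ap[OF fo that] .
  have f0: "ap f zero = trcl (sing (powerset reals))"
  proof -
    have "app f zero = trcl (setof {powerset reals})" using L unfolding L_hierarchy_def by blast
    moreover have "setof {powerset reals} = sing (powerset reals)" by (rule setof_eqI) simp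
    ultimately show ?thesis using app_f[OF zero_in_suc[OF oa]] by simp
  qed
  have fs: "ap f (suc c) = Def (ap f c)" if "suc c \<in> elts (suc a)" for c
  proof -
    have "c \<in> elts (suc a)" by (rule ord_trans[OF osa _ that]) simp
    moreover have "app f (suc c) = Def (app f c)" using L that unfolding L_hierarchy_def by blast
    ultimately show ?thesis using app_f that by simp
  qed
  have fl: "elts (ap f b) = (\<Union>c\<in>elts b. elts (ap f c))" if b: "b \<in> elts (suc a)" "limit_ordinal b" for b
  proof -
    have "app f b = setof (\<Union>c\<in>elts b. elts (app f c))" using L b unfolding L_hierarchy_def by blast
    moreover have "app f c = ap f c" if "c \<in> elts b" for c
      using app_f ord_trans[OF osa that b(1)] by blast
    ultimately have "ap f b = setof (\<Union>c\<in>elts b. elts (ap f c))" using app_f[OF b(1)] by simp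
    moreover have "elts (bigU (img b (ap f))) = (\<Union>c\<in>elts b. elts (ap f c))"
    proof -
      have "elts (img b (ap f)) = ap f ` elts b" by (rule elts_img) (intro dfi)
      then show ?thesis by simp
    qed
    ultimately show ?thesis using setof_eqI by metis
  qed
  \<comment> \<open>A member of some level is included in a level: at a successor stage it was
    defined as a subset of the preceding one.\<close>
  have Y_sub: "\<exists>c\<in>elts (suc a). elts Y \<subseteq> elts (ap f c)"
  proof -
    let ?P = "\<lambda>b. b \<in> elts (suc a) \<longrightarrow> (\<forall>y\<in>elts (ap f b). \<exists>c\<in>elts (suc a). elts y \<subseteq> elts (ap f c))"
    have "?P a"
    proof (rule ord_induct[where P = ?P])
      show "dfn (\<lambda>s. ?P (s 0))" by (intro dfi)
      show "ordinal a" by fact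
      fix b assume ob: "ordinal b" and IH: "\<And>c. c \<in> elts b \<Longrightarrow> ?P c"
      show "?P b"
      proof (intro impI ballI)
        fix y assume b: "b \<in> elts (suc a)" and y: "y \<in> elts (ap f b)"
        from ord_cases[OF ob] show "\<exists>c\<in>elts (suc a). elts y \<subseteq> elts (ap f c)"
        proof (elim disjE exE)
          assume "b = zero"
          with y f0 have "y \<in> elts (trcl (sing (powerset reals)))" by simp
          then have "elts y \<subseteq> elts (ap f zero)"
            using transitive_trcl[of "sing (powerset reals)"] unfolding f0 transitive_def by blast
          with zero_in_suc[OF oa] show ?thesis by blast
        next
          fix c assume c: "b = suc c"
          with b y have "y \<in> elts (Def (ap f c))" using fs by simp
          then have "elts y \<subseteq> elts (ap f c)" unfolding elts_Def using elts_Pdef by auto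
          moreover have "c \<in> elts (suc a)" by (rule ord_trans[OF osa _ b]) (simp add: c)
          ultimately show ?thesis by blast
        next
          assume "limit_ordinal b"
          with fl[OF b] y obtain c where c: "c \<in> elts b" "y \<in> elts (ap f c)" by blast
          moreover have "c \<in> elts (suc a)" using ord_trans[OF osa c(1) b] .
          ultimately show ?thesis using IH by blast
        qed
      qed
    qed
    with Ya app_f[of a] show ?thesis by simp
  qed
  \<comment> \<open>One set that bounds all entries of lists, so that the families of lists are
    members of the set \<open>T\<close>.\<close>
  define \<Lambda> where "\<Lambda> = Un2 (Un2 (powerset reals) below_sets) (bigU (rn f))"
  have f_\<Lambda>: "elts (ap f b) \<subseteq> elts \<Lambda>" if "b \<in> elts (suc a)" for b
    unfolding \<Lambda>_def using that dm_fun_on[OF fo] by (auto simp: elts_rn)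
  \<comment> \<open>The bottom level of the hierarchy, cut into \<open>Rsmall\<close> pieces with
    index below Theta; \<open>Zs\<close> does this for the sets of reals.\<close>
  define D0 where "D0 b = Un2 (Zs b) below_sets" for b
  have dD0: "dft t \<Longrightarrow> dft (\<lambda>s. D0 (t s))" for t
    by (rule dft_comp1[of D0]) (simp_all only: D0_def, intro dfi)
  have D0_\<Lambda>: "elts (D0 b) \<subseteq> elts \<Lambda>" for b
    unfolding D0_def \<Lambda>_def by (auto simp: elts_Zs)
  have D0_Rsmall: "Rsmall (D0 b)" if "b \<in> elts Theta" for b
    unfolding D0_def by (intro Rsmall_Un2 Zs_Rsmall \<open>AD\<close> that Rsmall_below_sets)
  have D0_cover: "\<exists>b\<in>elts Theta. x \<in> elts (D0 b)" if "x \<in> elts (ap f zero)" for x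
  proof -
    from that trcl_powerset_reals have "x \<in> elts (Un2 (powerset reals) below_sets)" unfolding f0 by blast
    then consider "elts x \<subseteq> elts reals" | "x \<in> elts below_sets" by auto
    then show ?thesis
    proof cases
      case 1
      with Zs_cover[OF reg this] show ?thesis unfolding D0_def by auto
    next
      case 2
      with zero_in_Theta show ?thesis unfolding D0_def by auto
    qed
  qed
  define Ext0 where "Ext0 S b = sep (funs omega \<Lambda>) (\<lambda>\<tau>. \<exists>\<sigma>\<in>elts S. \<exists>x\<in>elts (D0 b). \<tau> = cons x \<sigma>)" for S b
  have dExt0: "dft t \<Longrightarrow> dft u \<Longrightarrow> dft (\<lambda>s. Ext0 (t s) (u s))" for t u
    by (rule dft_comp2[of Ext0]) (simp_all only: Ext0_def, intro dfi dD0)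
  have elts_Ext0: "elts (Ext0 S b) = {\<tau> \<in> elts (funs omega \<Lambda>). \<exists>\<sigma>\<in>elts S. \<exists>x\<in>elts (D0 b). \<tau> = cons x \<sigma>}" for S b
    unfolding Ext0_def by (rule elts_sep) (intro dfi)
  have Ext0_Rsmall: "Rsmall (Ext0 S b)" if "Rsmall S" "b \<in> elts Theta" for S b
  proof (rule Rsmall_image2[OF that(1) D0_Rsmall[OF that(2)], where F = "\<lambda>\<sigma> x. cons x \<sigma>"])
    show "dft (\<lambda>s. cons (s (Suc 0)) (s 0))" by (intro dfi)
  qed (auto simp: elts_Ext0)
  define Ext1 where "Ext1 S b = sep (funs omega \<Lambda>) (\<lambda>\<tau>. \<exists>\<sigma>\<in>elts S. \<exists>R. \<exists>y\<in>elts reals.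
    definable_relation (ap f b) R \<and> reindex \<sigma> y \<in> elts (funs omega (ap f b)) \<and>
    \<tau> = cons (Pdef (ap f b) R (reindex \<sigma> y)) \<sigma>)" for S b
  have dExt1: "dft t \<Longrightarrow> dft u \<Longrightarrow> dft (\<lambda>s. Ext1 (t s) (u s))" for t u
    by (rule dft_comp2[of Ext1]) (simp_all only: Ext1_def, intro dfi)
  have elts_Ext1: "elts (Ext1 S b) = {\<tau> \<in> elts (funs omega \<Lambda>). \<exists>\<sigma>\<in>elts S. \<exists>R. \<exists>y\<in>elts reals.
    definable_relation (ap f b) R \<and> reindex \<sigma> y \<in> elts (funs omega (ap f b)) \<and>
    \<tau> = cons (Pdef (ap f b) R (reindex \<sigma> y)) \<sigma>}" for S b
    unfolding Ext1_def by (rule elts_sep) (intro dfi)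
  have Ext1_Rsmall: "Rsmall (Ext1 S b)" if "Rsmall S" for S b
  proof -
    obtain D where D: "Rsmall D" "\<And>R. definable_relation (ap f b) R \<Longrightarrow> R \<in> elts D"
      using definable_Rsmall by blast
    show ?thesis
    proof (rule Rsmall_image2[OF that Rsmall_prod[OF D(1) Rsmall_reals],
          where F = "\<lambda>\<sigma> p. cons (Pdef (ap f b) (fst' p) (reindex \<sigma> (snd' p))) \<sigma>"])
      show "dft (\<lambda>s. cons (Pdef (ap f b) (fst' (s (Suc 0))) (reindex (s 0) (snd' (s (Suc 0))))) (s 0))"
        by (intro dfi)
      fix \<tau> assume "\<tau> \<in> elts (Ext1 S b)"
      then obtain \<sigma> R y where "\<sigma> \<in> elts S" "y \<in> elts reals" "R \<in> elts D"
        "\<tau> = cons (Pdef (ap f b) R (reindex \<sigma> y)) \<sigma>" unfolding elts_Ext1 using D(2) by blast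
      then show "\<exists>\<sigma>\<in>elts S. \<exists>p\<in>elts (prod D reals). \<tau> = cons (Pdef (ap f b) (fst' p) (reindex \<sigma> (snd' p))) \<sigma>"
        by (intro bexI[of _ \<sigma>] bexI[of _ "opair R y"]) simp_all
    qed
  qed
  define S0 where "S0 = sing (lam omega (\<lambda>n. zero))"
  define T where "T = powerset (funs omega \<Lambda>)"
  \<comment> \<open>Codes start with 0 for the initial family, 1 for adding an element of the bottom
    level, and 2 for adding a definable subset of a level. The default \<open>T\<close> is not a
    member of \<open>T\<close> and is thus never listed.\<close>
  define F where "F n c =
    (if fst' c = zero then S0
     else if fst' c = suc zero \<and> fst' (snd' c) \<in> elts Theta \<and> snd' (snd' c) \<in> elts (dm n)
       then Ext0 (ap n (snd' (snd' c))) (fst' (snd' c))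
     else if fst' c = suc (suc zero) \<and> suc (fst' (snd' c)) \<in> elts (suc a) \<and> snd' (snd' c) \<in> elts (dm n)
       then Ext1 (ap n (snd' (snd' c))) (fst' (snd' c))
     else T)" for n c
  have F: "dft (\<lambda>s. F (s 0) (s (Suc 0)))" unfolding F_def by (intro dfi dExt0 dExt1)
  obtain d n where dn: "ordinal d" "fun_on n d" "\<And>g. g \<in> elts d \<Longrightarrow> ap n g \<in> elts T"
    and n_step: "\<And>g. g \<in> elts d \<Longrightarrow> \<exists>k i e. ap n g = F (restr n g) (opair k (opair i e))"
    and closed: "\<And>k i e. ordinal k \<Longrightarrow> ordinal i \<Longrightarrow> ordinal e \<Longrightarrow> F n (opair k (opair i e)) \<in> elts T \<Longrightarrow>
       \<exists>h\<in>elts d. ap n h = F n (opair k (opair i e))"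
  proof (rule greedy_enumeration[OF F, of T], goal_cases)
    case (1 d n)
    note * = 1
    show ?case
    proof (rule that[of d n])
      show "ordinal d" "fun_on n d" by (fact *)+
      show "ap n g \<in> elts T" if "g \<in> elts d" for g using that by (rule *(4))
      show "\<exists>k i e. ap n g = F (restr n g) (opair k (opair i e))" if "g \<in> elts d" for g
        using *(6)[OF that] by blast
      show "\<exists>h\<in>elts d. ap n h = F n (opair k (opair i e))"
        if "ordinal k" "ordinal i" "ordinal e" "F n (opair k (opair i e)) \<in> elts T" for k i e
        using that by (rule *(7))
    qed
  qed
  have dmn: "dm n = d" using dn(2) by (rule dm_fun_on)
  have S0_Rsmall: "Rsmall S0" unfolding S0_def by simp
  \<comment> \<open>Each listed family arises from an earlier one by \<open>Ext0\<close> or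
    \<open>Ext1\<close>, unless it is the initial one; induction on its index applies.\<close>
  have n_Rsmall: "Rsmall (ap n g)" if "g \<in> elts d" for g
  proof -
    have "g \<in> elts d \<longrightarrow> Rsmall (ap n g)"
    proof (rule ord_induct[where P = "\<lambda>g. g \<in> elts d \<longrightarrow> Rsmall (ap n g)"])
      show "dfn (\<lambda>s. s 0 \<in> elts d \<longrightarrow> Rsmall (ap n (s 0)))" by (intro dfi)
      show "ordinal g" using dn(1) that by (rule ord_elem)
      fix g assume IH: "\<And>h. h \<in> elts g \<Longrightarrow> h \<in> elts d \<longrightarrow> Rsmall (ap n h)"
      show "g \<in> elts d \<longrightarrow> Rsmall (ap n g)"
      proof
        assume g: "g \<in> elts d"
        then obtain k i e where eq: "ap n g = F (restr n g) (opair k (opair i e))" using n_step by blast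
        have sub: "elts g \<subseteq> elts d" using dn(1) g ord_trans by blast
        have dmg: "dm (restr n g) = g" using fun_on_restr[OF dn(2) sub] by (rule dm_fun_on)
        have "ap n g \<noteq> T" using dn(3)[OF g] by auto
        then consider "ap n g = S0" | "i \<in> elts Theta" "e \<in> elts g" "ap n g = Ext0 (ap (restr n g) e) i"
          | "e \<in> elts g" "ap n g = Ext1 (ap (restr n g) e) i"
          unfolding eq F_def fst'_opair snd'_opair dmg by (auto split: if_splits)
        then show "Rsmall (ap n g)"
        proof cases
          case 2
          then show ?thesis using IH sub ap_restr[OF dn(2) sub 2(2)] Ext0_Rsmall by auto
        next
          case 3
          then show ?thesis using IH sub ap_restr[OF dn(2) sub 3(1)] Ext1_Rsmall by auto
        qed (simp add: S0_Rsmall)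
      qed
    qed
    with that show ?thesis by blast
  qed
  have o0: "ordinal (suc zero)" "ordinal (suc (suc zero))" by simp_all
  have S0_in: "\<exists>h\<in>elts d. ap n h = S0"
  proof -
    have d0: "dft (\<lambda>s. zero)" by (intro dfi)
    have "zero \<in> elts \<Lambda>" unfolding \<Lambda>_def below_sets_def by simp
    then have "lam omega (\<lambda>n. zero) \<in> elts (funs omega \<Lambda>)"
      unfolding funs_iff using fun_on_lam[OF d0] ap_lam[OF d0] by simp
    then have "F n (opair zero (opair zero zero)) \<in> elts T"
      unfolding F_def S0_def T_def by simp
    from closed[OF _ _ _ this] show ?thesis unfolding F_def by simp
  qed
  have Ext0_in: "\<exists>h\<in>elts d. ap n h = Ext0 (ap n e) i" if "e \<in> elts d" "i \<in> elts Theta" for e i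
  proof -
    have eq: "F n (opair (suc zero) (opair i e)) = Ext0 (ap n e) i"
      unfolding F_def using that dmn by simp
    have "F n (opair (suc zero) (opair i e)) \<in> elts T"
      unfolding eq T_def by (auto simp: elts_Ext0)
    from closed[OF o0(1) Theta_ord[OF that(2)] ord_elem[OF dn(1) that(1)] this]
    show ?thesis unfolding eq .
  qed
  have Ext1_in: "\<exists>h\<in>elts d. ap n h = Ext1 (ap n e) i" if "e \<in> elts d" "suc i \<in> elts (suc a)" for e i
  proof -
    have eq: "F n (opair (suc (suc zero)) (opair i e)) = Ext1 (ap n e) i"
      unfolding F_def using that dmn by simp
    have "F n (opair (suc (suc zero)) (opair i e)) \<in> elts T"
      unfolding eq T_def by (auto simp: elts_Ext1)
    moreover have "ordinal i" using ord_elem[OF osa that(2)] by simp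
    ultimately show ?thesis using closed[OF o0(2) _ ord_elem[OF dn(1) that(1)], of i] unfolding eq by blast
  qed
  have n_funs: "\<sigma> \<in> elts (funs omega \<Lambda>)" if "\<sigma> \<in> elts (ap n e)" "e \<in> elts d" for \<sigma> e
    using dn(3)[OF that(2)] that(1) unfolding T_def by auto
  \<comment> \<open>Lists may grow and shift their entries; only the set of entries has to
    persist.\<close>
  define ext where "ext \<sigma> \<tau> \<longleftrightarrow> (\<forall>k\<in>elts omega. \<exists>m\<in>elts omega. ap \<sigma> k = ap \<tau> m)" for \<sigma> \<tau>
  have dext: "dft t \<Longrightarrow> dft u \<Longrightarrow> dfn (\<lambda>s. ext (t s) (u s))" for t u
    by (rule dfn_comp2[of ext]) (simp_all only: ext_def, intro dfi)
  have ext_trans: "ext \<sigma> \<upsilon>" if "ext \<sigma> \<tau>" "ext \<tau> \<upsilon>" for \<sigma> \<tau> \<upsilon>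
    using that unfolding ext_def by metis
  have ext_cons: "ext \<sigma> (cons x \<sigma>)" for \<sigma> x
    unfolding ext_def using ap_cons(2) suc_omega by metis
  let ?R = "\<lambda>b. b \<in> elts (suc a) \<longrightarrow> (\<forall>e\<in>elts d. \<forall>\<sigma>\<in>elts (ap n e). \<forall>x\<in>elts (ap f b).
    \<exists>h\<in>elts d. \<exists>\<tau>\<in>elts (ap n h). ext \<sigma> \<tau> \<and> ap \<tau> zero = x)"
  have reach: "ordinal b \<Longrightarrow> ?R b" for b
  proof (rule ord_induct[where P = ?R])
    show "dfn (\<lambda>s. ?R (s 0))" by (intro dfi dext)
    fix b assume ob: "ordinal b" and IH: "\<And>c. c \<in> elts b \<Longrightarrow> ?R c"
    show "?R b"
    proof (intro impI ballI)
      fix e \<sigma> x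
      assume b: "b \<in> elts (suc a)" and e: "e \<in> elts d" and \<sigma>: "\<sigma> \<in> elts (ap n e)" and x: "x \<in> elts (ap f b)"
      from ord_cases[OF ob] show "\<exists>h\<in>elts d. \<exists>\<tau>\<in>elts (ap n h). ext \<sigma> \<tau> \<and> ap \<tau> zero = x"
      proof (elim disjE exE)
        assume "b = zero"
        with D0_cover x obtain i where i: "i \<in> elts Theta" "x \<in> elts (D0 i)" by blast
        from Ext0_in[OF e i(1)] obtain h where h: "h \<in> elts d" "ap n h = Ext0 (ap n e) i" by blast
        have "cons x \<sigma> \<in> elts (ap n h)"
          unfolding h(2) elts_Ext0 using cons_funs[OF n_funs[OF \<sigma> e]] D0_\<Lambda> i(2) \<sigma> by blast
        with h(1) ext_cons ap_cons(1) show ?thesis by blast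
      next
        assume "limit_ordinal b"
        with fl[OF b] x obtain c where c: "c \<in> elts b" "x \<in> elts (ap f c)" by blast
        moreover have "c \<in> elts (suc a)" using ord_trans[OF osa c(1) b] .
        ultimately show ?thesis using IH[OF c(1)] e \<sigma> by blast
      next
        fix c assume bc: "b = suc c"
        have cb: "c \<in> elts b" by (simp add: bc)
        have c: "c \<in> elts (suc a)" by (rule ord_trans[OF osa cb b])
        let ?A = "ap f c"
        have sc: "suc c \<in> elts (suc a)" using b bc by simp
        from x have "x \<in> elts (Def ?A)" using fs[OF sc] bc by simp
        then obtain R s where Rs: "definable_relation ?A R" "s \<in> elts (funs omega ?A)" "x = Pdef ?A R s"
          unfolding elts_Def by blast
        obtain m where m: "m \<in> elts omega" "support ?A R m" using definable_support[OF Rs(1)] by blast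
        \<comment> \<open>The parameters lie in the earlier level \<open>c\<close>, where the
          induction hypothesis reaches them one at a time. Since it extends a given list, finitely
          many of them can be gathered in a single list.\<close>
        have "\<exists>h\<in>elts d. \<exists>\<tau>\<in>elts (ap n h). ext \<sigma> \<tau> \<and> (\<forall>k\<in>elts l. \<exists>k'\<in>elts omega. ap s k = ap \<tau> k')"
          if "l \<in> elts omega" for l
          using that
        proof (induction l rule: omega_induct)
          case dfn
          show ?case by (intro dfi dext)
        next
          case zero
          have "ext \<sigma> \<sigma>" unfolding ext_def by blast
          with e \<sigma> show ?case by auto
        next
          case (suc l)
          then obtain h \<tau> where h: "h \<in> elts d" "\<tau> \<in> elts (ap n h)" "ext \<sigma> \<tau>"
            "\<forall>k\<in>elts l. \<exists>k'\<in>elts omega. ap s k = ap \<tau> k'" by blast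
          have "ap s l \<in> elts ?A" using Rs(2) suc(1) unfolding funs_iff by blast
          then obtain h' \<upsilon> where h': "h' \<in> elts d" "\<upsilon> \<in> elts (ap n h')" "ext \<tau> \<upsilon>" "ap \<upsilon> zero = ap s l"
            using IH[OF cb] c h(1,2) by blast
          have "\<exists>k'\<in>elts omega. ap s k = ap \<upsilon> k'" if k: "k \<in> elts (suc l)" for k
          proof (cases "k = l")
            case True
            with h'(4) show ?thesis by (intro bexI[of _ zero]) simp_all
          next
            case False
            with k h(4) obtain k' where "k' \<in> elts omega" "ap s k = ap \<tau> k'" by auto
            with h'(3) show ?thesis unfolding ext_def by metis
          qed
          with h'(1,2) ext_trans[OF h(3) h'(3)] show ?case by blast
        qed
        \<comment> \<open>\<open>suc m\<close> parameters are gathered instead of \<open>m\<close>: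
          the parameter with index zero is then available even if the support is empty.\<close>
        from this[OF suc_omega[OF m(1)]] obtain h \<tau> where h: "h \<in> elts d" "\<tau> \<in> elts (ap n h)" "ext \<sigma> \<tau>"
          and found: "\<And>k. k \<in> elts (suc m) \<Longrightarrow> \<exists>k'\<in>elts omega. ap s k = ap \<tau> k'" by blast
        \<comment> \<open>The place in \<open>\<tau>\<close> of parameter \<open>k\<close>. Beyond
          the support, parameter zero is taken instead, which keeps the reindexed list inside the
          level.\<close>
        define idx where "idx k = lst (\<lambda>k'. k' \<in> elts omega \<and> ap s (if k \<in> elts (suc m) then k else zero) = ap \<tau> k')" for k
        have idx: "dft (\<lambda>s. idx (s 0))" unfolding idx_def by (intro dfi)
        have zm: "zero \<in> elts (suc m)" by (rule zero_in_suc) (rule omega_ord[OF m(1)])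
        have idx_eq: "idx k \<in> elts omega \<and> ap s (if k \<in> elts (suc m) then k else zero) = ap \<tau> (idx k)" for k
        proof -
          let ?k = "if k \<in> elts (suc m) then k else zero"
          have "?k \<in> elts (suc m)" using zm by simp
          then obtain k' where k': "k' \<in> elts omega" "ap s ?k = ap \<tau> k'" using found by blast
          have df: "dfn (\<lambda>z. z 0 \<in> elts omega \<and> ap s ?k = ap \<tau> (z 0))" by (intro dfi)
          show ?thesis
            unfolding idx_def
            by (rule lst_mem(2)[where P = "\<lambda>k'. k' \<in> elts omega \<and> ap s ?k = ap \<tau> k'", OF df omega_ord[OF k'(1)]])
              (use k' in blast)
        qed
        define y where "y = lam omega idx"
        have y: "y \<in> elts reals" unfolding y_def by (rule lam_reals[OF idx]) (use idx_eq in blast)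
        have ap_y: "ap \<tau> (ap y k) = ap s (if k \<in> elts (suc m) then k else zero)" if "k \<in> elts omega" for k
          unfolding y_def using ap_lam[OF idx that] idx_eq[of k] by simp
        have rf: "reindex \<tau> y \<in> elts (funs omega ?A)"
          unfolding funs_iff using Rs(2) fun_on_reindex by (simp add: ap_reindex ap_y funs_iff)
        have "Pdef ?A R s = Pdef ?A R (reindex \<tau> y)"
          by (rule Pdef_support[OF m(2,1) Rs(2) rf]) (use omega_trans[OF m(1)] in \<open>simp add: ap_reindex ap_y\<close>)
        with Rs(3) have xx: "x = Pdef ?A R (reindex \<tau> y)" by simp
        from Ext1_in[OF h(1) sc] obtain h' where h': "h' \<in> elts d" "ap n h' = Ext1 (ap n h) c" by blast
        have "cons x \<tau> \<in> elts (funs omega \<Lambda>)"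
          using cons_funs[OF n_funs[OF h(2,1)]] f_\<Lambda>[OF b] x by blast
        then have "cons x \<tau> \<in> elts (ap n h')"
          unfolding h'(2) elts_Ext1 using h(2) y Rs(1) rf xx by blast
        with h'(1) ext_trans[OF h(3) ext_cons] ap_cons(1) show ?thesis by blast
      qed
    qed
  qed
  \<comment> \<open>Every element reached stands at the head of a list, so the wanted families
    consist of first entries.\<close>
  define q where "q g = img (ap n g) (\<lambda>\<sigma>. ap \<sigma> zero)" for g
  have q: "dft (\<lambda>s. q (s 0))" unfolding q_def by (intro dfi)
  have elts_q: "elts (q g) = (\<lambda>\<sigma>. ap \<sigma> zero) ` elts (ap n g)" for g
    unfolding q_def by (rule elts_img) (intro dfi)
  have "Rsmall (ap (lam d q) g)" if "g \<in> elts d" for g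
  proof -
    have "Rsmall (q g)"
    proof (rule Rsmall_image[OF n_Rsmall[OF that], where F = "\<lambda>\<sigma>. ap \<sigma> zero"])
      show "dft (\<lambda>s. ap (s 0) zero)" by (intro dfi)
    qed (auto simp: elts_q)
    then show ?thesis by (simp add: ap_lam[OF q that])
  qed
  moreover have "\<exists>g\<in>elts d. y \<in> elts (ap (lam d q) g)" if yY: "y \<in> elts Y" for y
  proof -
    obtain c where c: "c \<in> elts (suc a)" "y \<in> elts (ap f c)" using Y_sub yY by blast
    obtain e where e: "e \<in> elts d" "ap n e = S0" using S0_in by blast
    have "lam omega (\<lambda>n. zero) \<in> elts (ap n e)" unfolding e(2) S0_def by simp
    with reach[OF ord_elem[OF osa c(1)]] c e(1) obtain h \<tau> where h: "h \<in> elts d" "\<tau> \<in> elts (ap n h)" "ap \<tau> zero = y"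
      by blast
    then have "y \<in> elts (q h)" unfolding elts_q by blast
    with h(1) show ?thesis by (intro bexI[of _ h]) (simp_all add: ap_lam[OF q])
  qed
  ultimately show ?thesis using dn(1) by blast
qed


section \<open>Conditions\<close>

definition two :: 'a where
  "two = suc (suc zero)"

lemma elts_two [simp]: "elts two = {zero, suc zero}"
  unfolding two_def by auto

text \<open>Bounded partial functions from Theta to 2, the pairs being written as (value, argument).\<close>
definition T2 :: 'a where
  "T2 = sep (powerset (prod two Theta)) (\<lambda>p. (\<exists>a\<in>elts Theta. elts p \<subseteq> elts (prod two a)) \<and>
     (\<forall>x. \<not> (opair zero x \<in> elts p \<and> opair (suc zero) x \<in> elts p)))"

lemma elts_T2: "elts T2 = {p. (\<exists>a\<in>elts Theta. elts p \<subseteq> elts (prod two a)) \<and>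
     (\<forall>x. \<not> (opair zero x \<in> elts p \<and> opair (suc zero) x \<in> elts p))}"
proof -
  have "dfn (\<lambda>s. (\<exists>a\<in>elts Theta. elts (s 0) \<subseteq> elts (prod two a)) \<and>
     (\<forall>x. \<not> (opair zero x \<in> elts (s 0) \<and> opair (suc zero) x \<in> elts (s 0))))"
    by (intro dfi)
  moreover have "elts (prod two a) \<subseteq> elts (prod two Theta)" if "a \<in> elts Theta" for a
    using Theta_trans[OF that] unfolding elts_prod by blast
  ultimately show ?thesis
    using elts_sep[of "\<lambda>p. (\<exists>a\<in>elts Theta. elts p \<subseteq> elts (prod two a)) \<and>
     (\<forall>x. \<not> (opair zero x \<in> elts p \<and> opair (suc zero) x \<in> elts p))" "powerset (prod two Theta)"]
    unfolding T2_def elts_powerset by blast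
qed

lemma prod_mono: "elts a \<subseteq> elts b \<Longrightarrow> elts (prod c a) \<subseteq> elts (prod c b)"
  unfolding elts_prod by blast

definition free :: "'a \<Rightarrow> 'a" where
  "free p = lst (\<lambda>x. opair zero x \<notin> elts p \<and> opair (suc zero) x \<notin> elts p)"

lemma dft_free [dfi]: "dft t \<Longrightarrow> dft (\<lambda>s. free (t s))"
  by (rule dft_comp1[of free]) (simp_all only: free_def, intro dfi)

definition ext :: "'a \<Rightarrow> 'a \<Rightarrow> 'a" where
  "ext k p = Un2 p (sing (opair k (free p)))"

lemma dft_ext' [dfi]: "dft t \<Longrightarrow> dft u \<Longrightarrow> dft (\<lambda>s. ext (t s) (u s))"
  by (rule dft_comp2[of ext]) (simp_all only: ext_def, intro dfi)

lemma elts_ext: "elts (ext k p) = insert (opair k (free p)) (elts p)"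
  unfolding ext_def by auto

lemma free_props:
  assumes p: "elts p \<subseteq> elts (prod two a)" and a: "ordinal a"
  shows "free p \<in> elts (suc a)" "opair zero (free p) \<notin> elts p" "opair (suc zero) (free p) \<notin> elts p"
proof -
  have d: "dfn (\<lambda>s. opair zero (s 0) \<notin> elts p \<and> opair (suc zero) (s 0) \<notin> elts p)" by (intro dfi)
  have "opair zero a \<notin> elts p \<and> opair (suc zero) a \<notin> elts p"
    using p by (metis mem_irrefl opair_in_prod subsetD)
  note L = lst_mem[where P = "\<lambda>x. opair zero x \<notin> elts p \<and> opair (suc zero) x \<notin> elts p", OF d a this, folded free_def]
  from L(2,3) show "free p \<in> elts (suc a)" "opair zero (free p) \<notin> elts p" "opair (suc zero) (free p) \<notin> elts p"
    by blast+
qed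

lemma ext_T2:
  assumes p: "p \<in> elts T2" and k: "k = zero \<or> k = suc zero"
  shows "ext k p \<in> elts T2" "elts p \<subset> elts (ext k p)"
proof -
  obtain a where a: "a \<in> elts Theta" "elts p \<subseteq> elts (prod two a)" using p unfolding elts_T2 by blast
  note fp = free_props[OF a(2) Theta_ord[OF a(1)]]
  have "elts (prod two a) \<subseteq> elts (prod two (suc a))" by (rule prod_mono) auto
  then have "elts (ext k p) \<subseteq> elts (prod two (suc a))"
    using a(2) fp(1) k unfolding elts_ext by auto
  moreover have "\<not> (opair zero x \<in> elts (ext k p) \<and> opair (suc zero) x \<in> elts (ext k p))" for x
  proof
    assume "opair zero x \<in> elts (ext k p) \<and> opair (suc zero) x \<in> elts (ext k p)"
    then show False
      using p fp(2,3) k unfolding elts_ext elts_T2 by auto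
  qed
  ultimately show "ext k p \<in> elts T2" using Theta_suc[OF a(1)] unfolding elts_T2 by blast
  show "elts p \<subset> elts (ext k p)" unfolding elts_ext using fp(2,3) k by blast
qed

text \<open>The two extensions give different values to the same argument
  \<open>free p\<close>.\<close>

lemma ext_incompatible: "q \<in> elts T2 \<Longrightarrow> elts (ext zero p) \<subseteq> elts q \<Longrightarrow> elts (ext (suc zero) p) \<subseteq> elts q \<Longrightarrow> False"
  unfolding elts_T2 elts_ext by blast

text \<open>These conditions are pairwise distinct. Putting all of them into the poset guarantees
  that there are not fewer than Theta conditions.\<close>

lemma literal_T2: "l \<in> elts Theta \<Longrightarrow> sing (opair zero l) \<in> elts T2"
  unfolding elts_T2 using Theta_suc by (auto intro!: bexI[of _ "suc l"])

section \<open>Greedy sequences of conditions\<close>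

text \<open>
  The parameter \<open>c\<close> is a triple \<open>(n, (Y, p))\<close> of an enumeration \<open>n\<close> of conditions, a set \<open>Y\<close> of
  relations between conditions and reals, and a condition \<open>p\<close>. The sequence \<open>sq c\<close> starts below
  \<open>p\<close> and always takes the first condition of the enumeration which is related, by some \<open>b\<close> in
  \<open>Y\<close>, to some real to which no earlier condition of the sequence was related by \<open>b\<close>.
\<close>
definition usq :: "'a \<Rightarrow> 'a \<Rightarrow> 'a" where
  "usq c g = Un2 (snd' (snd' c)) (bigU (rn g))"

definition newc :: "'a \<Rightarrow> 'a \<Rightarrow> 'a \<Rightarrow> bool" where
  "newc c g q \<longleftrightarrow> elts (usq c g) \<subset> elts q \<and> (\<exists>b\<in>elts (fst' (snd' c)). \<exists>x\<in>elts reals. opair q x \<in> elts b \<and>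
     (\<forall>e\<in>elts (dm g). opair (ap g e) x \<notin> elts b))"

definition hasnew :: "'a \<Rightarrow> 'a \<Rightarrow> bool" where
  "hasnew c g \<longleftrightarrow> (\<exists>e\<in>elts (dm (fst' c)). newc c g (ap (fst' c) e))"

definition stepc :: "'a \<Rightarrow> 'a \<Rightarrow> 'a" where
  "stepc c g = ap (fst' c) (lst (\<lambda>e. e \<in> elts (dm (fst' c)) \<and> newc c g (ap (fst' c) e)))"

definition sq :: "'a \<Rightarrow> 'a \<Rightarrow> 'a" where
  "sq c = trv (stepc c)"

definition stop :: "'a \<Rightarrow> 'a" where
  "stop c = lst (\<lambda>x. \<not> hasnew c (lam x (sq c)))"

definition cand :: "'a \<Rightarrow> 'a" where
  "cand c = usq c (lam (stop c) (sq c))"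

lemma dft_usq [dfi]: "dft t \<Longrightarrow> dft u \<Longrightarrow> dft (\<lambda>s. usq (t s) (u s))"
  by (rule dft_comp2[of usq]) (simp_all only: usq_def, intro dfi)

lemma dfn_newc [dfi]: "dft t \<Longrightarrow> dft u \<Longrightarrow> dft v \<Longrightarrow> dfn (\<lambda>s. newc (t s) (u s) (v s))"
  by (rule dfn_comp3[of newc]) (simp_all only: newc_def, intro dfi)

lemma dfn_hasnew [dfi]: "dft t \<Longrightarrow> dft u \<Longrightarrow> dfn (\<lambda>s. hasnew (t s) (u s))"
  by (rule dfn_comp2[of hasnew]) (simp_all only: hasnew_def, intro dfi)

lemma dft_stepc [dfi]: "dft t \<Longrightarrow> dft u \<Longrightarrow> dft (\<lambda>s. stepc (t s) (u s))"
  by (rule dft_comp2[of stepc]) (simp_all only: stepc_def, intro dfi)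

lemma dft_sq [dfi]: "dft t \<Longrightarrow> dft u \<Longrightarrow> dft (\<lambda>s. sq (t s) (u s))"
  by (rule dft_comp2[of sq]) (simp_all only: sq_def, intro dfi)

lemma dft_stop [dfi]: "dft t \<Longrightarrow> dft (\<lambda>s. stop (t s))"
  by (rule dft_comp1[of stop]) (simp_all only: stop_def, intro dfi)

lemma dft_cand [dfi]: "dft t \<Longrightarrow> dft (\<lambda>s. cand (t s))"
  by (rule dft_comp1[of cand]) (simp_all only: cand_def, intro dfi)

lemma dft_stepc_c: "dft (\<lambda>s. stepc c (s 0))"
  by (intro dfi)

lemma dft_sq_c: "dft (\<lambda>s. sq c (s 0))"
  by (intro dfi)

lemma sq_eq: "ordinal x \<Longrightarrow> sq c x = stepc c (lam x (sq c))"
  unfolding sq_def by (rule trv_eq[OF dft_stepc_c])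

lemma elts_usq_lam: "elts (usq c (lam x (sq c))) = elts (snd' (snd' c)) \<union> (\<Union>y\<in>elts x. elts (sq c y))"
  unfolding usq_def by (simp add: elts_rn_lam[OF dft_sq_c])

lemma newc_lam: "newc c (lam x (sq c)) q \<longleftrightarrow> elts (usq c (lam x (sq c))) \<subset> elts q \<and>
  (\<exists>b\<in>elts (fst' (snd' c)). \<exists>r\<in>elts reals. opair q r \<in> elts b \<and> (\<forall>e\<in>elts x. opair (sq c e) r \<notin> elts b))"
  unfolding newc_def dm_lam[OF dft_sq_c] by (simp add: ap_lam[OF dft_sq_c])

lemma stepc_new:
  assumes d: "ordinal d" "dm (fst' c) = d" and "hasnew c g"
  shows "newc c g (stepc c g)" "\<exists>e\<in>elts d. stepc c g = ap (fst' c) e"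
proof -
  from assms obtain e where e: "e \<in> elts (dm (fst' c)) \<and> newc c g (ap (fst' c) e)"
    unfolding hasnew_def by blast
  have df: "dfn (\<lambda>s. s 0 \<in> elts (dm (fst' c)) \<and> newc c g (ap (fst' c) (s 0)))" by (intro dfi)
  have "ordinal e" using d e ord_elem by blast
  note L = lst_mem(2)[where P = "\<lambda>e. e \<in> elts (dm (fst' c)) \<and> newc c g (ap (fst' c) e)", OF df this e]
  then show "newc c g (stepc c g)" "\<exists>e\<in>elts d. stepc c g = ap (fst' c) e"
    unfolding stepc_def d(2) by blast+
qed

text \<open>The limit is a condition because the sequence has length below Theta and Theta is
  regular; consistency holds because the sequence increases. The last conclusion says that nothing
  in the enumeration is new at the limit, which is what distributivity will exploit.\<close>

lemma cand_props:
  assumes reg: "regular Theta" and d: "ordinal d" "fun_on n d" "\<forall>e\<in>elts d. ap n e \<in> elts T2"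
    and Y: "Rsmall Y" and p: "p \<in> elts T2" and c: "c = opair n (opair Y p)"
  shows "cand c \<in> elts T2" "elts p \<subseteq> elts (cand c)"
    "\<And>y. y \<in> elts (stop c) \<Longrightarrow> \<exists>e\<in>elts d. sq c y = ap n e"
    "\<And>y. y \<in> elts (stop c) \<Longrightarrow> elts (sq c y) \<subseteq> elts (cand c)"
    "\<And>e. e \<in> elts d \<Longrightarrow> \<not> newc c (lam (stop c) (sq c)) (ap n e)"
proof -
  have cs: "fst' c = n" "fst' (snd' c) = Y" "snd' (snd' c) = p" unfolding c by simp_all
  have dmn: "dm (fst' c) = d" unfolding cs by (rule dm_fun_on[OF d(2)])
  have sq_new: "newc c (lam x (sq c)) (sq c x)" "\<exists>e\<in>elts d. sq c x = ap n e"
    if "ordinal x" "hasnew c (lam x (sq c))" for x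
    using stepc_new[OF d(1) dmn that(2)] unfolding sq_eq[OF that(1)] cs by blast+
  have "\<exists>x\<in>elts Theta. \<not> hasnew c (lam x (sq c))"
  proof (rule ccontr)
    assume "\<not> ?thesis"
    then have all: "hasnew c (lam x (sq c))" if "x \<in> elts Theta" for x using that by blast
    \<comment> \<open>Stage \<open>x\<close> is recovered from a pair \<open>(b, r)\<close> that is
      new there, as the first stage related to \<open>r\<close> by \<open>b\<close>.\<close>
    have "Rsmall Theta"
    proof (rule Rsmall_image2[OF Y Rsmall_reals, where F = "\<lambda>b r. lst (\<lambda>x. opair (sq c x) r \<in> elts b)"])
      show "dft (\<lambda>s. lst (\<lambda>x. opair (sq c x) (s (Suc 0)) \<in> elts (s 0)))" by (intro dfi)
      fix x assume x: "x \<in> elts Theta"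
      note ox = Theta_ord[OF x]
      from sq_new(1)[OF ox all[OF x]] obtain b r where br: "b \<in> elts Y" "r \<in> elts reals"
        "opair (sq c x) r \<in> elts b" "\<And>e. e \<in> elts x \<Longrightarrow> opair (sq c e) r \<notin> elts b"
        unfolding newc_lam cs by blast
      have df: "dfn (\<lambda>s. opair (sq c (s 0)) r \<in> elts b)" by (intro dfi)
      note L = lst_mem[where P = "\<lambda>x. opair (sq c x) r \<in> elts b", OF df ox br(3)]
      have "x = lst (\<lambda>x. opair (sq c x) r \<in> elts b)"
        using L(2,3) br(4) by auto
      with br(1,2) show "\<exists>b\<in>elts Y. \<exists>r\<in>elts reals. x = lst (\<lambda>x. opair (sq c x) r \<in> elts b)" by blast
    qed
    with Theta_not_Rsmall show False by blast
  qed
  then obtain x0 where x0: "x0 \<in> elts Theta" "\<not> hasnew c (lam x0 (sq c))" by blast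
  have df: "dfn (\<lambda>s. \<not> hasnew c (lam (s 0) (sq c)))" by (intro dfi)
  note S = lst_mem[where P = "\<lambda>x. \<not> hasnew c (lam x (sq c))", OF df Theta_ord[OF x0(1)] x0(2), folded stop_def]
  have sT: "stop c \<in> elts Theta" using S(3) x0(1) Theta_trans by auto
  have S4: "hasnew c (lam y (sq c))" if "y \<in> elts (stop c)" for y using S(4)[OF that] by blast
  have oy: "ordinal y" if "y \<in> elts (stop c)" for y using S(1) that by (rule ord_elem)
  show in_n: "\<exists>e\<in>elts d. sq c y = ap n e" if "y \<in> elts (stop c)" for y
    using sq_new(2)[OF oy[OF that] S4[OF that]] .
  have cand: "elts (cand c) = elts p \<union> (\<Union>y\<in>elts (stop c). elts (sq c y))"
    unfolding cand_def elts_usq_lam cs ..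
  show "elts p \<subseteq> elts (cand c)" unfolding cand by blast
  show "elts (sq c y) \<subseteq> elts (cand c)" if "y \<in> elts (stop c)" for y
    unfolding cand using that by blast
  show "\<not> newc c (lam (stop c) (sq c)) (ap n e)" if "e \<in> elts d" for e
  proof
    assume "newc c (lam (stop c) (sq c)) (ap n e)"
    then have "hasnew c (lam (stop c) (sq c))"
      unfolding hasnew_def dmn by (intro bexI[of _ e]) (simp_all only: cs that)
    with S(2) show False by (rule notE)
  qed
  have inc: "elts p \<subseteq> elts (sq c y)" "\<And>z. z \<in> elts y \<Longrightarrow> elts (sq c z) \<subseteq> elts (sq c y)"
    if "y \<in> elts (stop c)" for y
    using sq_new(1)[OF oy[OF that] S4[OF that]] unfolding newc_lam elts_usq_lam cs by blast+
  have sqT: "sq c y \<in> elts T2" if "y \<in> elts (stop c)" for y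
    using in_n[OF that] d(3) by metis
  \<comment> \<open>The least bound of each condition in the sequence is a definable function of its
    index, so \<open>Rsmall_bounded\<close> gives a common bound.\<close>
  have "\<exists>b\<in>elts Theta. \<forall>y\<in>elts (stop c). elts (sq c y) \<subseteq> elts (prod two b)"
  proof -
    define F where "F y = lst (\<lambda>a. elts (sq c y) \<subseteq> elts (prod two a))" for y
    have F: "dft (\<lambda>s. F (s 0))" unfolding F_def by (intro dfi)
    have Fy: "F y \<in> elts Theta \<and> elts (sq c y) \<subseteq> elts (prod two (F y))" if y: "y \<in> elts (stop c)" for y
    proof -
      obtain a where a: "a \<in> elts Theta" "elts (sq c y) \<subseteq> elts (prod two a)"
        using sqT[OF y] unfolding elts_T2 by blast
      have df: "dfn (\<lambda>s. elts (sq c y) \<subseteq> elts (prod two (s 0)))" by (intro dfi)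
      note L = lst_mem[where P = "\<lambda>a. elts (sq c y) \<subseteq> elts (prod two a)", OF df Theta_ord[OF a(1)] a(2), folded F_def]
      show ?thesis using L(2) Theta_trans[OF Theta_suc[OF a(1)] L(3)] by blast
    qed
    have img: "elts (img (stop c) F) = F ` elts (stop c)" by (rule elts_img[OF F])
    have "Rsmall (stop c)" using sT Theta_iff[OF S(1)] by blast
    then have "Rsmall (img (stop c) F)" by (rule Rsmall_image[OF _ F]) (auto simp: img)
    from Rsmall_bounded[OF reg this] obtain b where b: "b \<in> elts Theta" "F ` elts (stop c) \<subseteq> elts b"
      unfolding img using Fy by blast
    have "elts (sq c y) \<subseteq> elts (prod two b)" if "y \<in> elts (stop c)" for y
    proof -
      have "F y \<in> elts b" using b(2) that by blast
      then have "elts (F y) \<subseteq> elts b" using Theta_ord[OF b(1)] ord_trans by blast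
      with Fy[OF that] prod_mono show ?thesis by blast
    qed
    with b(1) show ?thesis by blast
  qed
  then obtain b where b: "b \<in> elts Theta" "\<And>y. y \<in> elts (stop c) \<Longrightarrow> elts (sq c y) \<subseteq> elts (prod two b)" by blast
  obtain a where a: "a \<in> elts Theta" "elts p \<subseteq> elts (prod two a)" using p unfolding elts_T2 by blast
  have "elts (prod two a) \<subseteq> elts (prod two (Un2 a b))" "elts (prod two b) \<subseteq> elts (prod two (Un2 a b))"
    by (rule prod_mono, simp)+
  then have "elts (cand c) \<subseteq> elts (prod two (Un2 a b))"
    using a(2) b(2) unfolding cand by blast
  moreover have "\<not> (opair zero x \<in> elts (cand c) \<and> opair (suc zero) x \<in> elts (cand c))" for x
  proof
    assume "opair zero x \<in> elts (cand c) \<and> opair (suc zero) x \<in> elts (cand c)"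
    then have 0: "opair zero x \<in> elts p \<or> (\<exists>y\<in>elts (stop c). opair zero x \<in> elts (sq c y))"
      and 1: "opair (suc zero) x \<in> elts p \<or> (\<exists>y\<in>elts (stop c). opair (suc zero) x \<in> elts (sq c y))"
      unfolding cand by blast+
    have T: "\<not> (opair zero x \<in> elts q \<and> opair (suc zero) x \<in> elts q)" if "q \<in> elts T2" for q
      using that unfolding elts_T2 by blast
    from 0 1 show False
    proof (elim disjE bexE)
      fix y z assume y: "y \<in> elts (stop c)" "opair zero x \<in> elts (sq c y)"
        and z: "z \<in> elts (stop c)" "opair (suc zero) x \<in> elts (sq c z)"
      from ord_linear[OF oy[OF y(1)] oy[OF z(1)]] show False
        using inc(2)[OF y(1)] inc(2)[OF z(1)] T[OF sqT[OF y(1)]] T[OF sqT[OF z(1)]] y(2) z(2) by blast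
    qed (use T[OF p] inc(1) T[OF sqT] in blast)+
  qed
  ultimately show "cand c \<in> elts T2" using Theta_Un2[OF a(1) b(1)] unfolding elts_T2 by blast
qed


text \<open>Besides literals and one-point extensions, the enumeration is closed under the limits
  \<open>cand\<close> computed from the enumeration itself. A limit depends on an index
  \<open>i\<close> of a family of relations and on an index \<open>e\<close> of a condition, both
  ordinals, as the greedy enumeration requires.\<close>

lemma distributive_conditions:
  assumes VL: "V_eq_L_over (powerset reals)" and AD and reg: "regular Theta"
  obtains d n where "ordinal d" "fun_on n d" "\<And>e. e \<in> elts d \<Longrightarrow> ap n e \<in> elts T2"
    "\<And>l. l \<in> elts Theta \<Longrightarrow> \<exists>e\<in>elts d. ap n e = sing (opair zero l)"
    "\<And>e k. e \<in> elts d \<Longrightarrow> k = zero \<or> k = suc zero \<Longrightarrow> \<exists>h\<in>elts d. ap n h = ext k (ap n e)"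
    "\<And>b e. elts b \<subseteq> elts (prod T2 reals) \<Longrightarrow> e \<in> elts d \<Longrightarrow>
       (\<And>x e. x \<in> elts reals \<Longrightarrow> e \<in> elts d \<Longrightarrow>
          \<exists>h\<in>elts d. elts (ap n e) \<subseteq> elts (ap n h) \<and> opair (ap n h) x \<in> elts b) \<Longrightarrow>
       (\<And>x e h. x \<in> elts reals \<Longrightarrow> e \<in> elts d \<Longrightarrow> h \<in> elts d \<Longrightarrow> elts (ap n e) \<subseteq> elts (ap n h) \<Longrightarrow>
          opair (ap n e) x \<in> elts b \<Longrightarrow> opair (ap n h) x \<in> elts b) \<Longrightarrow>
       \<exists>h\<in>elts d. elts (ap n e) \<subseteq> elts (ap n h) \<and> (\<forall>x\<in>elts reals. opair (ap n h) x \<in> elts b)"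
proof -
  obtain dY pY where Y: "ordinal dY" "\<And>i. i \<in> elts dY \<Longrightarrow> Rsmall (ap pY i)"
    "\<And>b. b \<in> elts (powerset (prod T2 reals)) \<Longrightarrow> \<exists>i\<in>elts dY. b \<in> elts (ap pY i)"
    using Rsmall_cover[OF VL \<open>AD\<close> reg, of "powerset (prod T2 reals)"] by blast
  \<comment> \<open>The first component 0, 1 or 2 selects literals, one-point extensions or limits.
    The default \<open>T2\<close> is not a member of itself, hence never admissible.\<close>
  define F where "F n c =
    (if fst' c = zero \<and> fst' (snd' c) \<in> elts Theta then sing (opair zero (fst' (snd' c)))
     else if fst' c = suc zero \<and> fst' (snd' c) \<in> elts two \<and> snd' (snd' c) \<in> elts (dm n)
       then ext (fst' (snd' c)) (ap n (snd' (snd' c)))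
     else if fst' c = suc (suc zero) \<and> fst' (snd' c) \<in> elts dY \<and> snd' (snd' c) \<in> elts (dm n)
       then cand (opair n (opair (ap pY (fst' (snd' c))) (ap n (snd' (snd' c)))))
     else T2)" for n c
  have F: "dft (\<lambda>s. F (s 0) (s (Suc 0)))" unfolding F_def by (intro dfi)
  show thesis
  proof (rule greedy_enumeration[OF F, of T2], goal_cases)
    case (1 d n)
    note dn = 1(1-3) and closed = 1(6)
    have dT: "\<forall>e\<in>elts d. ap n e \<in> elts T2" using dn(3) by blast
    have dmn: "dm n = d" using dn(2) by (rule dm_fun_on)
    have o: "ordinal (suc zero)" "ordinal (suc (suc zero))" by simp_all
    have lits: "\<exists>e\<in>elts d. ap n e = sing (opair zero l)" if "l \<in> elts Theta" for l
    proof -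
      have eq: "F n (opair zero (opair l zero)) = sing (opair zero l)" unfolding F_def using that by simp
      from closed[OF ordinal_zero Theta_ord[OF that] ordinal_zero] literal_T2[OF that] show ?thesis
        unfolding eq by blast
    qed
    have exts: "\<exists>h\<in>elts d. ap n h = ext k (ap n e)" if "e \<in> elts d" "k = zero \<or> k = suc zero" for e k
    proof -
      have eq: "F n (opair (suc zero) (opair k e)) = ext k (ap n e)" unfolding F_def using that dmn by auto
      have "ordinal k" using that(2) by auto
      from closed[OF o(1) this ord_elem[OF dn(1) that(1)]] ext_T2(1)[OF dn(3)[OF that(1)] that(2)] show ?thesis
        unfolding eq by blast
    qed
    have dist: "\<exists>h\<in>elts d. elts (ap n e) \<subseteq> elts (ap n h) \<and> (\<forall>x\<in>elts reals. opair (ap n h) x \<in> elts b)"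
      if b: "elts b \<subseteq> elts (prod T2 reals)" and e: "e \<in> elts d"
        and dense: "\<And>x e. x \<in> elts reals \<Longrightarrow> e \<in> elts d \<Longrightarrow>
          \<exists>h\<in>elts d. elts (ap n e) \<subseteq> elts (ap n h) \<and> opair (ap n h) x \<in> elts b"
        and "open": "\<And>x e h. x \<in> elts reals \<Longrightarrow> e \<in> elts d \<Longrightarrow> h \<in> elts d \<Longrightarrow>
          elts (ap n e) \<subseteq> elts (ap n h) \<Longrightarrow> opair (ap n e) x \<in> elts b \<Longrightarrow> opair (ap n h) x \<in> elts b"
      for b e
    proof -
      \<comment> \<open>The single relation \<open>b\<close> sits in an \<open>Rsmall\<close> family
        with an ordinal index; the limit is taken for the whole family.\<close>
      obtain i where i: "i \<in> elts dY" "b \<in> elts (ap pY i)" using Y(3)[of b] b by auto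
      define c where "c = opair n (opair (ap pY i) (ap n e))"
      note C = cand_props[OF reg dn(1,2) dT Y(2)[OF i(1)] dn(3)[OF e] c_def]
      have eq: "F n (opair (suc (suc zero)) (opair i e)) = cand c"
        unfolding F_def c_def using i(1) e dmn by simp
      obtain h where h: "h \<in> elts d" "ap n h = cand c"
        using closed[OF o(2) ord_elem[OF Y(1) i(1)] ord_elem[OF dn(1) e]] C(1) unfolding eq by blast
      have "opair (cand c) x \<in> elts b" if x: "x \<in> elts reals" for x
      proof -
        obtain h0 where h0: "h0 \<in> elts d" "elts (cand c) \<subseteq> elts (ap n h0)" "opair (ap n h0) x \<in> elts b"
          using dense[OF x h(1)] unfolding h(2) by blast
        \<comment> \<open>\<open>newc\<close> demands a proper extension. If \<open>h0\<close>
          equals the limit, only one more step makes it proper, and openness keeps the relation to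
          \<open>x\<close>.\<close>
        obtain h1 where h1: "h1 \<in> elts d" "ap n h1 = ext zero (ap n h0)" using exts[OF h0(1), of zero] by blast
        have less: "elts (ap n h0) \<subset> elts (ap n h1)"
          unfolding h1(2) by (rule ext_T2(2)[OF dn(3)[OF h0(1)]]) simp
        then have h1b: "opair (ap n h1) x \<in> elts b" using "open"[OF x h0(1) h1(1) _ h0(3)] by blast
        have "elts (usq c (lam (stop c) (sq c))) \<subset> elts (ap n h1)"
          using h0(2) less unfolding cand_def by blast
        moreover have "fst' (snd' c) = ap pY i" unfolding c_def by simp
        \<comment> \<open>As \<open>h1\<close> is not new, the pair of \<open>b\<close> and
          \<open>x\<close> must have been met earlier, by some condition of the sequence; openness
          carries this up to the limit.\<close>
        ultimately obtain y where y: "y \<in> elts (stop c)" "opair (sq c y) x \<in> elts b"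
          using C(5)[OF h1(1)] i(2) x h1b unfolding newc_lam by metis
        from C(3)[OF y(1)] obtain g where g: "g \<in> elts d" "sq c y = ap n g" by blast
        from "open"[OF x g(1) h(1)] C(4)[OF y(1)] y(2) show ?thesis unfolding g(2) h(2) by blast
      qed
      with h C(2) show ?thesis by metis
    qed
    show ?case by (rule that[OF dn lits exts dist])
  qed
qed

section \<open>Conditions are numbered by Theta\<close>

text \<open>A condition is coded by three sets of reals: a prewellordering of length
  \<open>a\<close>, and the sets of reals whose ranks are assigned 0 and 1. The triple determines
  the condition by \<open>pwo_determines\<close>.\<close>

definition decodes :: "'a \<Rightarrow> 'a \<Rightarrow> bool" where
  "decodes z s \<longleftrightarrow> (\<exists>a\<in>elts Theta. \<exists>h. onto h a \<and> fst' z = pwo h \<and>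
     s = Un2 (img (fst' (snd' z)) (\<lambda>x. opair zero (ap h x))) (img (snd' (snd' z)) (\<lambda>x. opair (suc zero) (ap h x))))"

lemma dfn_decodes [dfi]: "dft t \<Longrightarrow> dft u \<Longrightarrow> dfn (\<lambda>s. decodes (t s) (u s))"
  by (rule dfn_comp2[of decodes]) (simp_all only: decodes_def, intro dfi)

lemma decodes_unique: "decodes z s \<Longrightarrow> decodes z t \<Longrightarrow> s = t"
  unfolding decodes_def using pwo_determines Theta_ord by metis

definition Ws :: "'a \<Rightarrow> 'a" where
  "Ws b = sep T2 (\<lambda>s. \<exists>z\<in>elts (prod (Zs b) (prod (Zs b) (Zs b))). decodes z s)"

lemma dft_Ws [dfi]: "dft t \<Longrightarrow> dft (\<lambda>s. Ws (t s))"
  by (rule dft_comp1[of Ws]) (simp_all only: Ws_def, intro dfi)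

lemma elts_Ws: "elts (Ws b) = {s \<in> elts T2. \<exists>z\<in>elts (prod (Zs b) (prod (Zs b) (Zs b))). decodes z s}"
  unfolding Ws_def by (rule elts_sep) (intro dfi)

lemma Ws_mono: "elts b \<subseteq> elts c \<Longrightarrow> elts (Ws b) \<subseteq> elts (Ws c)"
proof -
  assume "elts b \<subseteq> elts c"
  then have "elts (prod (Zs b) (prod (Zs b) (Zs b))) \<subseteq> elts (prod (Zs c) (prod (Zs c) (Zs c)))"
    using Zs_mono unfolding elts_prod by blast
  then show ?thesis unfolding elts_Ws by blast
qed

lemma Ws_Rsmall:
  assumes AD "b \<in> elts Theta"
  shows "Rsmall (Ws b)"
proof -
  note Z = Zs_Rsmall[OF assms]
  show ?thesis
  proof (rule Rsmall_image[OF Rsmall_prod[OF Z Rsmall_prod[OF Z Z]], where F = "\<lambda>z. iota (decodes z)"])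
    show "dft (\<lambda>s. iota (decodes (s 0)))" by (intro dfi)
    fix s assume "s \<in> elts (Ws b)"
    then obtain z where z: "z \<in> elts (prod (Zs b) (prod (Zs b) (Zs b)))" "decodes z s" unfolding elts_Ws by blast
    have "iota (decodes z) = s"
      by (rule iota_eq[where P = "decodes z"]) (rule z(2), rule decodes_unique[OF _ z(2)])
    with z(1) show "\<exists>z\<in>elts (prod (Zs b) (prod (Zs b) (Zs b))). s = iota (decodes z)" by blast
  qed
qed

text \<open>Pulling a condition bounded by \<open>a\<close> back along a surjection from the reals
  onto \<open>suc a\<close> gives the three sets; each has a level in \<open>Zs\<close>, and the
  union of the levels serves for all.\<close>

lemma Ws_cover:
  assumes reg: "regular Theta" and s: "s \<in> elts T2"
  shows "\<exists>b\<in>elts Theta. s \<in> elts (Ws b)"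
proof -
  obtain a where a: "a \<in> elts Theta" "elts s \<subseteq> elts (prod two a)" using s unfolding elts_T2 by blast
  have sa: "suc a \<in> elts Theta" using Theta_suc[OF a(1)] .
  have "Rsmall (suc a)" using sa Theta_iff[OF Theta_ord[OF sa]] by blast
  then obtain h where h: "onto h (suc a)" using Rsmall_onto[of "suc a" a] by auto
  define B where "B k = sep reals (\<lambda>x. opair k (ap h x) \<in> elts s)" for k
  have B: "elts (B k) = {x \<in> elts reals. opair k (ap h x) \<in> elts s}" for k
    unfolding B_def by (rule elts_sep) (intro dfi)
  have I: "elts (img (B k) (\<lambda>x. opair k (ap h x))) = (\<lambda>x. opair k (ap h x)) ` elts (B k)" for k
    by (rule elts_img) (intro dfi)
  have "elts s = elts (Un2 (img (B zero) (\<lambda>x. opair zero (ap h x))) (img (B (suc zero)) (\<lambda>x. opair (suc zero) (ap h x))))"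
    unfolding elts_Un2 I
  proof (intro set_eqI iffI)
    fix v assume v: "v \<in> elts s"
    then obtain k y where ky: "k = zero \<or> k = suc zero" "y \<in> elts a" "v = opair k y"
      using a(2) unfolding elts_prod by auto
    then obtain x where "x \<in> elts reals" "ap h x = y" using h unfolding onto_def by auto
    with v ky(3) have "v \<in> (\<lambda>x. opair k (ap h x)) ` elts (B k)"
      unfolding B by (intro image_eqI[of _ _ x]) simp_all
    with ky(1) show "v \<in> (\<lambda>x. opair zero (ap h x)) ` elts (B zero) \<union> (\<lambda>x. opair (suc zero) (ap h x)) ` elts (B (suc zero))"
      by blast
  next
    fix v assume "v \<in> (\<lambda>x. opair zero (ap h x)) ` elts (B zero) \<union> (\<lambda>x. opair (suc zero) (ap h x)) ` elts (B (suc zero))"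
    then show "v \<in> elts s" unfolding B by blast
  qed
  then have "s = Un2 (img (B zero) (\<lambda>x. opair zero (ap h x))) (img (B (suc zero)) (\<lambda>x. opair (suc zero) (ap h x)))"
    by (simp only: elts_inject)
  then have dec: "decodes (opair (pwo h) (opair (B zero) (B (suc zero)))) s"
    unfolding decodes_def fst'_opair snd'_opair using sa h by (intro bexI[of _ "suc a"] exI[of _ h] conjI refl)
  have sub: "elts (pwo h) \<subseteq> elts reals" "elts (B k) \<subseteq> elts reals" for k
    unfolding elts_pwo B by blast+
  obtain b0 where b0: "b0 \<in> elts Theta" "pwo h \<in> elts (Zs b0)" using Zs_cover[OF reg sub(1)] by blast
  obtain b1 where b1: "b1 \<in> elts Theta" "B zero \<in> elts (Zs b1)" using Zs_cover[OF reg sub(2)] by blast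
  obtain b2 where b2: "b2 \<in> elts Theta" "B (suc zero) \<in> elts (Zs b2)" using Zs_cover[OF reg sub(2)] by blast
  define b where "b = Un2 b0 (Un2 b1 b2)"
  have "b \<in> elts Theta" unfolding b_def using Theta_Un2 b0(1) b1(1) b2(1) by blast
  moreover have "pwo h \<in> elts (Zs b)" "B zero \<in> elts (Zs b)" "B (suc zero) \<in> elts (Zs b)"
    using Zs_mono[of b0 b] Zs_mono[of b1 b] Zs_mono[of b2 b] b0(2) b1(2) b2(2) unfolding b_def by auto
  ultimately show ?thesis
    using dec s unfolding elts_Ws by (intro bexI[of _ b]) auto
qed

text \<open>The conditions are listed anew, with the level in \<open>Ws\<close> as priority.
  Everything before a listed condition then lies in its level, an \<open>Rsmall\<close> set, so the
  length is at most Theta; the literals prevent it from being smaller.\<close>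

lemma enumeration_by_Theta:
  assumes AD and reg: "regular Theta" and d: "ordinal d" "fun_on n d" "\<forall>e\<in>elts d. ap n e \<in> elts T2"
    and lits: "\<forall>l\<in>elts Theta. \<exists>e\<in>elts d. ap n e = sing (opair zero l)"
  shows "\<exists>m. fun_on m Theta \<and> ap m ` elts Theta = ap n ` elts d \<and>
    (\<forall>g\<in>elts Theta. \<forall>h\<in>elts Theta. ap m g = ap m h \<longrightarrow> g = h)"
proof -
  define P where "P = rn n"
  have P: "elts P = ap n ` elts d" unfolding P_def elts_rn dm_fun_on[OF d(2)] ..
  \<comment> \<open>The component \<open>k\<close> is the level and \<open>i\<close> an index in the
    old enumeration. The default \<open>P\<close> is outside \<open>P\<close>, hence never
    listed.\<close>
  define F where "F m c = (if fst' c \<in> elts Theta \<and> fst' (snd' c) \<in> elts d \<and> ap n (fst' (snd' c)) \<in> elts (Ws (fst' c))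
    then ap n (fst' (snd' c)) else P)" for m c :: 'a
  have F: "dft (\<lambda>s. F (s 0) (s (Suc 0)))" unfolding F_def by (intro dfi)
  have F_P: "k \<in> elts Theta \<and> i \<in> elts d \<and> ap n i \<in> elts (Ws k) \<and> F m (opair k (opair i e)) = ap n i"
    if "F m (opair k (opair i e)) \<in> elts P" for m k i e
    using that unfolding F_def by (auto split: if_splits)
  have F_eq: "F m (opair k (opair i e)) = ap n i" if "k \<in> elts Theta" "i \<in> elts d" "ap n i \<in> elts (Ws k)" for m k i e
    using that unfolding F_def by simp
  show ?thesis
  proof (rule greedy_enumeration[OF F, of P], goal_cases)
    case (1 d' m)
    note m = 1(1-4) and step = 1(5) and closed = 1(6)
    have rng: "ap m ` elts d' = elts P"
    proof
      show "ap m ` elts d' \<subseteq> elts P" using m(3) by blast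
      show "elts P \<subseteq> ap m ` elts d'"
      proof
        fix s assume s: "s \<in> elts P"
        then obtain i where i: "i \<in> elts d" "s = ap n i" unfolding P by blast
        obtain k where k: "k \<in> elts Theta" "s \<in> elts (Ws k)" using Ws_cover[OF reg d(3)[rule_format, OF i(1)]] i(2) by blast
        have "F m (opair k (opair i zero)) = s" using F_eq k i by simp
        with closed[OF Theta_ord[OF k(1)] ord_elem[OF d(1) i(1)] ordinal_zero] s
        show "s \<in> ap m ` elts d'" by force
      qed
    qed
    \<comment> \<open>\<open>k\<close> is a level containing entry \<open>g\<close>, and by the
      priority of the enumeration all conditions of lower levels precede that entry.\<close>
    have level: "\<exists>k\<in>elts Theta. ap m g \<in> elts (Ws k) \<and> (\<forall>k'\<in>elts k. \<forall>s\<in>elts P. s \<in> elts (Ws k') \<longrightarrow> (\<exists>h\<in>elts g. ap m h = s))"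
      if g: "g \<in> elts d'" for g
    proof -
      obtain k i e where kie: "ordinal k" "ap m g = F (restr m g) (opair k (opair i e))"
        and min: "\<And>k' i' e'. k' \<in> elts k \<Longrightarrow> ordinal i' \<Longrightarrow> ordinal e' \<Longrightarrow>
          F (restr m g) (opair k' (opair i' e')) \<in> elts P \<Longrightarrow>
          \<exists>h\<in>elts g. ap m h = F (restr m g) (opair k' (opair i' e'))"
        using step[OF g] by blast
      have fp: "k \<in> elts Theta \<and> i \<in> elts d \<and> ap n i \<in> elts (Ws k) \<and> F (restr m g) (opair k (opair i e)) = ap n i"
        by (rule F_P) (use m(3)[OF g] kie(2) in simp)
      have "\<exists>h\<in>elts g. ap m h = s" if k': "k' \<in> elts k" and s: "s \<in> elts P" "s \<in> elts (Ws k')" for k' s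
      proof -
        obtain i' where i': "i' \<in> elts d" "s = ap n i'" using s(1) unfolding P by blast
        have "k' \<in> elts Theta" using fp k' Theta_trans by blast
        then have eq: "F (restr m g) (opair k' (opair i' zero)) = s" using F_eq i' s(2) by simp
        from min[OF k' ord_elem[OF d(1) i'(1)] ordinal_zero] s(1) show ?thesis unfolding eq by blast
      qed
      with fp kie(2) show ?thesis by auto
    qed
    have "g \<in> elts Theta" if g: "g \<in> elts d'" for g
    proof -
      obtain k where k: "k \<in> elts Theta" "ap m g \<in> elts (Ws k)" using level[OF g] by blast
      have og: "ordinal g" using m(1) g by (rule ord_elem)
      have inW: "ap m h \<in> elts (Ws k)" if h: "h \<in> elts g" for h
      proof -
        have hd: "h \<in> elts d'" using ord_trans[OF m(1) h g] .
        obtain k' where k': "k' \<in> elts Theta" "ap m h \<in> elts (Ws k')"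
          "\<forall>l\<in>elts k'. \<forall>s\<in>elts P. s \<in> elts (Ws l) \<longrightarrow> (\<exists>u\<in>elts h. ap m u = s)" using level[OF hd] by blast
        \<comment> \<open>If the level of the earlier entry \<open>h\<close> were higher, entry
          \<open>g\<close> would have been listed before \<open>h\<close> already, against
          injectivity.\<close>
        have "k \<notin> elts k'"
        proof
          assume "k \<in> elts k'"
          with k'(3) k(2) m(3)[OF g] obtain u where u: "u \<in> elts h" "ap m u = ap m g" by blast
          have "u \<in> elts d'" using ord_trans[OF m(1) u(1) hd] .
          from m(4)[OF this g u(2)] u(1) h show False using mem_asym by blast
        qed
        then have "elts k' \<subseteq> elts k" using ord_not_mem[OF Theta_ord[OF k(1)] Theta_ord[OF k'(1)]] by blast
        with Ws_mono k'(2) show ?thesis by blast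
      qed
      have "Rsmall g"
      proof (rule Rsmall_image[OF Ws_Rsmall[OF \<open>AD\<close> k(1)], where F = "\<lambda>s. iota (\<lambda>h. h \<in> elts d' \<and> ap m h = s)"])
        show "dft (\<lambda>s. iota (\<lambda>h. h \<in> elts d' \<and> ap m h = s 0))" by (intro dfi)
        fix h assume h: "h \<in> elts g"
        have hd: "h \<in> elts d'" using ord_trans[OF m(1) h g] .
        have "iota (\<lambda>u. u \<in> elts d' \<and> ap m u = ap m h) = h"
        proof (rule iota_eq)
          show "h \<in> elts d' \<and> ap m h = ap m h" using hd by simp
          show "u = h" if "u \<in> elts d' \<and> ap m u = ap m h" for u using that m(4)[of u h] hd by simp
        qed
        with inW[OF h] show "\<exists>s\<in>elts (Ws k). h = iota (\<lambda>u. u \<in> elts d' \<and> ap m u = s)" by metis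
      qed
      with Theta_iff[OF og] show ?thesis by blast
    qed
    then have sub: "elts d' \<subseteq> elts Theta" by blast
    have dT: "d' = Theta"
    proof (rule ccontr)
      assume "d' \<noteq> Theta"
      with sub have "d' \<in> elts Theta" using ord_subset_iff[OF m(1) ordinal_Theta] by blast
      then have "Rsmall d'" using Theta_iff[OF m(1)] by blast
      \<comment> \<open>An index \<open>g\<close> of a literal determines the ordinal
        \<open>l\<close>, and every \<open>l\<close> below Theta arises.\<close>
      have "Rsmall Theta"
      proof (rule Rsmall_image[OF \<open>Rsmall d'\<close>, where F = "\<lambda>g. iota (\<lambda>l. ap m g = sing (opair zero l))"])
        show "dft (\<lambda>s. iota (\<lambda>l. ap m (s 0) = sing (opair zero l)))" by (intro dfi)
        fix l assume "l \<in> elts Theta"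
        then obtain e where "e \<in> elts d" "ap n e = sing (opair zero l)" using lits by blast
        then have "sing (opair zero l) \<in> ap m ` elts d'" unfolding rng P by force
        then obtain g where g: "g \<in> elts d'" "ap m g = sing (opair zero l)" by force
        have "iota (\<lambda>l. ap m g = sing (opair zero l)) = l"
        proof (rule iota_eq)
          show "ap m g = sing (opair zero l)" by fact
          show "l' = l" if "ap m g = sing (opair zero l')" for l'
          proof -
            have "elts (sing (opair zero l)) = elts (sing (opair zero l'))" using that g(2) by simp
            then show ?thesis unfolding elts_sing by simp
          qed
        qed
        with g(1) show "\<exists>g\<in>elts d'. l = iota (\<lambda>l. ap m g = sing (opair zero l))" by metis
      qed
      with Theta_not_Rsmall show False by blast
    qed
    show ?case
    proof (intro exI[of _ m] conjI ballI impI)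
      show "fun_on m Theta" using m(2) unfolding dT .
      show "ap m ` elts Theta = ap n ` elts d" using rng unfolding dT P .
      show "g = h" if "g \<in> elts Theta" "h \<in> elts Theta" "ap m g = ap m h" for g h
        by (rule m(4)) (use that in \<open>simp_all only: dT\<close>)
    qed
  qed
qed

definition splitting :: "'a \<Rightarrow> 'a \<Rightarrow> bool" where
  "splitting P le \<longleftrightarrow> (\<forall>p\<in>elts P. \<exists>q\<in>elts P. \<exists>r\<in>elts P. opair q p \<in> elts le \<and> opair r p \<in> elts le \<and>
     \<not> (\<exists>t. opair t q \<in> elts le \<and> opair t r \<in> elts le))"

text \<open>The family of open dense sets indexed by the reals is given as one relation
  \<open>b\<close>, so that the quantifier over families ranges over elements of the model.\<close>

definition distributive :: "'a \<Rightarrow> 'a \<Rightarrow> bool" where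
  "distributive P le \<longleftrightarrow> (\<forall>b. (\<forall>x\<in>elts reals. (\<forall>p\<in>elts P. \<exists>q\<in>elts P. opair q p \<in> elts le \<and> opair q x \<in> elts b) \<and>
      (\<forall>p q. opair q p \<in> elts le \<longrightarrow> opair p x \<in> elts b \<longrightarrow> opair q x \<in> elts b)) \<longrightarrow>
    (\<forall>p\<in>elts P. \<exists>q\<in>elts P. opair q p \<in> elts le \<and> (\<forall>x\<in>elts reals. opair q x \<in> elts b)))"

lemma poset_on_Theta:
  assumes VL: "V_eq_L_over (powerset reals)" and AD and reg: "regular Theta"
  shows "\<exists>le. poset Theta le \<and> splitting Theta le \<and> distributive Theta le"
proof (rule distributive_conditions[OF assms], goal_cases)
  case (1 d n)
  note dn = 1(1-3) and lits = 1(4) and exts = 1(5) and dist = 1(6)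
  have "\<forall>e\<in>elts d. ap n e \<in> elts T2" "\<forall>l\<in>elts Theta. \<exists>e\<in>elts d. ap n e = sing (opair zero l)"
    using dn(3) lits by blast+
  note enumeration_by_Theta[OF \<open>AD\<close> reg dn(1,2) this]
  then obtain m where m': "fun_on m Theta" "ap m ` elts Theta = ap n ` elts d"
    "\<forall>g\<in>elts Theta. \<forall>h\<in>elts Theta. ap m g = ap m h \<longrightarrow> g = h"
    by (elim exE conjE) (rule that)
  have m3: "g = h" if "g \<in> elts Theta" "h \<in> elts Theta" "ap m g = ap m h" for g h
    using m'(3)[rule_format, OF that] .
  note m = m'(1,2) m3
  have to_n: "\<exists>e\<in>elts d. ap m p = ap n e" if "p \<in> elts Theta" for p using m(2) that by blast
  have to_m: "\<exists>p\<in>elts Theta. ap m p = ap n e" if "e \<in> elts d" for e using m(2) that by (metis image_iff)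
  define le where "le = sep (prod Theta Theta) (\<lambda>z. elts (ap m (snd' z)) \<subseteq> elts (ap m (fst' z)))"
  have le': "elts le = {z \<in> elts (prod Theta Theta). elts (ap m (snd' z)) \<subseteq> elts (ap m (fst' z))}"
    unfolding le_def by (rule elts_sep) (intro dfi)
  have le: "opair q p \<in> elts le \<longleftrightarrow> q \<in> elts Theta \<and> p \<in> elts Theta \<and> elts (ap m p) \<subseteq> elts (ap m q)" for p q
    unfolding le' by simp
  have "poset Theta le"
    unfolding poset_def
  proof (intro conjI allI ballI impI)
    fix z assume "z \<in> elts le"
    then show "\<exists>p\<in>elts Theta. \<exists>q\<in>elts Theta. z = opair p q" unfolding le' elts_prod by blast
  next
    fix p q assume "opair p q \<in> elts le \<and> opair q p \<in> elts le"
    then have "p \<in> elts Theta" "q \<in> elts Theta" "elts (ap m p) = elts (ap m q)" unfolding le by blast+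
    with m(3) show "p = q" by simp
  qed (unfold le, blast+)
  moreover have "splitting Theta le"
    unfolding splitting_def
  proof
    fix p assume p: "p \<in> elts Theta"
    then obtain e where e: "e \<in> elts d" "ap m p = ap n e" using to_n by blast
    obtain h0 where h0: "h0 \<in> elts d" "ap n h0 = ext zero (ap n e)" using exts[OF e(1), of zero] by blast
    obtain h1 where h1: "h1 \<in> elts d" "ap n h1 = ext (suc zero) (ap n e)" using exts[OF e(1), of "suc zero"] by blast
    obtain q where q: "q \<in> elts Theta" "ap m q = ext zero (ap n e)" using to_m[OF h0(1)] h0(2) by auto
    obtain r where r: "r \<in> elts Theta" "ap m r = ext (suc zero) (ap n e)" using to_m[OF h1(1)] h1(2) by auto
    have "\<not> (\<exists>t. opair t q \<in> elts le \<and> opair t r \<in> elts le)"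
    proof
      assume "\<exists>t. opair t q \<in> elts le \<and> opair t r \<in> elts le"
      then obtain t where t: "t \<in> elts Theta" "elts (ext zero (ap n e)) \<subseteq> elts (ap m t)"
        "elts (ext (suc zero) (ap n e)) \<subseteq> elts (ap m t)" unfolding le q(2) r(2) by blast
      obtain e' where "e' \<in> elts d" "ap m t = ap n e'" using to_n[OF t(1)] by blast
      with ext_incompatible[OF dn(3)] t(2,3) show False by metis
    qed
    moreover have "opair q p \<in> elts le" "opair r p \<in> elts le"
      unfolding le using p q r e(2) by (auto simp: elts_ext)
    ultimately show "\<exists>q\<in>elts Theta. \<exists>r\<in>elts Theta. opair q p \<in> elts le \<and> opair r p \<in> elts le \<and>
        \<not> (\<exists>t. opair t q \<in> elts le \<and> opair t r \<in> elts le)" using q(1) r(1) by blast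
  qed
  moreover have "distributive Theta le"
    unfolding distributive_def
  proof (intro allI impI ballI)
    fix b p
    assume b: "\<forall>x\<in>elts reals. (\<forall>p\<in>elts Theta. \<exists>q\<in>elts Theta. opair q p \<in> elts le \<and> opair q x \<in> elts b) \<and>
      (\<forall>p q. opair q p \<in> elts le \<longrightarrow> opair p x \<in> elts b \<longrightarrow> opair q x \<in> elts b)" and p: "p \<in> elts Theta"
    \<comment> \<open>The relation is moved along \<open>m\<close> from numbers of conditions to the
      conditions themselves, where the distributivity of the enumeration is stated.\<close>
    define b' where "b' = sep (prod T2 reals) (\<lambda>z. \<exists>q\<in>elts Theta. fst' z = ap m q \<and> opair q (snd' z) \<in> elts b)"
    have b': "elts b' = {z \<in> elts (prod T2 reals). \<exists>q\<in>elts Theta. fst' z = ap m q \<and> opair q (snd' z) \<in> elts b}"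
      unfolding b'_def by (rule elts_sep) (intro dfi)
    have mT: "ap m q \<in> elts T2" if "q \<in> elts Theta" for q using to_n[OF that] dn(3) by metis
    have b'_iff: "opair (ap m q) x \<in> elts b' \<longleftrightarrow> opair q x \<in> elts b" if q: "q \<in> elts Theta" and x: "x \<in> elts reals" for q x
    proof
      assume "opair (ap m q) x \<in> elts b'"
      then obtain q' where "q' \<in> elts Theta" "ap m q = ap m q'" "opair q' x \<in> elts b"
        unfolding b' mem_Collect_eq fst'_opair snd'_opair by blast
      with m3[OF q] show "opair q x \<in> elts b" by simp
    next
      assume "opair q x \<in> elts b"
      with q x mT[OF q] show "opair (ap m q) x \<in> elts b'"
        unfolding b' mem_Collect_eq fst'_opair snd'_opair opair_in_prod by blast
    qed
    obtain e where e: "e \<in> elts d" "ap m p = ap n e" using to_n[OF p] by blast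
    have "\<exists>h\<in>elts d. elts (ap n e) \<subseteq> elts (ap n h) \<and> (\<forall>x\<in>elts reals. opair (ap n h) x \<in> elts b')"
    proof (rule dist[OF _ e(1)])
      show "elts b' \<subseteq> elts (prod T2 reals)" unfolding b' by blast
      fix x e assume x: "x \<in> elts reals" and e: "e \<in> elts d"
      obtain p where p: "p \<in> elts Theta" "ap m p = ap n e" using to_m[OF e] by blast
      obtain q where q: "q \<in> elts Theta" "opair q p \<in> elts le" "opair q x \<in> elts b" using b x p(1) by blast
      obtain h where h: "h \<in> elts d" "ap m q = ap n h" using to_n[OF q(1)] by blast
      from q(2) have "elts (ap n e) \<subseteq> elts (ap n h)" unfolding le p(2) h(2) by blast
      moreover have "opair (ap n h) x \<in> elts b'" using b'_iff[OF q(1) x] q(3) h(2) by simp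
      ultimately show "\<exists>h\<in>elts d. elts (ap n e) \<subseteq> elts (ap n h) \<and> opair (ap n h) x \<in> elts b'" using h(1) by blast
    next
      fix x e h
      assume x: "x \<in> elts reals" and e: "e \<in> elts d" and h: "h \<in> elts d"
        and sub: "elts (ap n e) \<subseteq> elts (ap n h)" and xb: "opair (ap n e) x \<in> elts b'"
      obtain p where p: "p \<in> elts Theta" "ap m p = ap n e" using to_m[OF e] by blast
      obtain q where q: "q \<in> elts Theta" "ap m q = ap n h" using to_m[OF h] by blast
      have "opair p x \<in> elts b" using b'_iff[OF p(1) x] xb p(2) by simp
      moreover have "opair q p \<in> elts le" unfolding le p(2) q(2) using p(1) q(1) sub by blast
      ultimately have "opair q x \<in> elts b" using b x by blast
      then show "opair (ap n h) x \<in> elts b'" using b'_iff[OF q(1) x] q(2) by simp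
    qed
    then obtain h where h: "h \<in> elts d" "elts (ap n e) \<subseteq> elts (ap n h)" "\<forall>x\<in>elts reals. opair (ap n h) x \<in> elts b'" by blast
    obtain q where q: "q \<in> elts Theta" "ap m q = ap n h" using to_m[OF h(1)] by blast
    have "opair q p \<in> elts le" unfolding le q(2) e(2) using h(2) p q(1) by blast
    moreover have "opair q x \<in> elts b" if "x \<in> elts reals" for x
      using b'_iff[OF q(1) that] h(3) that unfolding q(2) by blast
    ultimately show "\<exists>q\<in>elts Theta. opair q p \<in> elts le \<and> (\<forall>x\<in>elts reals. opair q x \<in> elts b)" using q(1) by blast
  qed
  ultimately show ?case by blast
qed

section \<open>Forcing\<close>

text \<open>
  \<open>e\<close> consists of the triples \<open>(\<sigma>, (y, p))\<close> such that \<open>p\<close> forces the value of the name \<open>\<sigma>\<close> to be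
  the ground model set \<open>y\<close>. Only this part of the forcing relation is needed, and since it occurs
  positively in its own recursive clause, it can be obtained as a greatest fixed point.
\<close>
definition fstep :: "'a \<Rightarrow> 'a \<Rightarrow> 'a \<Rightarrow> bool" where
  "fstep le e t \<longleftrightarrow>
     (\<forall>u r q. opair u r \<in> elts (fst' t) \<longrightarrow> opair q (snd' (snd' t)) \<in> elts le \<longrightarrow> opair q r \<in> elts le \<longrightarrow>
        (\<exists>q'. opair q' q \<in> elts le \<and> (\<exists>z\<in>elts (fst' (snd' t)). opair u (opair z q') \<in> elts e))) \<and>
     (\<forall>z\<in>elts (fst' (snd' t)). \<forall>q. opair q (snd' (snd' t)) \<in> elts le \<longrightarrow>
        (\<exists>q'. opair q' q \<in> elts le \<and> (\<exists>u r. opair u r \<in> elts (fst' t) \<and> opair q' r \<in> elts le \<and>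
           opair u (opair z q') \<in> elts e)))"

lemma dfn_fstep [dfi]: "dft t \<Longrightarrow> dft u \<Longrightarrow> dft v \<Longrightarrow> dfn (\<lambda>s. fstep (t s) (u s) (v s))"
  by (rule dfn_comp3[of fstep]) (simp_all only: fstep_def, intro dfi)

lemma fstep_mono: "fstep le e t \<Longrightarrow> elts e \<subseteq> elts W \<Longrightarrow> fstep le W t"
  unfolding fstep_def by (meson subsetD)

text \<open>Knaster-Tarski inside the set \<open>B\<close>: unite all \<open>W\<close> whose members
  satisfy \<open>fstep le W\<close>. By monotonicity the triples accepted by
  \<open>fstep le e\<close> form such a set again. \<open>truth\<close> recovers the meaning of
  \<open>e\<close> from this equation by induction on names.\<close>

lemma forcing_relation:
  "\<exists>e. \<forall>t\<in>elts B. t \<in> elts e \<longleftrightarrow> fstep le e t"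
proof -
  define e where "e = sep B (\<lambda>t. \<exists>W. elts W \<subseteq> elts B \<and> (\<forall>t\<in>elts W. fstep le W t) \<and> t \<in> elts W)"
  have e: "elts e = {t \<in> elts B. \<exists>W. elts W \<subseteq> elts B \<and> (\<forall>t\<in>elts W. fstep le W t) \<and> t \<in> elts W}"
    unfolding e_def by (rule elts_sep) (intro dfi)
  have e_step: "fstep le e t" if t: "t \<in> elts e" for t
  proof -
    obtain W where W: "elts W \<subseteq> elts B" "\<forall>t\<in>elts W. fstep le W t" "t \<in> elts W" using t unfolding e by blast
    have "elts W \<subseteq> elts e" unfolding e using W(1,2) by blast
    moreover have "fstep le W t" using W(2,3) by blast
    ultimately show ?thesis by (rule fstep_mono[rotated])
  qed
  define V where "V = sep B (fstep le e)"
  have V: "elts V = {t \<in> elts B. fstep le e t}"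
    unfolding V_def by (rule elts_sep) (intro dfi)
  have eV: "elts e \<subseteq> elts V" unfolding V using e_step e by blast
  have "\<forall>t\<in>elts V. fstep le V t"
    using fstep_mono[OF _ eV] unfolding V by blast
  moreover have "elts V \<subseteq> elts B" unfolding V by blast
  ultimately have "t \<in> elts e" if "t \<in> elts V" for t unfolding e using that by blast
  then have "\<forall>t\<in>elts B. t \<in> elts e \<longleftrightarrow> fstep le e t" using e_step unfolding V by blast
  then show ?thesis by blast
qed

lemma omega_unique:
  assumes "limit_ordinal w" "\<And>n. n \<in> elts w \<Longrightarrow> \<not> limit_ordinal n"
  shows "w = omega"
proof -
  have nl: "\<not> limit_ordinal n" if "n \<in> elts omega" for n
  proof
    assume l: "limit_ordinal n"
    from omega_cases[OF that] show False
    proof (elim disjE bexE)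
      assume "n = zero" with l show False unfolding limit_ordinal_def by simp
    next
      fix k assume "n = suc k"
      with l have "suc k \<in> elts (suc k)" unfolding limit_ordinal_def by simp
      then show False using mem_irrefl by blast
    qed
  qed
  have "ordinal w" using assms(1) unfolding limit_ordinal_def by blast
  from ord_linear[OF this ordinal_omega] assms nl omega_natural show ?thesis by blast
qed

lemma transitive_opair:
  "transitive d \<Longrightarrow> v \<in> elts d \<Longrightarrow> opair u r \<in> elts v \<Longrightarrow> u \<in> elts d"
  unfolding transitive_def opair_upair using elts_upair by blast

end

section \<open>Absoluteness along the embedding of the ground model\<close>

locale transitive_embedding = E: zf E + F: zf F for E F :: "'a \<Rightarrow> 'a \<Rightarrow> bool" +
  fixes j :: "'a \<Rightarrow> 'a"
  assumes inj_j: "inj j" and elts_j: "F.elts (j x) = j ` E.elts x"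
begin

lemma j_eq [simp]: "j x = j y \<longleftrightarrow> x = y"
  using inj_j by (rule inj_eq)

lemma j_mem [simp]: "j x \<in> F.elts (j y) \<longleftrightarrow> x \<in> E.elts y"
  unfolding elts_j by (simp add: inj_image_mem_iff inj_j)

lemma j_zero: "F.zero = j E.zero"
  by (rule F.elts_eqI) (simp add: elts_j)

lemma j_upair: "F.upair (j a) (j b) = j (E.upair a b)"
  by (rule F.elts_eqI) (auto simp: elts_j)

lemma j_opair: "F.opair (j a) (j b) = j (E.opair a b)"
  unfolding F.opair_upair E.opair_upair j_upair ..

lemma j_suc: "F.suc (j a) = j (E.suc a)"
  by (rule F.elts_eqI) (auto simp: elts_j)

text \<open>The range of \<open>j\<close> is a transitive class, so a pair in it has both
  coordinates in it.\<close>

lemma opair_in_range: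
  assumes "F.opair u v = j p"
  obtains u' v' where "u = j u'" "v = j v'" "p = E.opair u' v'"
proof -
  have "F.upair u v \<in> F.elts (j p)" using assms unfolding F.opair_upair by (metis F.elts_upair insertCI)
  then obtain w where "F.upair u v = j w" unfolding elts_j by blast
  then have "{u, v} = j ` E.elts w" using F.elts_upair elts_j by metis
  then obtain u' v' where uv: "u = j u'" "v = j v'" by (metis imageE insertCI)
  with assms have "p = E.opair u' v'" by (simp add: j_opair)
  with uv that show thesis by blast
qed

lemma opair_mem_j:
  assumes "F.opair u v \<in> F.elts (j f)"
  obtains u' v' where "u = j u'" "v = j v'" "E.opair u' v' \<in> E.elts f"
proof -
  from assms obtain p where p: "p \<in> E.elts f" "F.opair u v = j p" unfolding elts_j by blast
  from opair_in_range[OF p(2)] p(1) that show thesis by metis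
qed

lemma opair_j_mem [simp]: "F.opair (j u) (j v) \<in> F.elts (j f) \<longleftrightarrow> E.opair u v \<in> E.elts f"
  by (simp add: j_opair)

lemma j_transitive: "F.transitive (j x) \<longleftrightarrow> E.transitive x"
  unfolding F.transitive_def E.transitive_def by (simp add: elts_j inj_image_subset_iff inj_j)

lemma j_ordinal: "F.ordinal (j x) \<longleftrightarrow> E.ordinal x"
  unfolding F.ordinal_def E.ordinal_def by (auto simp: elts_j j_transitive)

lemma j_limit_ordinal: "F.limit_ordinal (j x) \<longleftrightarrow> E.limit_ordinal x"
  unfolding F.limit_ordinal_def E.limit_ordinal_def j_ordinal by (auto simp: elts_j j_suc)

lemma j_omega: "F.omega = j E.omega"
proof (rule F.omega_unique[symmetric])
  show "F.limit_ordinal (j E.omega)" unfolding j_limit_ordinal using E.omega_natural by blast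
  fix n assume "n \<in> F.elts (j E.omega)"
  then obtain k where k: "k \<in> E.elts E.omega" "n = j k" unfolding elts_j by blast
  have "\<not> E.limit_ordinal k"
  proof
    assume l: "E.limit_ordinal k"
    from E.omega_cases[OF k(1)] show False
    proof (elim disjE bexE)
      assume "k = E.zero" with l show False unfolding E.limit_ordinal_def by simp
    next
      fix i assume "k = E.suc i"
      with l have "E.suc i \<in> E.elts (E.suc i)" unfolding E.limit_ordinal_def by simp
      then show False using E.mem_irrefl by blast
    qed
  qed
  then show "\<not> F.limit_ordinal n" unfolding k(2) j_limit_ordinal .
qed

lemma j_fun_on: "E.fun_on f a \<Longrightarrow> F.fun_on (j f) (j a)"
proof (rule F.fun_onI[where F = "\<lambda>x. j (E.ap f (inv j x))"])
  assume f: "E.fun_on f a"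
  show "\<exists>x y. x \<in> F.elts (j a) \<and> p = F.opair x y" if "p \<in> F.elts (j f)" for p
    using that unfolding elts_j E.fun_on_elts[OF f] by (auto simp: j_opair[symmetric])
  show "F.opair x (j (E.ap f (inv j x))) \<in> F.elts (j f)" if "x \<in> F.elts (j a)" for x
    using that by (auto simp: elts_j[of a] inj_j E.fun_on_pair_iff[OF f])
  show "y = j (E.ap f (inv j x))" if "x \<in> F.elts (j a)" "F.opair x y \<in> F.elts (j f)" for x y
    using opair_mem_j[OF that(2)] E.fun_on_pair_iff[OF f] inj_j by (metis inv_f_f)
qed

lemma j_ap: "E.fun_on f a \<Longrightarrow> x \<in> E.elts a \<Longrightarrow> F.ap (j f) (j x) = j (E.ap f x)"
  by (rule F.ap_eq[OF _ j_fun_on]) (simp_all add: E.fun_on_pair_iff)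

lemma j_maps: "E.maps f a b \<Longrightarrow> F.maps (j f) (j a) (j b)"
  unfolding E.maps_iff F.maps_iff using j_fun_on j_ap by (auto simp: elts_j)

lemma maps_j: "F.maps (j f) (j a) (j b) \<Longrightarrow> E.maps f a b"
proof -
  assume m: "F.maps (j f) (j a) (j b)"
  then have f: "F.fun_on (j f) (j a)" and b: "\<And>x. x \<in> F.elts (j a) \<Longrightarrow> F.ap (j f) x \<in> F.elts (j b)"
    unfolding F.maps_iff by blast+
  have p: "E.opair x y \<in> E.elts f \<longleftrightarrow> x \<in> E.elts a \<and> j y = F.ap (j f) (j x)" for x y
    using F.fun_on_pair_iff[OF f, of "j x" "j y"] by simp
  have val: "\<exists>y\<in>E.elts b. F.ap (j f) (j x) = j y" if "x \<in> E.elts a" for x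
    using b[of "j x"] that unfolding elts_j[of b] by auto
  have fo: "E.fun_on f a"
    unfolding E.fun_on_def
  proof (intro conjI ballI)
    fix q assume "q \<in> E.elts f"
    then have "j q \<in> F.elts (j f)" by simp
    then obtain x where x: "x \<in> F.elts (j a)" "j q = F.opair x (F.ap (j f) x)"
      unfolding F.fun_on_elts[OF f] by blast
    obtain u v where uv: "x = j u" "q = E.opair u v" using opair_in_range[OF x(2)[symmetric]] by metis
    with x(1) show "\<exists>x\<in>E.elts a. \<exists>y. q = E.opair x y" by auto
  next
    fix x assume x: "x \<in> E.elts a"
    then obtain y where "F.ap (j f) (j x) = j y" using val by blast
    then show "\<exists>!y. E.opair x y \<in> E.elts f" unfolding p using x by auto
  qed
  moreover have "E.ap f x \<in> E.elts b" if x: "x \<in> E.elts a" for x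
    using j_ap[OF fo x] val[OF x] by auto
  ultimately show ?thesis unfolding E.maps_iff by blast
qed

lemma j_restr: "F.restr (j f) (j a) = j (E.restr f a)"
proof (rule F.elts_eqI)
  fix p
  show "p \<in> F.elts (F.restr (j f) (j a)) \<longleftrightarrow> p \<in> F.elts (j (E.restr f a))"
  proof
    assume "p \<in> F.elts (F.restr (j f) (j a))"
    then obtain x y where p: "F.opair x y \<in> F.elts (j f)" "x \<in> F.elts (j a)" "p = F.opair x y"
      unfolding F.elts_restr by blast
    from opair_mem_j[OF p(1)] obtain u v where uv: "x = j u" "y = j v" "E.opair u v \<in> E.elts f" by metis
    with p(2) have "E.opair u v \<in> E.elts (E.restr f a)" unfolding E.elts_restr by auto
    then show "p \<in> F.elts (j (E.restr f a))" unfolding p(3) uv(1,2) by simp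
  next
    assume "p \<in> F.elts (j (E.restr f a))"
    then obtain x y where p: "E.opair x y \<in> E.elts f" "x \<in> E.elts a" "p = j (E.opair x y)"
      unfolding elts_j E.elts_restr by blast
    then show "p \<in> F.elts (F.restr (j f) (j a))"
      unfolding F.elts_restr by (auto simp: j_opair[symmetric])
  qed
qed

lemma j_prod: "F.prod (j a) (j b) = j (E.prod a b)"
proof (rule F.elts_eqI)
  fix p
  show "p \<in> F.elts (F.prod (j a) (j b)) \<longleftrightarrow> p \<in> F.elts (j (E.prod a b))"
  proof
    assume "p \<in> F.elts (F.prod (j a) (j b))"
    then obtain x y where "x \<in> E.elts a" "y \<in> E.elts b" "p = F.opair (j x) (j y)"
      unfolding F.elts_prod elts_j by blast
    then show "p \<in> F.elts (j (E.prod a b))" by (simp add: j_opair)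
  next
    assume "p \<in> F.elts (j (E.prod a b))"
    then obtain x y where "x \<in> E.elts a" "y \<in> E.elts b" "p = j (E.opair x y)"
      unfolding E.elts_prod elts_j by blast
    then show "p \<in> F.elts (F.prod (j a) (j b))" by (simp add: j_opair[symmetric])
  qed
qed

end

section \<open>Generic filters, the truth lemma and subsets of small sets in the extension\<close>

text \<open>The generic extension; \<open>g\<close> is the filter \<open>G\<close> as a set of the extension.\<close>
locale forcing_extension = transitive_embedding E F j for E F :: "'a \<Rightarrow> 'a \<Rightarrow> bool" and j +
  fixes P le :: 'a and G :: "'a set" and g :: 'a
  assumes poset: "E.poset P le" and generic: "E.generic_filter P le G"
    and elts_g: "F.elts g = j ` G" and names: "\<exists>t. F.name_value g (j t) x"
begin

abbreviation leq :: "'a \<Rightarrow> 'a \<Rightarrow> bool" where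
  "leq q p \<equiv> E.opair q p \<in> E.elts le"

lemma leq_P: "leq q p \<Longrightarrow> q \<in> E.elts P \<and> p \<in> E.elts P"
  using poset unfolding E.poset_def by (metis E.opair_inject)

lemma leq_refl: "p \<in> E.elts P \<Longrightarrow> leq p p"
  using poset unfolding E.poset_def by blast

lemma leq_trans: "leq p q \<Longrightarrow> leq q r \<Longrightarrow> leq p r"
  using poset unfolding E.poset_def by blast

lemma G_P: "p \<in> G \<Longrightarrow> p \<in> E.elts P"
  using generic unfolding E.generic_filter_def by blast

lemma G_up: "p \<in> G \<Longrightarrow> leq p q \<Longrightarrow> q \<in> G"
  using generic unfolding E.generic_filter_def by blast

lemma G_directed: "p \<in> G \<Longrightarrow> q \<in> G \<Longrightarrow> \<exists>r\<in>G. leq r p \<and> leq r q"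
  using generic unfolding E.generic_filter_def by blast

text \<open>Genericity concerns dense sets of the ground model; definability of \<open>D\<close> in
  \<open>E\<close> makes the set of its conditions one of them.\<close>

lemma G_dense:
  assumes D: "E.dfn (\<lambda>s. D (s 0))" and "\<And>p. p \<in> E.elts P \<Longrightarrow> \<exists>q. leq q p \<and> D q"
  shows "\<exists>q\<in>G. D q"
proof -
  have S: "E.elts (E.sep P D) = {q \<in> E.elts P. D q}" by (rule E.elts_sep[OF D])
  have "E.dense P le (E.sep P D)"
    unfolding E.dense_def S using assms(2) leq_P by blast
  then have "G \<inter> E.elts (E.sep P D) \<noteq> {}" using generic unfolding E.generic_filter_def by blast
  then show ?thesis unfolding S by blast
qed

text \<open>Adding the conditions incompatible with \<open>p\<close> makes the set dense everywhere,
  and no such condition can share the filter with \<open>p\<close>.\<close>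

lemma G_dense_below:
  assumes D: "E.dfn (\<lambda>s. D (s 0))" and p: "p \<in> G" and dense: "\<And>q. leq q p \<Longrightarrow> \<exists>q'. leq q' q \<and> D q'"
  shows "\<exists>q\<in>G. D q"
proof -
  have "\<exists>q\<in>G. D q \<or> \<not> (\<exists>t. leq t q \<and> leq t p)"
  proof (rule G_dense)
    show "E.dfn (\<lambda>s. D (s 0) \<or> \<not> (\<exists>t. leq t (s 0) \<and> leq t p))" by (intro dfi D)
    fix q assume q: "q \<in> E.elts P"
    show "\<exists>q'. leq q' q \<and> (D q' \<or> \<not> (\<exists>t. leq t q' \<and> leq t p))"
    proof (cases "\<exists>t. leq t q \<and> leq t p")
      case True
      then obtain t where t: "leq t q" "leq t p" by blast
      from dense[OF t(2)] obtain q' where "leq q' t" "D q'" by blast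
      with leq_trans t(1) show ?thesis by blast
    next
      case False
      with leq_refl[OF q] show ?thesis by blast
    qed
  qed
  with G_directed[OF p] show ?thesis by blast
qed

text \<open>Were \<open>G\<close> a ground model set, the conditions outside it would be dense: of
  two incompatible extensions, at most one belongs to the filter.\<close>

lemma new_set:
  assumes "E.splitting P le"
  shows "g \<notin> range j"
proof
  assume "g \<in> range j"
  then obtain x where "g = j x" by blast
  then have x: "E.elts x = G" using elts_g inj_j unfolding elts_j by (metis elts_j inj_image_eq_iff)
  have "\<exists>q\<in>G. q \<notin> E.elts x"
  proof (rule G_dense)
    show "E.dfn (\<lambda>s. s 0 \<notin> E.elts x)" by (intro dfi)
    fix p assume "p \<in> E.elts P"
    then obtain q r where qr: "leq q p" "leq r p" "\<not> (\<exists>t. leq t q \<and> leq t r)"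
      using assms unfolding E.splitting_def by blast
    then have "\<not> (q \<in> G \<and> r \<in> G)" using G_directed by blast
    with qr x show "\<exists>q. leq q p \<and> q \<notin> E.elts x" by blast
  qed
  with x show False by blast
qed

text \<open>The truth lemma for one name \<open>\<sigma>\<close>, assuming it for the names
  \<open>u\<close> that occur in it. A condition forces the equation with \<open>y\<close> exactly
  if no extension is an obstruction in one of two ways, one for each inclusion.\<close>

lemma truth_step:
  assumes forces: "\<And>y p. y \<in> E.elts Y \<Longrightarrow> p \<in> E.elts P \<Longrightarrow>
      E.opair \<sigma> (E.opair y p) \<in> E.elts e \<longleftrightarrow> E.fstep le e (E.opair \<sigma> (E.opair y p))"
    and down: "\<And>u r z p q. E.opair u r \<in> E.elts \<sigma> \<Longrightarrow> z \<in> E.elts Y \<Longrightarrow> leq q p \<Longrightarrow>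
      E.opair u (E.opair z p) \<in> E.elts e \<Longrightarrow> E.opair u (E.opair z q) \<in> E.elts e"
    and Y: "E.transitive Y" and y: "y \<in> E.elts Y"
    and val: "F.elts v = {H u | u. \<exists>r\<in>G. E.opair u r \<in> E.elts \<sigma>}"
    and IH: "\<And>u r z. E.opair u r \<in> E.elts \<sigma> \<Longrightarrow> z \<in> E.elts Y \<Longrightarrow>
      H u = j z \<longleftrightarrow> (\<exists>p\<in>G. E.opair u (E.opair z p) \<in> E.elts e)"
  shows "v = j y \<longleftrightarrow> (\<exists>p\<in>G. E.opair \<sigma> (E.opair y p) \<in> E.elts e)"
proof -
  have zY: "z \<in> E.elts Y" if "z \<in> E.elts y" for z using Y y that unfolding E.transitive_def by blast
  \<comment> \<open>\<open>bad1\<close>: \<open>q\<close> puts the value of some \<open>u\<close>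
    into \<open>\<sigma>\<close> while no extension places it in \<open>y\<close>.
    \<open>bad2\<close>: some \<open>z\<close> in \<open>y\<close> is put into
    \<open>\<sigma>\<close> by no extension.\<close>
  define bad1 where "bad1 q \<longleftrightarrow> (\<exists>u r. E.opair u r \<in> E.elts \<sigma> \<and> leq q r \<and>
      \<not> (\<exists>q'. leq q' q \<and> (\<exists>z\<in>E.elts y. E.opair u (E.opair z q') \<in> E.elts e)))" for q
  define bad2 where "bad2 q \<longleftrightarrow> (\<exists>z\<in>E.elts y. \<not> (\<exists>q'. leq q' q \<and> (\<exists>u r. E.opair u r \<in> E.elts \<sigma> \<and> leq q' r \<and>
      E.opair u (E.opair z q') \<in> E.elts e)))" for q
  have step: "E.fstep le e (E.opair \<sigma> (E.opair y p)) \<longleftrightarrow> (\<forall>q. leq q p \<longrightarrow> \<not> bad1 q \<and> \<not> bad2 q)" for p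
    unfolding E.fstep_def bad1_def bad2_def E.fst'_opair E.snd'_opair by blast
  show ?thesis
  proof
    assume v: "v = j y"
    \<comment> \<open>If no extension of \<open>p\<close> is an obstruction, \<open>p\<close> itself
      forces the equation. So some member of the filter forces it or is an obstruction, and the
      latter contradicts \<open>v = j y\<close>.\<close>
    have "\<exists>q\<in>G. E.opair \<sigma> (E.opair y q) \<in> E.elts e \<or> bad1 q \<or> bad2 q"
    proof (rule G_dense)
      show "E.dfn (\<lambda>s. E.opair \<sigma> (E.opair y (s 0)) \<in> E.elts e \<or> bad1 (s 0) \<or> bad2 (s 0))"
        unfolding bad1_def bad2_def by (intro dfi)
      fix p assume p: "p \<in> E.elts P"
      show "\<exists>q. leq q p \<and> (E.opair \<sigma> (E.opair y q) \<in> E.elts e \<or> bad1 q \<or> bad2 q)"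
      proof (cases "\<exists>q. leq q p \<and> (bad1 q \<or> bad2 q)")
        case False
        with forces[OF y p] step have "E.opair \<sigma> (E.opair y p) \<in> E.elts e" by blast
        with leq_refl[OF p] show ?thesis by blast
      qed blast
    qed
    then obtain q where q: "q \<in> G" "E.opair \<sigma> (E.opair y q) \<in> E.elts e \<or> bad1 q \<or> bad2 q" by blast
    have "\<not> bad1 q"
    proof
      assume "bad1 q"
      then obtain u r where ur: "E.opair u r \<in> E.elts \<sigma>" "leq q r"
        "\<not> (\<exists>q'. leq q' q \<and> (\<exists>z\<in>E.elts y. E.opair u (E.opair z q') \<in> E.elts e))" unfolding bad1_def by blast
      have "H u \<in> F.elts v" unfolding val using ur(1) G_up[OF q(1) ur(2)] by blast
      then obtain z where z: "z \<in> E.elts y" "H u = j z" unfolding v elts_j by blast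
      then obtain p' where p': "p' \<in> G" "E.opair u (E.opair z p') \<in> E.elts e"
        using IH[OF ur(1) zY[OF z(1)]] by blast
      obtain q' where q': "leq q' q" "leq q' p'" using G_directed[OF q(1) p'(1)] by blast
      with down[OF ur(1) zY[OF z(1)] q'(2) p'(2)] ur(3) z(1) show False by blast
    qed
    moreover have "\<not> bad2 q"
    proof
      assume "bad2 q"
      then obtain z where z: "z \<in> E.elts y" "\<not> (\<exists>q'. leq q' q \<and> (\<exists>u r. E.opair u r \<in> E.elts \<sigma> \<and> leq q' r \<and>
        E.opair u (E.opair z q') \<in> E.elts e))" unfolding bad2_def by blast
      have "j z \<in> F.elts v" unfolding v using z(1) by simp
      then obtain u r where ur: "r \<in> G" "E.opair u r \<in> E.elts \<sigma>" "H u = j z" unfolding val by auto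
      obtain p' where p': "p' \<in> G" "E.opair u (E.opair z p') \<in> E.elts e"
        using IH[OF ur(2) zY[OF z(1)]] ur(3) by blast
      obtain q1 where q1: "q1 \<in> G" "leq q1 q" "leq q1 p'" using G_directed[OF q(1) p'(1)] by blast
      obtain q2 where q2: "leq q2 q1" "leq q2 r" using G_directed[OF q1(1) ur(1)] by blast
      have "leq q2 q" "leq q2 p'" using leq_trans[OF q2(1)] q1 by blast+
      with down[OF ur(2) zY[OF z(1)] _ p'(2)] z(2) ur(2) q2(2) show False by blast
    qed
    ultimately show "\<exists>p\<in>G. E.opair \<sigma> (E.opair y p) \<in> E.elts e" using q by blast
  next
    assume "\<exists>p\<in>G. E.opair \<sigma> (E.opair y p) \<in> E.elts e"
    then obtain p where p: "p \<in> G" "E.opair \<sigma> (E.opair y p) \<in> E.elts e" by blast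
    have good: "\<not> bad1 q \<and> \<not> bad2 q" if "leq q p" for q
      using forces[OF y G_P[OF p(1)]] p(2) step that by blast
    show "v = j y"
    proof (rule F.elts_eqI)
      fix w
      show "w \<in> F.elts v \<longleftrightarrow> w \<in> F.elts (j y)"
      proof
        assume "w \<in> F.elts v"
        then obtain u r where ur: "r \<in> G" "E.opair u r \<in> E.elts \<sigma>" "w = H u" unfolding val by blast
        obtain q where q: "q \<in> G" "leq q p" "leq q r" using G_directed[OF p(1) ur(1)] by blast
        have "\<exists>q'\<in>G. \<exists>z\<in>E.elts y. E.opair u (E.opair z q') \<in> E.elts e"
        proof (rule G_dense_below[OF _ q(1)])
          show "E.dfn (\<lambda>s. \<exists>z\<in>E.elts y. E.opair u (E.opair z (s 0)) \<in> E.elts e)" by (intro dfi)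
          fix q' assume q': "leq q' q"
          have "\<not> bad1 q'" using good leq_trans[OF q' q(2)] by blast
          with ur(2) leq_trans[OF q' q(3)]
          show "\<exists>q''. leq q'' q' \<and> (\<exists>z\<in>E.elts y. E.opair u (E.opair z q'') \<in> E.elts e)"
            unfolding bad1_def by blast
        qed
        then obtain z where "z \<in> E.elts y" "H u = j z" using IH[OF ur(2)] zY by blast
        with ur(3) show "w \<in> F.elts (j y)" by simp
      next
        assume "w \<in> F.elts (j y)"
        then obtain z where z: "z \<in> E.elts y" "w = j z" unfolding elts_j by blast
        have "\<exists>q\<in>G. \<exists>u r. E.opair u r \<in> E.elts \<sigma> \<and> leq q r \<and> E.opair u (E.opair z q) \<in> E.elts e"
        proof (rule G_dense_below[OF _ p(1)])
          show "E.dfn (\<lambda>s. \<exists>u r. E.opair u r \<in> E.elts \<sigma> \<and> leq (s 0) r \<and> E.opair u (E.opair z (s 0)) \<in> E.elts e)"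
            by (intro dfi)
          fix q assume "leq q p"
          then have "\<not> bad2 q" using good by blast
          with z(1) show "\<exists>q'. leq q' q \<and> (\<exists>u r. E.opair u r \<in> E.elts \<sigma> \<and> leq q' r \<and> E.opair u (E.opair z q') \<in> E.elts e)"
            unfolding bad2_def by blast
        qed
        then obtain q u r where q: "q \<in> G" "E.opair u r \<in> E.elts \<sigma>" "leq q r" "E.opair u (E.opair z q) \<in> E.elts e"
          by blast
        have "H u = j z" using IH[OF q(2) zY[OF z(1)]] q(1,4) by blast
        then show "w \<in> F.elts v" unfolding val z(2) using q(2) G_up[OF q(1,3)] by force
      qed
    qed
  qed
qed


lemma fstep_down: "E.fstep le e (E.opair s (E.opair y p)) \<Longrightarrow> leq q p \<Longrightarrow> E.fstep le e (E.opair s (E.opair y q))"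
proof -
  assume f: "E.fstep le e (E.opair s (E.opair y p))" and qp: "leq q p"
  have up: "leq r p" if "leq r q" for r using leq_trans[OF that qp] .
  note f' = f[unfolded E.fstep_def E.fst'_opair E.snd'_opair]
  show ?thesis
    unfolding E.fstep_def E.fst'_opair E.snd'_opair
  proof (intro conjI allI impI ballI)
    fix u r q' assume "E.opair u r \<in> E.elts s" "leq q' q" "leq q' r"
    with conjunct1[OF f'] up show "\<exists>q''. leq q'' q' \<and> (\<exists>z\<in>E.elts y. E.opair u (E.opair z q'') \<in> E.elts e)"
      by meson
  next
    fix z q' assume "z \<in> E.elts y" "leq q' q"
    with conjunct2[OF f'] up show "\<exists>q''. leq q'' q' \<and> (\<exists>u r. E.opair u r \<in> E.elts s \<and> leq q'' r \<and>
        E.opair u (E.opair z q'') \<in> E.elts e)"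
      by meson
  qed
qed

text \<open>The induction on names takes place in \<open>F\<close>, since the evaluation
  \<open>h\<close> exists only there; the forcing relation is carried over by
  \<open>j\<close>.\<close>

lemma truth:
  assumes dE: "E.transitive dE" and Y: "E.transitive Y"
    and e: "\<forall>t\<in>E.elts (E.prod dE (E.prod Y P)). t \<in> E.elts e \<longleftrightarrow> E.fstep le e t"
    and d: "F.transitive d" and h: "F.fun_on h d"
    and val: "\<forall>v\<in>F.elts d. F.elts (F.app h v) = {F.app h u | u. \<exists>p\<in>F.elts g. F.opair u p \<in> F.elts v}"
    and s: "s \<in> E.elts dE" "j s \<in> F.elts d" and y: "y \<in> E.elts Y"
  shows "F.ap h (j s) = j y \<longleftrightarrow> (\<exists>p\<in>G. E.opair s (E.opair y p) \<in> E.elts e)"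
proof -
  \<comment> \<open>The claim is phrased with \<open>j Y\<close>, \<open>j e\<close> and
    \<open>g\<close> as parameters, which makes it definable in \<open>F\<close> and thus open to
    induction there.\<close>
  define Q where "Q t \<longleftrightarrow> (t \<in> F.elts d \<longrightarrow> (\<forall>y\<in>F.elts (j Y). F.ap h t = y \<longleftrightarrow>
    (\<exists>p\<in>F.elts g. F.opair t (F.opair y p) \<in> F.elts (j e))))" for t
  have dQ: "F.dft t \<Longrightarrow> F.dfn (\<lambda>s. Q (t s))" for t
    by (rule F.dfn_comp1[of Q]) (simp_all only: Q_def, intro dfi)
  have conv: "(\<exists>p\<in>F.elts g. F.opair (j u) (F.opair (j z) p) \<in> F.elts (j e)) \<longleftrightarrow>
      (\<exists>p\<in>G. E.opair u (E.opair z p) \<in> E.elts e)" for u z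
    by (simp add: elts_g j_opair)
  have Q_j: "Q (j u) \<longleftrightarrow> (j u \<in> F.elts d \<longrightarrow> (\<forall>z\<in>E.elts Y. F.ap h (j u) = j z \<longleftrightarrow>
      (\<exists>p\<in>G. E.opair u (E.opair z p) \<in> E.elts e)))" for u
    unfolding Q_def elts_j[of Y] ball_simps conv ..
  have app_h: "F.app h v = F.ap h v" if "v \<in> F.elts d" for v using F.app_eq_ap[OF h that] .
  have main: "Q (j s)" if s: "s \<in> E.elts dE" and IH: "\<And>u r. E.opair u r \<in> E.elts s \<Longrightarrow> Q (j u)" for s
    unfolding Q_j
  proof (intro impI ballI)
    fix y assume sd: "j s \<in> F.elts d" and y: "y \<in> E.elts Y"
    have ud: "j u \<in> F.elts d" if "E.opair u r \<in> E.elts s" for u r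
      by (rule F.transitive_opair[OF d sd, of _ "j r"]) (simp add: that)
    have udE: "u \<in> E.elts dE" if "E.opair u r \<in> E.elts s" for u r
      by (rule E.transitive_opair[OF dE s that])
    have forces: "E.opair u (E.opair z p) \<in> E.elts e \<longleftrightarrow> E.fstep le e (E.opair u (E.opair z p))"
      if "u \<in> E.elts dE" "z \<in> E.elts Y" "p \<in> E.elts P" for u z p
      by (rule e[rule_format]) (simp add: that)
    show "F.ap h (j s) = j y \<longleftrightarrow> (\<exists>p\<in>G. E.opair s (E.opair y p) \<in> E.elts e)"
    proof (rule truth_step[where H = "\<lambda>u. F.ap h (j u)", OF _ _ Y y])
      show "E.opair s (E.opair y p) \<in> E.elts e \<longleftrightarrow> E.fstep le e (E.opair s (E.opair y p))"
        if "y \<in> E.elts Y" "p \<in> E.elts P" for y p using forces[OF s that] .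
      show "E.opair u (E.opair z q) \<in> E.elts e"
        if ur: "E.opair u r \<in> E.elts s" and z: "z \<in> E.elts Y" and qp: "leq q p" and up: "E.opair u (E.opair z p) \<in> E.elts e"
        for u r z p q
        using forces[OF udE[OF ur] z] leq_P[OF qp] up fstep_down[OF _ qp] by blast
      show "F.elts (F.ap h (j s)) = {F.ap h (j u) | u. \<exists>r\<in>G. E.opair u r \<in> E.elts s}"
      proof -
        have "F.elts (F.ap h (j s)) = {F.app h u | u. \<exists>p\<in>F.elts g. F.opair u p \<in> F.elts (j s)}"
          using bspec[OF val sd] unfolding app_h[OF sd] .
        also have "\<dots> = {F.ap h (j u) | u. \<exists>r\<in>G. E.opair u r \<in> E.elts s}"
        proof (intro set_eqI iffI)
          fix w assume "w \<in> {F.app h u | u. \<exists>p\<in>F.elts g. F.opair u p \<in> F.elts (j s)}"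
          then obtain u p where up: "w = F.app h u" "p \<in> F.elts g" "F.opair u p \<in> F.elts (j s)" by blast
          from opair_mem_j[OF up(3)] obtain u' r where u': "u = j u'" "p = j r" "E.opair u' r \<in> E.elts s" by metis
          have "r \<in> G" using up(2) unfolding u'(2) elts_g by auto
          with up(1) u' app_h[OF ud[OF u'(3)]] show "w \<in> {F.ap h (j u) | u. \<exists>r\<in>G. E.opair u r \<in> E.elts s}"
            by auto
        next
          fix w assume "w \<in> {F.ap h (j u) | u. \<exists>r\<in>G. E.opair u r \<in> E.elts s}"
          then obtain u r where ur: "w = F.ap h (j u)" "r \<in> G" "E.opair u r \<in> E.elts s" by blast
          have "w = F.app h (j u)" "j r \<in> F.elts g" "F.opair (j u) (j r) \<in> F.elts (j s)"
            using ur app_h[OF ud[OF ur(3)]] by (simp_all add: elts_g)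
          then show "w \<in> {F.app h u | u. \<exists>p\<in>F.elts g. F.opair u p \<in> F.elts (j s)}" by blast
        qed
        finally show ?thesis .
      qed
      show "F.ap h (j u) = j z \<longleftrightarrow> (\<exists>p\<in>G. E.opair u (E.opair z p) \<in> E.elts e)"
        if ur: "E.opair u r \<in> E.elts s" and z: "z \<in> E.elts Y" for u r z
        using IH[OF ur] ud[OF ur] z unfolding Q_j by blast
    qed
  qed
  \<comment> \<open>A name \<open>u\<close> is not an element of \<open>s\<close> but lies below the
    pair: \<open>u \<in> {u} \<in> (u,r) \<in> s\<close>. So the induction statement also covers
    elements and elements of elements.\<close>
  define R where "R t \<longleftrightarrow> Q t \<and> (\<forall>a\<in>F.elts t. Q a \<and> (\<forall>b\<in>F.elts a. Q b))" for t
  have "R t" if "t \<in> F.elts (j dE)" for t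
  proof (rule F.set_induct[where P = R, OF _ _ that])
    show "F.dfn (\<lambda>s. R (s 0))" unfolding R_def by (intro dfi dQ)
    fix t assume t: "t \<in> F.elts (j dE)" and IH: "\<And>z. z \<in> F.elts t \<Longrightarrow> z \<in> F.elts (j dE) \<Longrightarrow> R z"
    then obtain s where s: "s \<in> E.elts dE" "t = j s" unfolding elts_j by blast
    have sub: "F.elts t \<subseteq> F.elts (j dE)" using t dE unfolding j_transitive[symmetric] F.transitive_def by blast
    have Rz: "R z" if "z \<in> F.elts t" for z using IH[OF that] sub that by blast
    have "Q (j s)"
    proof (rule main[OF s(1)])
      fix u r assume "E.opair u r \<in> E.elts s"
      then have "F.opair (j u) (j r) \<in> F.elts t" unfolding s(2) by simp
      then have "R (F.opair (j u) (j r))" by (rule Rz)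
      moreover have "F.upair (j u) (j u) \<in> F.elts (F.opair (j u) (j r))" unfolding F.opair_upair by simp
      moreover have "j u \<in> F.elts (F.upair (j u) (j u))" by simp
      ultimately show "Q (j u)" unfolding R_def by blast
    qed
    then show "R t" using Rz unfolding R_def s(2) by blast
  qed
  then have "Q (j s)" using s(1) unfolding R_def by simp
  with s y show ?thesis unfolding Q_j by blast
qed

text \<open>Distributivity decides a subset of a surjective image of the reals by a single condition.\<close>
lemma no_new_subsets:
  assumes dist: "E.distributive P le" and X: "E.Rsmall X" and A: "F.elts A \<subseteq> F.elts (j X)"
  shows "\<exists>B. A = j B \<and> E.elts B \<subseteq> E.elts X"
proof -
  obtain t where "F.name_value g (j t) A" using names by blast
  then obtain d h where d: "F.transitive d" and td: "j t \<in> F.elts d" and h: "F.fun_on h d"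
    and val: "\<forall>v\<in>F.elts d. F.elts (F.app h v) = {F.app h u | u. \<exists>p\<in>F.elts g. F.opair u p \<in> F.elts v}"
    and At: "F.app h (j t) = A"
    unfolding F.name_value_def by blast
  obtain dE where dE: "E.transitive dE" "t \<in> E.elts dE" using E.ex_transitive by blast
  \<comment> \<open>\<open>truth\<close> is about values in a transitive set; the elements of
    \<open>X\<close> are the values of interest.\<close>
  define Y where "Y = E.trcl X"
  have Y: "E.transitive Y" "E.elts X \<subseteq> E.elts Y" unfolding Y_def by (rule E.transitive_trcl E.trcl_superset)+
  obtain e where e: "\<forall>t\<in>E.elts (E.prod dE (E.prod Y P)). t \<in> E.elts e \<longleftrightarrow> E.fstep le e t"
    using E.forcing_relation by blast
  note T = truth[OF dE(1) Y(1) e d h val]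
  have forces: "E.opair u (E.opair z p) \<in> E.elts e \<longleftrightarrow> E.fstep le e (E.opair u (E.opair z p))"
    if "u \<in> E.elts dE" "z \<in> E.elts Y" "p \<in> E.elts P" for u z p
    by (rule e[rule_format]) (simp add: that)
  have udE: "u \<in> E.elts dE" if "E.opair u r \<in> E.elts t" for u r
    by (rule E.transitive_opair[OF dE that])
  have ud: "j u \<in> F.elts d" if "E.opair u r \<in> E.elts t" for u r
    by (rule F.transitive_opair[OF d td, of _ "j r"]) (simp add: that)
  have down: "E.opair u (E.opair z q) \<in> E.elts e"
    if "E.opair u r \<in> E.elts t" "z \<in> E.elts Y" "leq q p" "E.opair u (E.opair z p) \<in> E.elts e" for u r z p q
    using forces[OF udE[OF that(1)] that(2)] leq_P[OF that(3)] that(4) fstep_down[OF _ that(3)] by blast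
  \<comment> \<open>\<open>S x p\<close>: the condition \<open>p\<close> witnesses that
    \<open>x\<close> belongs to the set named by \<open>t\<close>.\<close>
  define S where "S x p \<longleftrightarrow> (\<exists>u r. E.opair u r \<in> E.elts t \<and> leq p r \<and> E.opair u (E.opair x p) \<in> E.elts e)" for x p
  have dS: "E.dft a \<Longrightarrow> E.dft b \<Longrightarrow> E.dfn (\<lambda>s. S (a s) (b s))" for a b
    by (rule E.dfn_comp2[of S]) (simp_all only: S_def, intro dfi)
  have S_down: "S x q" if x: "x \<in> E.elts X" and "S x p" "leq q p" for x p q
    using that down Y(2) leq_trans unfolding S_def by blast
  have elts_A: "F.elts A = {F.app h u | u. \<exists>p\<in>F.elts g. F.opair u p \<in> F.elts (j t)}"
    using val td At by blast
  have A_iff: "j x \<in> F.elts A \<longleftrightarrow> (\<exists>p\<in>G. S x p)" if x: "x \<in> E.elts X" for x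
  proof
    have xY: "x \<in> E.elts Y" using x Y(2) by blast
    assume "j x \<in> F.elts A"
    then obtain u p where up: "F.app h u = j x" "p \<in> F.elts g" "F.opair u p \<in> F.elts (j t)" unfolding elts_A by auto
    from opair_mem_j[OF up(3)] obtain u' r where u': "u = j u'" "p = j r" "E.opair u' r \<in> E.elts t" by metis
    have rG: "r \<in> G" using up(2) unfolding u'(2) elts_g by auto
    have "F.ap h (j u') = j x" using up(1) F.app_eq_ap[OF h ud[OF u'(3)]] u'(1) by simp
    then obtain p' where p': "p' \<in> G" "E.opair u' (E.opair x p') \<in> E.elts e"
      using T[OF udE[OF u'(3)] ud[OF u'(3)] xY] by blast
    obtain q where q: "q \<in> G" "leq q p'" "leq q r" using G_directed[OF p'(1) rG] by blast
    have "S x q" unfolding S_def using u'(3) q(3) down[OF u'(3) xY q(2) p'(2)] by blast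
    with q(1) show "\<exists>p\<in>G. S x p" by blast
  next
    have xY: "x \<in> E.elts Y" using x Y(2) by blast
    assume "\<exists>p\<in>G. S x p"
    then obtain p u r where p: "p \<in> G" "E.opair u r \<in> E.elts t" "leq p r" "E.opair u (E.opair x p) \<in> E.elts e"
      unfolding S_def by blast
    have "F.ap h (j u) = j x" using T[OF udE[OF p(2)] ud[OF p(2)] xY] p(1,4) by blast
    then have "j x = F.app h (j u)" using F.app_eq_ap[OF h ud[OF p(2)]] by simp
    moreover have "j r \<in> F.elts g" "F.opair (j u) (j r) \<in> F.elts (j t)"
      using G_up[OF p(1,3)] p(2) by (simp_all add: elts_g)
    ultimately show "j x \<in> F.elts A" unfolding elts_A by blast
  qed
  obtain f where f: "\<And>x. x \<in> E.elts X \<Longrightarrow> \<exists>z\<in>E.elts E.reals. E.ap f z = x"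
    using X unfolding E.Rsmall_def by blast
  \<comment> \<open>\<open>q\<close> decides whether the element coded by the real \<open>z\<close>
    belongs to the set. For each \<open>z\<close> this is open and dense, so distributivity yields
    one member of \<open>G\<close> that decides all elements of \<open>X\<close>.\<close>
  define D where "D q z \<longleftrightarrow> E.ap f z \<notin> E.elts X \<or> S (E.ap f z) q \<or> (\<forall>q'. leq q' q \<longrightarrow> \<not> S (E.ap f z) q')" for q z
  have dD: "E.dft a \<Longrightarrow> E.dft b \<Longrightarrow> E.dfn (\<lambda>s. D (a s) (b s))" for a b
    by (rule E.dfn_comp2[of D]) (simp_all only: D_def, intro dfi dS)
  have D_open: "D q z" if "D p z" "leq q p" for p q z
    using that S_down leq_trans unfolding D_def by blast
  have D_dense: "\<exists>q. leq q p \<and> D q z" if "p \<in> E.elts P" for p z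
    using leq_refl[OF that] leq_refl leq_P unfolding D_def by meson
  define b where "b = E.sep (E.prod P E.reals) (\<lambda>w. D (E.fst' w) (E.snd' w))"
  have b: "E.elts b = {w \<in> E.elts (E.prod P E.reals). D (E.fst' w) (E.snd' w)}"
    unfolding b_def by (rule E.elts_sep) (intro dfi dD)
  have b_iff: "E.opair q z \<in> E.elts b \<longleftrightarrow> q \<in> E.elts P \<and> z \<in> E.elts E.reals \<and> D q z" for q z
    unfolding b by auto
  have "\<forall>z\<in>E.elts E.reals. (\<forall>p\<in>E.elts P. \<exists>q\<in>E.elts P. leq q p \<and> E.opair q z \<in> E.elts b) \<and>
      (\<forall>p q. leq q p \<longrightarrow> E.opair p z \<in> E.elts b \<longrightarrow> E.opair q z \<in> E.elts b)"
    unfolding b_iff using D_dense D_open leq_P by blast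
  then have "\<forall>p\<in>E.elts P. \<exists>q\<in>E.elts P. leq q p \<and> (\<forall>z\<in>E.elts E.reals. E.opair q z \<in> E.elts b)"
    using dist unfolding E.distributive_def by blast
  then have below: "\<exists>q. leq q p \<and> (\<forall>z\<in>E.elts E.reals. D q z)" if "p \<in> E.elts P" for p
    using that unfolding b_iff by blast
  have "\<exists>q\<in>G. \<forall>z\<in>E.elts E.reals. D q z"
  proof (rule G_dense)
    show "E.dfn (\<lambda>s. \<forall>z\<in>E.elts E.reals. D (s 0) z)" by (intro dfi dD)
  qed (rule below)
  then obtain q where q: "q \<in> G" "\<And>z. z \<in> E.elts E.reals \<Longrightarrow> D q z" by blast
  define B where "B = E.sep X (\<lambda>x. S x q)"
  have B: "E.elts B = {x \<in> E.elts X. S x q}"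
    unfolding B_def by (rule E.elts_sep) (intro dfi dS)
  have iff: "j x \<in> F.elts A \<longleftrightarrow> S x q" if x: "x \<in> E.elts X" for x
  proof
    assume "S x q"
    with q(1) show "j x \<in> F.elts A" unfolding A_iff[OF x] by blast
  next
    assume "j x \<in> F.elts A"
    then obtain p where p: "p \<in> G" "S x p" unfolding A_iff[OF x] by blast
    obtain z where z: "z \<in> E.elts E.reals" "E.ap f z = x" using f[OF x] by blast
    obtain r where r: "leq r p" "leq r q" using G_directed[OF p(1) q(1)] by blast
    have "S x r" using S_down[OF x p(2) r(1)] .
    with q(2)[OF z(1)] r(2) x show "S x q" unfolding D_def z(2) by blast
  qed
  have "A = j B"
  proof (rule F.elts_eqI)
    fix w
    show "w \<in> F.elts A \<longleftrightarrow> w \<in> F.elts (j B)"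
    proof
      assume w: "w \<in> F.elts A"
      then obtain x where "x \<in> E.elts X" "w = j x" using A unfolding elts_j by blast
      with w iff show "w \<in> F.elts (j B)" by (simp add: B)
    next
      assume "w \<in> F.elts (j B)"
      then obtain x where "x \<in> E.elts X" "S x q" "w = j x" unfolding elts_j B by blast
      with iff show "w \<in> F.elts A" by blast
    qed
  qed
  with B show ?thesis by blast
qed

section \<open>Determinacy in the extension\<close>

context
  assumes dist: "E.distributive P le"
begin

text \<open>A real of the extension is a subset of \<open>omega\<close> times \<open>omega\<close>,
  an \<open>Rsmall\<close> set, hence comes from the ground model.\<close>

lemma j_reals: "F.reals = j E.reals"
proof (rule F.elts_eqI)
  fix x
  show "x \<in> F.elts F.reals \<longleftrightarrow> x \<in> F.elts (j E.reals)"
  proof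
    assume "x \<in> F.elts F.reals"
    then have m: "F.maps x (j E.omega) (j E.omega)" unfolding F.reals_iff j_omega .
    have "E.Rsmall (E.prod E.omega E.omega)" by (intro E.Rsmall_prod E.Rsmall_omega)
    from no_new_subsets[OF dist this, of x] obtain y where y: "x = j y"
      using F.maps_prod[OF m] unfolding j_prod by blast
    have "E.maps y E.omega E.omega" using m unfolding y by (rule maps_j)
    then show "x \<in> F.elts (j E.reals)" unfolding y by (simp add: E.reals_iff)
  next
    assume "x \<in> F.elts (j E.reals)"
    then obtain y where "y \<in> E.elts E.reals" "x = j y" unfolding elts_j by blast
    then show "x \<in> F.elts F.reals" unfolding F.reals_iff E.reals_iff j_omega using j_maps by blast
  qed
qed

lemma j_finite_seqs: "F.finite_seqs F.omega = j (E.finite_seqs E.omega)"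
proof (rule F.elts_eqI)
  fix x
  show "x \<in> F.elts (F.finite_seqs F.omega) \<longleftrightarrow> x \<in> F.elts (j (E.finite_seqs E.omega))"
  proof
    assume "x \<in> F.elts (F.finite_seqs F.omega)"
    then obtain n where n: "n \<in> F.elts F.omega" "F.maps x n F.omega" unfolding F.elts_finite_seqs by blast
    from n(1) obtain k where k: "k \<in> E.elts E.omega" "n = j k" unfolding j_omega elts_j by blast
    have m: "F.maps x (j k) (j E.omega)" using n(2) unfolding k(2) j_omega .
    have "E.Rsmall k" using E.Rsmall_omega by (rule E.Rsmall_subset) (rule E.omega_subset[OF k(1)])
    then have "E.Rsmall (E.prod k E.omega)" by (intro E.Rsmall_prod E.Rsmall_omega)
    from no_new_subsets[OF dist this, of x] obtain y where y: "x = j y"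
      using F.maps_prod[OF m] unfolding j_prod by blast
    have "E.maps y k E.omega" using m unfolding y by (rule maps_j)
    with k(1) show "x \<in> F.elts (j (E.finite_seqs E.omega))" unfolding y by (auto simp: E.elts_finite_seqs)
  next
    assume "x \<in> F.elts (j (E.finite_seqs E.omega))"
    then obtain y k where "k \<in> E.elts E.omega" "E.maps y k E.omega" "x = j y"
      unfolding elts_j E.elts_finite_seqs by blast
    then show "x \<in> F.elts (F.finite_seqs F.omega)"
      unfolding F.elts_finite_seqs j_omega using j_maps j_mem by blast
  qed
qed

text \<open>Evenness quantifies over all sets of the model, and \<open>F\<close> has more of them.
  Only the intersection with \<open>omega\<close> matters, and that is a ground model set.\<close>

lemma j_even_nat: "n \<in> E.elts E.omega \<Longrightarrow> F.even_nat (j n) \<longleftrightarrow> E.even_nat n"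
proof
  assume n: "n \<in> E.elts E.omega" and ev: "F.even_nat (j n)"
  show "E.even_nat n"
    unfolding E.even_nat_def
  proof (intro allI impI)
    fix e assume e: "E.zero \<in> E.elts e \<and> (\<forall>k\<in>E.elts e. E.suc (E.suc k) \<in> E.elts e)"
    then have "F.zero \<in> F.elts (j e) \<and> (\<forall>k\<in>F.elts (j e). F.suc (F.suc k) \<in> F.elts (j e))"
      unfolding j_zero by (auto simp: elts_j[of e] j_suc inj_image_mem_iff inj_j)
    then have "j n \<in> F.elts (j e)" using ev unfolding F.even_nat_def by blast
    then show "n \<in> E.elts e" by simp
  qed
next
  assume n: "n \<in> E.elts E.omega" and ev: "E.even_nat n"
  show "F.even_nat (j n)"
    unfolding F.even_nat_def
  proof (intro allI impI)
    fix e assume e: "F.zero \<in> F.elts e \<and> (\<forall>k\<in>F.elts e. F.suc (F.suc k) \<in> F.elts e)"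
    define A where "A = F.sep (j E.omega) (\<lambda>k. k \<in> F.elts e)"
    have A: "F.elts A = {k \<in> F.elts (j E.omega). k \<in> F.elts e}"
      unfolding A_def by (rule F.elts_sep) (intro dfi)
    then obtain B where B: "A = j B" "E.elts B \<subseteq> E.elts E.omega"
      using no_new_subsets[OF dist E.Rsmall_omega, of A] by blast
    have B_iff: "k \<in> E.elts B \<longleftrightarrow> k \<in> E.elts E.omega \<and> j k \<in> F.elts e" for k
    proof -
      have "k \<in> E.elts B \<longleftrightarrow> j k \<in> F.elts A" unfolding B(1) by simp
      also have "\<dots> \<longleftrightarrow> k \<in> E.elts E.omega \<and> j k \<in> F.elts e" unfolding A by simp
      finally show ?thesis .
    qed
    have "E.zero \<in> E.elts B" using e unfolding B_iff j_zero by simp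
    moreover have "\<forall>k\<in>E.elts B. E.suc (E.suc k) \<in> E.elts B"
    proof
      fix k assume "k \<in> E.elts B"
      then have "k \<in> E.elts E.omega" "j k \<in> F.elts e" unfolding B_iff by blast+
      with e show "E.suc (E.suc k) \<in> E.elts B" unfolding B_iff j_suc[symmetric] by simp
    qed
    ultimately have "n \<in> E.elts B" using ev unfolding E.even_nat_def by blast
    then show "j n \<in> F.elts e" unfolding B_iff by blast
  qed
qed

lemma j_app: "E.fun_on f a \<Longrightarrow> x \<in> E.elts a \<Longrightarrow> F.app (j f) (j x) = j (E.app f x)"
  using F.app_eq_ap[OF j_fun_on] E.app_eq_ap j_ap by simp

lemma j_plays:
  assumes "E.maps f (E.finite_seqs E.omega) E.omega" and x: "x \<in> E.elts E.reals" and n: "n \<in> E.elts E.omega"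
  shows "F.app (j x) (j n) = F.app (j f) (F.restr (j x) (j n)) \<longleftrightarrow> E.app x n = E.app f (E.restr x n)"
proof -
  have "E.fun_on x E.omega" using x unfolding E.reals_iff E.maps_iff by blast
  moreover have "E.fun_on f (E.finite_seqs E.omega)" using assms(1) unfolding E.maps_iff by blast
  ultimately show ?thesis
    using j_app[OF _ n] j_app[OF _ E.initial_seq[OF x n]] unfolding j_restr by simp
qed

text \<open>The payoff sets, plays and positions are those of the ground model, so a winning
  strategy of the ground model still wins.\<close>

lemma AD_extension:
  assumes E.AD
  shows F.AD
  unfolding F.AD_def
proof (intro allI impI)
  fix A assume "F.elts A \<subseteq> F.elts F.reals"
  then have "F.elts A \<subseteq> F.elts (j E.reals)" unfolding j_reals .
  from no_new_subsets[OF dist E.Rsmall_reals this] obtain B where B: "A = j B" "E.elts B \<subseteq> E.elts E.reals" by blast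
  have "E.determined E.omega (E.elts B)" using assms B(2) unfolding E.AD_def by blast
  then show "F.determined F.omega (F.elts A)"
    unfolding E.determined_def F.determined_def F.reals_def[symmetric] E.reals_def[symmetric]
  proof (elim disjE exE conjE)
    fix f
    assume f: "E.maps f (E.finite_seqs E.omega) E.omega" and win: "\<forall>x\<in>E.elts E.reals.
      (\<forall>n\<in>E.elts E.omega. E.even_nat n \<longrightarrow> E.app x n = E.app f (E.restr x n)) \<longrightarrow> x \<in> E.elts B"
    have "F.maps (j f) (F.finite_seqs F.omega) F.omega"
      using j_maps[OF f] unfolding j_finite_seqs unfolding j_omega .
    moreover have "x \<in> F.elts A" if x: "x \<in> F.elts F.reals"
      and play: "\<forall>n\<in>F.elts F.omega. F.even_nat n \<longrightarrow> F.app x n = F.app (j f) (F.restr x n)" for x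
    proof -
      obtain y where y: "y \<in> E.elts E.reals" "x = j y" using x unfolding j_reals elts_j by blast
      have "E.app y n = E.app f (E.restr y n)" if n: "n \<in> E.elts E.omega" "E.even_nat n" for n
        using play[rule_format, of "j n"] n j_plays[OF f y(1) n(1)] j_even_nat[OF n(1)] unfolding j_omega y(2) by simp
      with win y(1) have "y \<in> E.elts B" by blast
      then show ?thesis unfolding B(1) y(2) by simp
    qed
    ultimately show "(\<exists>\<sigma>. F.maps \<sigma> (F.finite_seqs F.omega) F.omega \<and> (\<forall>x\<in>F.elts F.reals.
        (\<forall>n\<in>F.elts F.omega. F.even_nat n \<longrightarrow> F.app x n = F.app \<sigma> (F.restr x n)) \<longrightarrow> x \<in> F.elts A)) \<or>
      (\<exists>\<sigma>. F.maps \<sigma> (F.finite_seqs F.omega) F.omega \<and> (\<forall>x\<in>F.elts F.reals.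
        (\<forall>n\<in>F.elts F.omega. \<not> F.even_nat n \<longrightarrow> F.app x n = F.app \<sigma> (F.restr x n)) \<longrightarrow> x \<notin> F.elts A))"
      by blast
  next
    fix f
    assume f: "E.maps f (E.finite_seqs E.omega) E.omega" and win: "\<forall>x\<in>E.elts E.reals.
      (\<forall>n\<in>E.elts E.omega. \<not> E.even_nat n \<longrightarrow> E.app x n = E.app f (E.restr x n)) \<longrightarrow> x \<notin> E.elts B"
    have "F.maps (j f) (F.finite_seqs F.omega) F.omega"
      using j_maps[OF f] unfolding j_finite_seqs unfolding j_omega .
    moreover have "x \<notin> F.elts A" if x: "x \<in> F.elts F.reals"
      and play: "\<forall>n\<in>F.elts F.omega. \<not> F.even_nat n \<longrightarrow> F.app x n = F.app (j f) (F.restr x n)" for x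
    proof -
      obtain y where y: "y \<in> E.elts E.reals" "x = j y" using x unfolding j_reals elts_j by blast
      have "E.app y n = E.app f (E.restr y n)" if n: "n \<in> E.elts E.omega" "\<not> E.even_nat n" for n
        using play[rule_format, of "j n"] n j_plays[OF f y(1) n(1)] j_even_nat[OF n(1)] unfolding j_omega y(2) by simp
      with win y(1) have "y \<notin> E.elts B" by blast
      then show ?thesis unfolding B(1) y(2) by simp
    qed
    ultimately show "(\<exists>\<sigma>. F.maps \<sigma> (F.finite_seqs F.omega) F.omega \<and> (\<forall>x\<in>F.elts F.reals.
        (\<forall>n\<in>F.elts F.omega. F.even_nat n \<longrightarrow> F.app x n = F.app \<sigma> (F.restr x n)) \<longrightarrow> x \<in> F.elts A)) \<or>
      (\<exists>\<sigma>. F.maps \<sigma> (F.finite_seqs F.omega) F.omega \<and> (\<forall>x\<in>F.elts F.reals.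
        (\<forall>n\<in>F.elts F.omega. \<not> F.even_nat n \<longrightarrow> F.app x n = F.app \<sigma> (F.restr x n)) \<longrightarrow> x \<notin> F.elts A))"
      by blast
  qed
qed

end

end

theorem theorem5p1:
  fixes E :: "'a \<Rightarrow> 'a \<Rightarrow> bool"
  assumes "set_structure.ZF E"
    and "set_structure.AD_plus E"
    and "set_structure.V_eq_L_over E (set_structure.powerset E (set_structure.reals E))"
    and "set_structure.regular E (set_structure.Theta E)"
  shows "\<exists>le. set_structure.poset E (set_structure.Theta E) le \<and>
    (\<forall>G F j. set_structure.generic_filter E (set_structure.Theta E) le G \<and>
             generic_extension E G F j \<longrightarrow>
      (\<exists>A. set_structure.elts F A \<subseteq> set_structure.elts F (j (set_structure.Theta E)) \<and>
           A \<notin> range j) \<and>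
      set_structure.AD F)"
proof -
  interpret E: zf E by unfold_locales (rule assms(1))
  have AD: E.AD using E.AD_plus_AD[OF assms(2)] .
  obtain le where le: "E.poset E.Theta le" "E.splitting E.Theta le" "E.distributive E.Theta le"
    using E.poset_on_Theta[OF assms(3) AD assms(4)] by blast
  have "(\<exists>A. set_structure.elts F A \<subseteq> set_structure.elts F (j E.Theta) \<and> A \<notin> range j) \<and> set_structure.AD F"
    if G: "E.generic_filter E.Theta le G" and ext: "generic_extension E G F j" for G F j
  proof -
    obtain g where g: "set_structure.elts F g = j ` G" "\<And>x. \<exists>t. set_structure.name_value F g (j t) x"
      using ext unfolding generic_extension_def by blast
    interpret forcing_extension E F j E.Theta le G g
      by unfold_locales (use ext le(1) G g in \<open>simp_all add: generic_extension_def\<close>)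
    \<comment> \<open>The new subset of Theta is the generic filter itself.\<close>
    have "F.elts g \<subseteq> F.elts (j E.Theta)" using G_P by (auto simp: elts_g)
    with new_set[OF le(2)] AD_extension[OF le(3) AD] show ?thesis by blast
  qed
  with le(1) show ?thesis by blast
qed

end
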